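(* Let $\mathcal X,\mathcal Y$ be real separable Hilbert spaces and $A:\mathcal X\to\mathcal Y$ a bounded linear operator with $\|A\|_{\mathrm{op}}\le1$. Let $X,\varepsilon$ be random variables with values in $\mathcal X$ and $\mathcal Y$ respectively, and let $Y=AX+\varepsilon$ almost surely. Assume: (i) $\mathbb E[\varepsilon|X]=0$ and there is $\tau>0$ with $\mathbb E[\|\varepsilon\|_{\mathcal Y}^2|X]\le\tau^2$; (ii) $\|X\|_{\mathcal X}\le1$ a.s., and there exist a random variable $Z$ with values in $\mathcal X$ and constants $\beta,s>0$ such that $X=(A^*A)^sZ$ and $\mathbb E[\|Z\|_{\mathcal X}^2]\le\beta^2$; (iii) $(g_\lambda)_{\lambda>0}$ is a family of functions $g_\lambda:(0,1]\to\mathbb R$ for which there are constants $C_1,C_2,\alpha>0$ such that, for all $\lambda\in(0,+\infty)$, $$\sup_{\sigma\in(0,1]}|g_\lambda(\sigma)\sqrt\sigma|\le\frac{C_1}{\sqrt\lambda},\qquad \sup_{\sigma\in(0,1]}|(1-g_\lambda(\sigma)\sigma)\sigma^s|\le C_2\lambda^\alpha,$$ with $s$ as in (ii); (iv) $\Lambda=\{\lambda_1,\dots,\lambda_N\}$ with $N\ge2$, $0<\lambda_1\le\dots\le\lambda_N<\infty$, $\lambda_j=\lambda_1Q^{j-1}$ for $j=1,\dots,N$, where $Q=(\lambda_N/\lambda_1)^{1/(N-1)}$, and $\lambda_*\in[\lambda_1,\lambda_N]$, where $$\lambda_*=\left(\frac{C_1^2}{2\alpha C_2^2}\right)^{1/(2\alpha+1)}\left(\frac{\tau}{\beta}\right)^{2/(2\alpha+1)}.$$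 Let $X_\lambda=f_\lambda(Y)$ with $f_\lambda(y)=g_\lambda(A^*A)A^*y$. Let $(Y_i,X_i)_{i=1}^n$ be independent copies of $(Y,X)$, put $X_\lambda^i=f_\lambda(Y_i)$, and let $$\widehat\lambda_\Lambda\in\arg\min_{\lambda\in\Lambda}\frac1n\sum_{i=1}^n\|TX_\lambda^i-X_i\|_{\mathcal X}^2 .$$ Let $\eta\in(0,1)$. Then, with probability at least $1-\eta$, $$L(X_{\widehat\lambda_\Lambda})\le\frac{2(2\alpha+Q^{2\alpha+1})}{Q}\left[\left(\frac{C_1^2}{2\alpha}\right)^{2\alpha}C_2^2\right]^{1/(2\alpha+1)}\left(\tau^{2\alpha}\beta\right)^{2/(2\alpha+1)}+\frac{26}{n}\log\frac{2N}{\eta}.$$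
   Context: The truncation operator $T:\mathcal X\to\mathcal X$ is $Tx=x$ if $\|x\|_{\mathcal X}\le1$ and $Tx=x/\|x\|_{\mathcal X}$ if $\|x\|_{\mathcal X}>1$. The loss is $\ell(x,x')=\|Tx-Tx'\|_{\mathcal X}^2$, and the expected risk is $L(X_\lambda)=L(f_\lambda)=\mathbb E[\|Tf_\lambda(Y)-TX\|_{\mathcal X}^2]$. The parameter $\widehat\lambda_\Lambda$ is a random variable depending on the sample, and $L(X_{\widehat\lambda_\Lambda})$ denotes the value of the deterministic function $\lambda\mapsto L(X_\lambda)$ at $\lambda=\widehat\lambda_\Lambda$; the probability is with respect to the sample. The operator $g_\lambda(A^*A)A^*$ is the bounded operator defined through the spectral (Borel functional) calculus of the self-adjoint operator $A^*A$, whose spectrum lies in $[0,1]$; the functions $g_\lambda$ are Borel measurable. The value assigned to $g_\lambda$ at $0$ is irrelevant, since the range of $A^*$ is orthogonal to $\ker A$. $(A^*A)^s$ is also defined by spectral calculus. *)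

theory Defs
  imports "HOL-Probability.Probability"
begin

section \<open>Borel functional calculus of a bounded self-adjoint operator\<close>

text \<open>
  Only the values on Borel sets are meaningful. Idempotence of the operators \<open>E S\<close> is the
  multiplicativity law with \<open>S = T\<close>, and \<open>E {} = 0\<close> follows from countable additivity in the
  strong operator topology.
\<close>

definition projection_valued_measure :: "(real set \<Rightarrow> 'a \<Rightarrow> 'a::real_inner) \<Rightarrow> bool" where
  "projection_valued_measure E \<longleftrightarrow>
     (\<forall>S\<in>sets borel. bounded_linear (E S) \<and> (\<forall>x y. E S x \<bullet> y = x \<bullet> E S y)) \<and>
     (\<forall>x. E UNIV x = x) \<and>
     (\<forall>S\<in>sets borel. \<forall>T\<in>sets borel. \<forall>x. E S (E T x) = E (S \<inter> T) x) \<and>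
     (\<forall>S :: nat \<Rightarrow> real set. range S \<subseteq> sets borel \<longrightarrow> disjoint_family S \<longrightarrow>
        (\<forall>x. (\<lambda>i. E (S i) x) sums E (\<Union>i. S i) x))"

definition scalar_spectral_measure :: "(real set \<Rightarrow> 'a \<Rightarrow> 'a::real_inner) \<Rightarrow> 'a \<Rightarrow> real measure" where
  "scalar_spectral_measure E x = measure_of UNIV (sets borel) (\<lambda>S. ennreal (E S x \<bullet> x))"

text \<open>
  \<open>E\<close> resolves \<open>B\<close> if it has compact support and \<open>B = \<integral> \<sigma> dE(\<sigma>)\<close>. For a self-adjoint operator it is
  enough to state the latter for the quadratic form.
\<close>

definition resolves :: "(real set \<Rightarrow> 'a \<Rightarrow> 'a::real_inner) \<Rightarrow> ('a \<Rightarrow> 'a) \<Rightarrow> bool" where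
  "resolves E B \<longleftrightarrow>
     projection_valued_measure E \<and>
     (\<exists>r. \<forall>x. E {-r..r} x = x) \<and>
     (\<forall>x. B x \<bullet> x = (\<integral>\<sigma>. \<sigma> \<partial>scalar_spectral_measure E x))"

text \<open>
  By the spectral theorem a resolution exists for every bounded self-adjoint operator \<open>B\<close> on a
  Hilbert space, and its values on Borel sets are unique.
\<close>

definition spectral_resolution :: "('a \<Rightarrow> 'a::real_inner) \<Rightarrow> real set \<Rightarrow> 'a \<Rightarrow> 'a" where
  "spectral_resolution B = (SOME E. resolves E B)"

text \<open>For bounded Borel \<open>f\<close>, the self-adjoint operator \<open>\<integral> f(\<sigma>) dE(\<sigma>)\<close>.\<close>

definition bounded_spectral_integral ::
    "(real set \<Rightarrow> 'a \<Rightarrow> 'a::real_inner) \<Rightarrow> (real \<Rightarrow> real) \<Rightarrow> 'a \<Rightarrow> 'a" where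
  "bounded_spectral_integral E f =
     (THE T. bounded_linear T \<and> (\<forall>x y. T x \<bullet> y = x \<bullet> T y) \<and>
             (\<forall>x. T x \<bullet> x = (\<integral>\<sigma>. f \<sigma> \<partial>scalar_spectral_measure E x)))"

text \<open>
  For a Borel function \<open>f\<close>, possibly unbounded, \<open>f(B) x\<close> is the limit of \<open>f\<^sub>n(B) x\<close> with
  \<open>f\<^sub>n = f \<cdot> 1{\<bar>f\<bar> \<le> n}\<close>. The limit exists exactly for \<open>x\<close> in the domain of \<open>f(B)\<close>, that is, if
  \<open>f\<close> is square integrable for the scalar spectral measure at \<open>x\<close>; outside of this domain
  the value is unspecified.
\<close>

definition borel_calculus :: "(real \<Rightarrow> real) \<Rightarrow> ('a \<Rightarrow> 'a::real_inner) \<Rightarrow> 'a \<Rightarrow> 'a" where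
  "borel_calculus f B x =
     lim (\<lambda>n. bounded_spectral_integral (spectral_resolution B)
                (\<lambda>\<sigma>. if \<bar>f \<sigma>\<bar> \<le> real n then f \<sigma> else 0) x)"

section \<open>Spectral regularisation and truncated risk\<close>

text \<open>
  \<open>g\<close> is only given on \<open>(0,1]\<close>. It is extended by \<open>0\<close>; as the spectrum of \<open>A\<^sup>*A\<close> lies in
  \<open>[0,1]\<close> only the value at \<open>0\<close> could matter, and it does not because the range of \<open>A\<^sup>*\<close> is
  orthogonal to the kernel of \<open>A\<close>. Although \<open>g(A\<^sup>*A)\<close> may be unbounded, the range of \<open>A\<^sup>*\<close> lies in
  its domain whenever \<open>g(\<sigma>)\<surd>\<sigma>\<close> is bounded on \<open>(0,1]\<close>.
\<close>

definition spectral_reconstruction ::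
    "('a::real_inner \<Rightarrow> 'b::real_inner) \<Rightarrow> (real \<Rightarrow> real) \<Rightarrow> 'b \<Rightarrow> 'a" where
  "spectral_reconstruction A g y =
     borel_calculus (\<lambda>\<sigma>. if \<sigma> \<in> {0<..1} then g \<sigma> else 0) (adjoint A \<circ> A) (adjoint A y)"

definition operator_power :: "('a \<Rightarrow> 'a::real_inner) \<Rightarrow> real \<Rightarrow> 'a \<Rightarrow> 'a" where
  "operator_power B s = borel_calculus (\<lambda>\<sigma>. \<sigma> powr s) B"

definition truncation :: "'a \<Rightarrow> 'a::real_normed_vector" where
  "truncation x = (if norm x \<le> 1 then x else x /\<^sub>R norm x)"

definition trunc_loss :: "'a::real_normed_vector \<Rightarrow> 'a \<Rightarrow> real" where
  "trunc_loss x x' = (norm (truncation x - truncation x'))\<^sup>2"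

definition expected_risk ::
    "'w measure \<Rightarrow> ('w \<Rightarrow> 'a::real_normed_vector) \<Rightarrow> ('w \<Rightarrow> 'b) \<Rightarrow> ('b \<Rightarrow> 'a) \<Rightarrow> real" where
  "expected_risk M X Y f = (\<integral>\<omega>. trunc_loss (f (Y \<omega>)) (X \<omega>) \<partial>M)"

text \<open>The sample is indexed by \<open>1, \<dots>, n\<close>; the signals \<open>x i\<close> are not truncated.\<close>

definition empirical_risk ::
    "nat \<Rightarrow> (nat \<Rightarrow> 'a::real_normed_vector) \<Rightarrow> (nat \<Rightarrow> 'b) \<Rightarrow> ('b \<Rightarrow> 'a) \<Rightarrow> real" where
  "empirical_risk n x y f = 1 / real n * (\<Sum>i=1..n. (norm (truncation (f (y i)) - x i))\<^sup>2)"

section \<open>Conditional expectation of vector-valued random variables\<close>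

text \<open>
  The library's \<open>real_cond_exp\<close> and \<open>nn_cond_exp\<close> only cover scalar functions. The predicate says
  that \<open>h\<close> is a version of \<open>E[f | F]\<close>.
\<close>

definition has_cond_exp ::
    "'w measure \<Rightarrow> 'w measure \<Rightarrow> ('w \<Rightarrow> 'a::{banach, second_countable_topology}) \<Rightarrow> ('w \<Rightarrow> 'a) \<Rightarrow> bool"
  where
  "has_cond_exp M F f h \<longleftrightarrow>
     subalgebra M F \<and> integrable M f \<and> integrable M h \<and> h \<in> borel_measurable F \<and>
     (\<forall>S\<in>sets F. (LINT \<omega>:S|M. f \<omega>) = (LINT \<omega>:S|M. h \<omega>))"

definition sigma_gen :: "'w measure \<Rightarrow> ('w \<Rightarrow> 'a::topological_space) \<Rightarrow> 'w measure" where
  "sigma_gen M X = vimage_algebra (space M) X borel"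

end

theory Submission
  imports Defs
begin

text \<open>
  The calculus of \<open>A\<^sup>*A\<close> turns the assumptions on \<open>g\<close> into operator bounds: \<open>R = g(A\<^sup>*A) A\<^sup>*\<close> has norm at
  most \<open>C1 / \<surd>\<lambda>\<close>, and \<open>\<parallel>R A X - X\<parallel> \<le> C2 \<lambda>\<^sup>\<alpha> \<parallel>Z\<parallel>\<close>. As \<open>X\<close> lies in the unit ball, truncation only
  decreases the error, and the cross term vanishes by \<open>E[\<epsilon>|X] = 0\<close>, so
  \<open>L(\<lambda>) \<le> C2\<^sup>2 \<beta>\<^sup>2 \<lambda>\<^sup>2\<^sup>\<alpha> + C1\<^sup>2 \<tau>\<^sup>2 / \<lambda>\<close>. Both terms are balanced at \<open>lamstar\<close>, and some grid point is
  \<open>q lamstar\<close> with \<open>1 \<le> q \<le> Q\<close>; the bound increases in \<open>q \<ge> 1\<close>.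

  For the selection step, the losses \<open>W\<close> have values in \<open>[0,4]\<close>, so \<open>E[exp(\<kappa> W / 4)] \<le> exp((e\<^sup>\<kappa> - 1) L / 4)\<close>.
  With \<open>\<kappa> = - ln 2\<close> at every grid point and \<open>\<kappa> = ln 2\<close> at one of them, a union bound over at most \<open>2 N\<close>
  events gives \<open>L(\<lambda>hat) \<le> 2 L(\<lambda>) + (16 / n) ln (2 N / \<eta>)\<close>.

  For the spectral theorem of an operator \<open>0 \<le> B \<le> 1\<close>, the projections \<open>P\<^sub>t\<close> onto the kernels of
  the positive parts of \<open>B - t\<close> form a right-continuous monotone family, whose Stieltjes measures
  \<open>\<langle>P\<^sub>t x, x\<rangle>\<close> extend to a projection-valued measure.
\<close>

section \<open>Self-adjoint operators on a Hilbert space\<close>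

text \<open>The definitions rest on \<open>SOME\<close> and \<open>THE\<close>, so nothing can be
  computed before a resolution is known to exist and an operator is known to be determined by its
  quadratic form. The second fact, \<open>selfadj_eqI\<close>, reduces nearly every operator
  identity below to an identity of scalar integrals. The calculus is developed for an arbitrary
  resolution, so it does not matter which one \<open>SOME\<close> picks. The filter may blow up at
  0, so applying it to \<open>adjoint A \<circ> A\<close> need not give a bounded operator; only the
  composition with the adjoint is controlled, by duality with \<open>A\<close>. With
  \<open>\<kappa> = \<plusminus> ln 2\<close> the factors \<open>(e^\<kappa> - 1) / 4\<close> have
  sizes 1/4 and 1/8, whose ratio is the 2 in front of the risk at the comparison point. Since the
  exponential moment is bounded through the mean \<open>L\<close>, the deviation is of order
  1/n.\<close>

lemma linear_coefficient_zero:
  fixes d q :: real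
  assumes "\<And>t. 0 \<le> 2 * t * d + t\<^sup>2 * q"
  shows "d = 0"
proof -
  \<comment> \<open>A positive majorant of \<open>q\<close>, so that \<open>- d / p\<close> is a
    step downhill even if \<open>q \<le> 0\<close>.\<close>
  define p where "p = \<bar>q\<bar> + 1"
  have p: "p > 0" "q \<le> p" by (auto simp: p_def)
  have "0 \<le> 2 * (- d / p) * d + (- d / p)\<^sup>2 * q" by (rule assms)
  also have "\<dots> \<le> 2 * (- d / p) * d + (- d / p)\<^sup>2 * p"
    using p by (intro add_left_mono mult_left_mono) auto
  also have "\<dots> = - d\<^sup>2 / p" using p by (simp add: field_simps power2_eq_square)
  finally show ?thesis using p by (simp add: field_simps)
qed

text \<open>The minimiser over \<open>M\<close> of \<open>\<parallel>x\<parallel>\<^sup>2 - 2 \<phi> x\<close> represents \<open>\<phi>\<close>.\<close>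

lemma riesz_on_closed_subspace:
  fixes \<phi> :: "'a::{real_inner,banach} \<Rightarrow> real"
  assumes \<phi>: "bounded_linear \<phi>" and M: "subspace M" "closed M"
  obtains x where "x \<in> M" "\<And>y. y \<in> M \<Longrightarrow> \<phi> y = x \<bullet> y"
proof -
  interpret phi: bounded_linear \<phi> by fact
  obtain K where K: "\<And>x. norm (\<phi> x) \<le> norm x * K" using phi.bounded by blast
  define J where "J x = x \<bullet> x - 2 * \<phi> x" for x
  \<comment> \<open>Completing the square: \<open>J x\<close> is at least
    \<open>(norm x - K)^2 - K^2\<close>.\<close>
  have Jlow: "- K\<^sup>2 \<le> J x" for x
  proof -
    have "\<phi> x \<le> norm x * K" using K[of x] by simp
    moreover have "0 \<le> (norm x - K)\<^sup>2" by simp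
    ultimately show ?thesis
      unfolding J_def by (simp add: power2_diff power2_norm_eq_inner)
  qed
  define m where "m = Inf (J ` M)"
  have M0: "0 \<in> M" using M by (simp add: subspace_0)
  have m_le: "m \<le> J x" if "x \<in> M" for x
    unfolding m_def using that Jlow by (intro cINF_lower) (auto intro!: bdd_belowI2)
  have "\<exists>x. x \<in> M \<and> J x < m + 1 / real (Suc n)" for n
  proof -
    have "Inf (J ` M) < m + 1 / real (Suc n)" by (simp add: m_def)
    then have "\<exists>z\<in>J ` M. z < m + 1 / real (Suc n)"
      using M0 Jlow by (subst (asm) cInf_less_iff) (auto intro!: bdd_belowI2)
    then show ?thesis by blast
  qed
  then obtain x where xM: "\<And>n. x n \<in> M" and xJ: "\<And>n. J (x n) < m + 1 / real (Suc n)"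
    by metis
  \<comment> \<open>The parallelogram law, in which the linear part of \<open>J\<close> cancels. As
    \<open>J \<ge> m\<close> at the midpoint, near-minimisers are close to each other.\<close>
  have par: "(norm (a - b))\<^sup>2 = 2 * J a + 2 * J b - 4 * J ((1/2) *\<^sub>R (a + b))" for a b
    unfolding J_def power2_norm_eq_inner
    by (simp add: phi.add phi.scaleR inner_add inner_diff inner_commute algebra_simps)
  have mid: "(1/2) *\<^sub>R (a + b) \<in> M" if "a \<in> M" "b \<in> M" for a b
    using M that by (intro subspace_scale subspace_add)
  have "Cauchy x"
  proof (rule metric_CauchyI)
    fix e :: real assume e: "0 < e"
    obtain k where k: "4 / e\<^sup>2 < real k" using reals_Archimedean2 by blast
    then have k': "4 < e\<^sup>2 * real k" using e by (simp add: field_simps)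
    show "\<exists>k. \<forall>i\<ge>k. \<forall>j\<ge>k. dist (x i) (x j) < e"
    proof (intro exI[of _ k] allI impI)
      fix i j assume ij: "k \<le> i" "k \<le> j"
      have kpos: "0 < k" using k' e by (cases k) auto
      have one: "1 / real (Suc l) \<le> 1 / real k" if "k \<le> l" for l
        using that kpos by (intro divide_left_mono) auto
      have "(norm (x i - x j))\<^sup>2 \<le> 2 * (1 / real k) + 2 * (1 / real k)"
        unfolding par using xJ[of i] xJ[of j] m_le[OF mid[OF xM xM], of i j]
          one[OF ij(1)] one[OF ij(2)] by linarith
      also have "\<dots> < e\<^sup>2" using k' kpos by (simp add: field_simps)
      finally show "dist (x i) (x j) < e"
        using e by (simp add: dist_norm power2_less_imp_less)
    qed
  qed
  then obtain l where l: "x \<longlonglongrightarrow> l" using Cauchy_convergent convergent_def by blast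
  have lM: "l \<in> M" using M(2) xM l by (rule closed_sequentially)
  have "(\<lambda>n. J (x n)) \<longlonglongrightarrow> J l"
    unfolding J_def by (intro tendsto_intros phi.tendsto l)
  moreover have "(\<lambda>n. m + 1 / real (Suc n)) \<longlonglongrightarrow> m + 0"
    by (intro tendsto_intros LIMSEQ_Suc[OF lim_1_over_n])
  ultimately have "J l \<le> m + 0"
    by (rule LIMSEQ_le) (use xJ in \<open>auto intro: less_imp_le\<close>)
  then have min: "J l \<le> J y" if "y \<in> M" for y using m_le[OF that] by simp
  have "\<phi> y = l \<bullet> y" if y: "y \<in> M" for y
  proof -
    \<comment> \<open>Minimality of \<open>l\<close> along the line \<open>l + t y\<close>.\<close>
    have "0 \<le> 2 * t * (l \<bullet> y - \<phi> y) + t\<^sup>2 * (y \<bullet> y)" for t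
    proof -
      have "J l \<le> J (l + t *\<^sub>R y)" using M lM y by (intro min subspace_add subspace_scale)
      then show ?thesis
        unfolding J_def
        by (simp add: phi.add phi.scaleR inner_add inner_commute algebra_simps power2_eq_square)
    qed
    then show ?thesis using linear_coefficient_zero by fastforce
  qed
  then show ?thesis using that lM by blast
qed

lemma riesz_representation:
  fixes \<phi> :: "'a::{real_inner,banach} \<Rightarrow> real"
  assumes "bounded_linear \<phi>"
  obtains x where "\<And>y. \<phi> y = x \<bullet> y"
proof (rule riesz_on_closed_subspace[OF assms subspace_UNIV closed_UNIV])
  fix x assume "\<And>y. y \<in> UNIV \<Longrightarrow> \<phi> y = x \<bullet> y"
  then show thesis by (intro that) simp
qed

text \<open>\<open>adjoint\<close> is a Hilbert choice; the Riesz representation of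
  \<open>x \<mapsto> A x \<bullet> y\<close>, available by completeness of the domain, shows that
  there is something to choose.\<close>

lemma adjoint_inner:
  fixes A :: "'a::{real_inner,banach} \<Rightarrow> 'b::real_inner"
  assumes "bounded_linear A"
  shows "A x \<bullet> y = x \<bullet> adjoint A y"
proof -
  interpret bounded_linear A by fact
  have "\<exists>z. \<forall>x. A x \<bullet> y = x \<bullet> z" for y
  proof -
    have "bounded_linear (\<lambda>x. A x \<bullet> y)"
      using bounded_linear_compose[OF bounded_linear_inner_left assms] .
    then show ?thesis by (rule riesz_representation) (metis inner_commute)
  qed
  then have "\<exists>f. \<forall>x y. A x \<bullet> y = x \<bullet> f y" by metis
  then show ?thesis unfolding adjoint_def by (rule someI2_ex) blast
qed

lemma bounded_linear_adjoint:
  fixes A :: "'a::{real_inner,banach} \<Rightarrow> 'b::real_inner"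
  assumes A: "bounded_linear A"
  shows "bounded_linear (adjoint A)"
proof -
  note adj = adjoint_inner[OF A]
  have eq: "u = v" if "\<And>x. x \<bullet> u = x \<bullet> v" for u v :: 'a
    using that vector_eq_ldot by blast
  obtain K where K: "\<And>x. norm (A x) \<le> norm x * K" "0 < K" using bounded_linear.pos_bounded[OF A] by blast
  show ?thesis
  proof (rule bounded_linear_intro)
    show "adjoint A (x + y) = adjoint A x + adjoint A y" for x y
      by (rule eq) (simp add: inner_add_right flip: adj)
    show "adjoint A (r *\<^sub>R x) = r *\<^sub>R adjoint A x" for r x
      by (rule eq) (simp flip: adj)
    show "norm (adjoint A y) \<le> norm y * K" for y
    proof -
      \<comment> \<open>The square is traded for an inner product with \<open>y\<close>, where the
        bound of \<open>A\<close> applies; one factor is cancelled afterwards.\<close>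
      have "(norm (adjoint A y))\<^sup>2 = A (adjoint A y) \<bullet> y" by (simp add: adj power2_norm_eq_inner)
      also have "\<dots> \<le> norm (A (adjoint A y)) * norm y" by (rule norm_cauchy_schwarz)
      also have "\<dots> \<le> norm (adjoint A y) * K * norm y" using K by (intro mult_right_mono) auto
      finally have "norm (adjoint A y) * norm (adjoint A y) \<le> norm (adjoint A y) * (norm y * K)"
        by (simp add: power2_eq_square mult_ac)
      then show ?thesis using K by (cases "norm (adjoint A y) = 0") (auto simp: mult_le_cancel_left)
    qed
  qed
qed

section \<open>Algebra, order and strong limits of self-adjoint operators\<close>

definition selfadj :: "('a \<Rightarrow> 'a::real_inner) \<Rightarrow> bool" where
  "selfadj T \<longleftrightarrow> bounded_linear T \<and> (\<forall>x y. T x \<bullet> y = x \<bullet> T y)"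

lemma selfadjD:
  assumes "selfadj T"
  shows "bounded_linear T" "T x \<bullet> y = x \<bullet> T y"
  using assms by (auto simp: selfadj_def)

lemma selfadj_simps:
  assumes "selfadj T"
  shows "T (x + y) = T x + T y" "T (x - y) = T x - T y" "T (r *\<^sub>R x) = r *\<^sub>R T x" "T 0 = 0"
    "T (- x) = - T x"
  using linear_simps[OF selfadjD(1)[OF assms]] by auto

lemma selfadj_sum:
  assumes "selfadj T"
  shows "T (\<Sum>i\<in>I. f i) = (\<Sum>i\<in>I. T (f i))"
  by (rule linear_sum[OF bounded_linear.linear[OF selfadjD(1)[OF assms]]])

lemma selfadj_tendsto:
  assumes "selfadj T" "(f \<longlongrightarrow> l) F"
  shows "((\<lambda>n. T (f n)) \<longlongrightarrow> T l) F"
  using bounded_linear.tendsto[OF selfadjD(1)[OF assms(1)] assms(2)] .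

lemma selfadj_zero: "selfadj (\<lambda>_. 0)"
  by (simp add: selfadj_def)

lemma selfadj_ident: "selfadj (\<lambda>x. x)"
  by (simp add: selfadj_def)

lemma selfadj_add: "selfadj S \<Longrightarrow> selfadj T \<Longrightarrow> selfadj (\<lambda>x. S x + T x)"
  by (auto simp: selfadj_def inner_add bounded_linear_add)

lemma selfadj_diff: "selfadj S \<Longrightarrow> selfadj T \<Longrightarrow> selfadj (\<lambda>x. S x - T x)"
  by (auto simp: selfadj_def inner_diff bounded_linear_sub)

lemma selfadj_scaleR: "selfadj S \<Longrightarrow> selfadj (\<lambda>x. c *\<^sub>R S x)"
  by (auto simp: selfadj_def bounded_linear_const_scaleR)

lemma selfadj_sumI: "(\<And>i. i \<in> I \<Longrightarrow> selfadj (T i)) \<Longrightarrow> selfadj (\<lambda>x. \<Sum>i\<in>I. T i x)"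
  by (auto simp: selfadj_def bounded_linear_sum inner_sum_left inner_sum_right)

lemma selfadj_comp:
  assumes "selfadj S" "selfadj T" "\<And>x. S (T x) = T (S x)"
  shows "selfadj (\<lambda>x. S (T x))"
  unfolding selfadj_def
  using bounded_linear_compose[OF selfadjD(1)[OF assms(1)] selfadjD(1)[OF assms(2)]]
    selfadjD(2)[OF assms(1)] selfadjD(2)[OF assms(2)] assms(3)
  by simp

text \<open>Polarisation at a single point: if the form of the symmetric operator
  \<open>D = S - T\<close> vanishes, its value at \<open>x + D x\<close> is
  \<open>2 * (D x \<bullet> D x)\<close>. Symmetry is what makes this true over the reals.\<close>

lemma selfadj_eqI:
  assumes S: "selfadj S" and T: "selfadj T" and eq: "\<And>x. S x \<bullet> x = T x \<bullet> x"
  shows "S x = T x"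
proof -
  let ?D = "\<lambda>x. S x - T x"
  have D: "selfadj ?D" using S T by (rule selfadj_diff)
  have D0: "?D x \<bullet> x = 0" for x by (simp add: inner_diff eq)
  have "?D (x + ?D x) \<bullet> (x + ?D x) = ?D x \<bullet> x + 2 * (?D x \<bullet> ?D x) + ?D (?D x) \<bullet> ?D x"
    unfolding selfadj_simps(1)[OF D] inner_add using selfadjD(2)[OF D, of "?D x" x] by simp
  then have "?D x \<bullet> ?D x = 0" unfolding D0 by simp
  then show ?thesis by simp
qed

text \<open>A zero of a nonnegative form is a minimum of it; the first-order condition in the
  direction \<open>D y\<close> gives \<open>D y \<bullet> D y = 0\<close>.\<close>

lemma selfadj_positive_null:
  assumes D: "selfadj D" and pos: "\<And>x. 0 \<le> D x \<bullet> x" and y: "D y \<bullet> y = 0"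
  shows "D y = 0"
proof -
  have "0 \<le> 2 * t * (D y \<bullet> D y) + t\<^sup>2 * (D (D y) \<bullet> D y)" for t
  proof -
    have "0 \<le> D (y + t *\<^sub>R D y) \<bullet> (y + t *\<^sub>R D y)" by (rule pos)
    then show ?thesis
      unfolding selfadj_simps[OF D] inner_add inner_scaleR_left inner_scaleR_right y
        selfadjD(2)[OF D, of "D y" y]
      by (simp add: power2_eq_square algebra_simps)
  qed
  then have "D y \<bullet> D y = 0" by (rule linear_coefficient_zero)
  then show ?thesis by simp
qed

text \<open>Expand \<open>0 \<le> \<langle>D (x - D x), x - D x\<rangle>\<close>.\<close>

lemma selfadj_contraction_square:
  assumes D: "selfadj D" and pos: "\<And>x. 0 \<le> D x \<bullet> x" and le: "\<And>x. D x \<bullet> x \<le> x \<bullet> x"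
  shows "D x \<bullet> D x \<le> D x \<bullet> x"
proof -
  have "0 \<le> D (x - D x) \<bullet> (x - D x)" by (rule pos)
  also have "\<dots> = D x \<bullet> x - 2 * (D x \<bullet> D x) + D (D x) \<bullet> D x"
    unfolding selfadj_simps[OF D] inner_diff selfadjD(2)[OF D, of "D x" x] by simp
  finally show ?thesis using le[of "D x"] by simp
qed

lemma selfadj_limit:
  fixes T :: "nat \<Rightarrow> 'a \<Rightarrow> 'a::real_inner"
  assumes T: "\<And>n. selfadj (T n)" and lim: "\<And>x. (\<lambda>n. T n x) \<longlonglongrightarrow> L x"
    and bd: "\<And>n x. norm (T n x) \<le> norm x * K"
  shows "selfadj L"
  unfolding selfadj_def
proof (intro conjI allI)
  show "bounded_linear L"
  proof (rule bounded_linear_intro)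
    show "L (x + y) = L x + L y" for x y
      using LIMSEQ_unique[OF lim[of "x + y"]] tendsto_add[OF lim[of x] lim[of y]]
      by (simp add: selfadj_simps[OF T])
    show "L (r *\<^sub>R x) = r *\<^sub>R L x" for r x
      using LIMSEQ_unique[OF lim[of "r *\<^sub>R x"]] tendsto_scaleR[OF tendsto_const lim[of x], of r]
      by (simp add: selfadj_simps[OF T])
    show "norm (L x) \<le> norm x * K" for x
      using bd by (intro tendsto_upperbound[OF tendsto_norm[OF lim[of x]]]) auto
  qed
  fix x y
  have "(\<lambda>n. T n x \<bullet> y) \<longlonglongrightarrow> L x \<bullet> y" by (intro tendsto_intros lim)
  moreover have "(\<lambda>n. T n x \<bullet> y) \<longlonglongrightarrow> x \<bullet> L y"
    unfolding selfadjD(2)[OF T] by (intro tendsto_intros lim)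
  ultimately show "L x \<bullet> y = x \<bullet> L y" by (rule LIMSEQ_unique)
qed

text \<open>For \<open>m \<le> n\<close> the increment \<open>T n - T m\<close> lies between 0 and
  1, so \<open>selfadj_contraction_square\<close> bounds its squared norm at \<open>x\<close> by the
  increment of the scalar sequence \<open>T n x \<bullet> x\<close>, which is monotone and
  bounded.\<close>

lemma selfadj_monotone_limit:
  fixes T :: "nat \<Rightarrow> 'a \<Rightarrow> 'a::{real_inner,banach}"
  assumes T: "\<And>n. selfadj (T n)" and inc: "\<And>n x. T n x \<bullet> x \<le> T (Suc n) x \<bullet> x"
    and pos: "\<And>n x. 0 \<le> T n x \<bullet> x" and le: "\<And>n x. T n x \<bullet> x \<le> x \<bullet> x"
  obtains L where "selfadj L" "\<And>x. (\<lambda>n. T n x) \<longlonglongrightarrow> L x"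
proof -
  have mono: "T m x \<bullet> x \<le> T n x \<bullet> x" if "m \<le> n" for m n x
    using lift_Suc_mono_le[of "\<lambda>n. T n x \<bullet> x"] inc that by blast
  have key: "(norm (T m x - T n x))\<^sup>2 \<le> \<bar>T m x \<bullet> x - T n x \<bullet> x\<bar>" for m n x
  proof -
    have *: "(norm (T n x - T m x))\<^sup>2 \<le> \<bar>T n x \<bullet> x - T m x \<bullet> x\<bar>" if "m \<le> n" for m n
    proof -
      have "(T n x - T m x) \<bullet> (T n x - T m x) \<le> (T n x - T m x) \<bullet> x"
      proof (rule selfadj_contraction_square[of "\<lambda>x. T n x - T m x"])
        show "selfadj (\<lambda>x. T n x - T m x)" by (intro selfadj_diff T)
        show "0 \<le> (T n x - T m x) \<bullet> x" for x using mono[OF that] by (simp add: inner_diff)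
        show "(T n x - T m x) \<bullet> x \<le> x \<bullet> x" for x
          using le[of n x] pos[of m x] by (simp add: inner_diff)
      qed
      then show ?thesis by (simp add: power2_norm_eq_inner inner_diff_left)
    qed
    show ?thesis
      using *[of m n] *[of n m] by (cases "m \<le> n") (auto simp: norm_minus_commute abs_minus_commute)
  qed
  have "Cauchy (\<lambda>n. T n x)" for x
  proof (rule metric_CauchyI)
    fix e :: real assume e: "0 < e"
    have "convergent (\<lambda>n. T n x \<bullet> x)"
      using Bseq_mono_convergent[of "\<lambda>n. T n x \<bullet> x"] mono le pos
      by (intro Bseq_monoseq_convergent BseqI'[of _ "x \<bullet> x"]) (auto simp: monoseq_def)
    then have "Cauchy (\<lambda>n. T n x \<bullet> x)" by (rule convergent_Cauchy)
    then obtain k where k: "\<And>m n. m \<ge> k \<Longrightarrow> n \<ge> k \<Longrightarrow> \<bar>T m x \<bullet> x - T n x \<bullet> x\<bar> < e\<^sup>2"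
      using e unfolding Cauchy_def dist_real_def by (meson zero_less_power)
    then show "\<exists>k. \<forall>m\<ge>k. \<forall>n\<ge>k. dist (T m x) (T n x) < e"
      using key e by (intro exI[of _ k])
        (auto simp: dist_norm intro!: power2_less_imp_less[of _ e] order.strict_trans1[OF key])
  qed
  then have "\<exists>l. (\<lambda>n. T n x) \<longlonglongrightarrow> l" for x
    using Cauchy_convergent convergent_def by blast
  then obtain L where L: "\<And>x. (\<lambda>n. T n x) \<longlonglongrightarrow> L x" by metis
  have "selfadj L"
  proof (rule selfadj_limit[OF T L])
    fix n x
    have "(norm (T n x))\<^sup>2 \<le> x \<bullet> x"
      using selfadj_contraction_square[OF T pos le, of n x] le[of n x]
      by (simp add: power2_norm_eq_inner)
    then show "norm (T n x) \<le> norm x * 1" by (simp add: norm_eq_sqrt_inner)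
  qed
  then show ?thesis using that L by blast
qed

text \<open>The projection of \<open>x\<close> is the Riesz representative, within \<open>M\<close>,
  of the functional \<open>y \<mapsto> x \<bullet> y\<close>.\<close>

lemma orthogonal_projection:
  fixes M :: "'a::{real_inner,banach} set"
  assumes M: "subspace M" "closed M"
  obtains P where "selfadj P" "\<And>x. P x \<in> M" "\<And>x y. y \<in> M \<Longrightarrow> (x - P x) \<bullet> y = 0"
    "\<And>x. x \<in> M \<Longrightarrow> P x = x"
proof -
  have "\<exists>p\<in>M. \<forall>y\<in>M. (x - p) \<bullet> y = 0" for x
    using riesz_on_closed_subspace[OF bounded_linear_inner_right[of x] M]
    by (metis inner_diff_left right_minus_eq)
  then obtain P where P: "\<And>x. P x \<in> M" "\<And>x y. y \<in> M \<Longrightarrow> (x - P x) \<bullet> y = 0" by metis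
  \<comment> \<open>Uniqueness of the orthogonal decomposition yields both the linearity of
    \<open>P\<close> and \<open>P x = x\<close> on \<open>M\<close>.\<close>
  have uniq: "p = P x" if "p \<in> M" "\<And>y. y \<in> M \<Longrightarrow> (x - p) \<bullet> y = 0" for p x
  proof -
    have d: "p - P x \<in> M" using that P M by (intro subspace_diff)
    have "(p - P x) \<bullet> (p - P x) = (x - P x) \<bullet> (p - P x) - (x - p) \<bullet> (p - P x)"
      by (simp add: algebra_simps)
    also have "\<dots> = 0" using P(2)[OF d] that(2)[OF d] by simp
    finally show ?thesis by simp
  qed
  have inner: "P x \<bullet> y = P x \<bullet> P y" for x y
    using P(2)[OF P(1)[of x], of y] by (simp add: inner_diff inner_commute)
  have "selfadj P"
    unfolding selfadj_def
  proof (intro conjI allI)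
    show "bounded_linear P"
    proof (rule bounded_linear_intro)
      show "P (x + y) = P x + P y" for x y
        using P M by (intro uniq[symmetric] subspace_add)
          (auto simp: add_diff_add inner_add_left)
      show "P (r *\<^sub>R x) = r *\<^sub>R P x" for r x
        using P M by (intro uniq[symmetric] subspace_scale)
          (auto simp flip: scaleR_diff_right)
      show "norm (P x) \<le> norm x * 1" for x
      proof -
        have "(norm (P x))\<^sup>2 = P x \<bullet> x" using inner[of x x] by (simp add: power2_norm_eq_inner)
        also have "\<dots> \<le> norm (P x) * norm x" by (rule norm_cauchy_schwarz)
        finally show ?thesis
          by (cases "norm (P x) = 0") (auto simp: power2_eq_square mult_le_cancel_left)
      qed
    qed
    show "P x \<bullet> y = x \<bullet> P y" for x y
      using inner[of x y] inner[of y x] by (simp add: inner_commute)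
  qed
  moreover have "P x = x" if "x \<in> M" for x using uniq[OF that, of x] by simp
  ultimately show ?thesis using that P by blast
qed

section \<open>Spectral theorem for positive contractions\<close>

text \<open>With \<open>R\<^sub>0 = S\<close> and \<open>R\<^sub>k\<^sub>+\<^sub>1 = R\<^sub>k - R\<^sub>k\<^sup>2\<close> one has \<open>S = \<Sum>\<^sub>k R\<^sub>k\<^sup>2\<close> strongly, so \<open>S T\<close> is a sum of
  the positive operators \<open>R\<^sub>k T R\<^sub>k\<close>.\<close>

lemma commuting_positive_product:
  fixes S T :: "'a \<Rightarrow> 'a::{real_inner,banach}"
  assumes S: "selfadj S" "\<And>x. 0 \<le> S x \<bullet> x" "\<And>x. S x \<bullet> x \<le> x \<bullet> x"
    and T: "selfadj T" "\<And>x. 0 \<le> T x \<bullet> x" and ST: "\<And>x. S (T x) = T (S x)"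
  shows "0 \<le> S (T x) \<bullet> x"
proof -
  define R where "R n = ((\<lambda>D x. D x - D (D x)) ^^ n) S" for n
  have R0: "R 0 = S" by (simp add: R_def)
  have RS: "R (Suc n) x = R n x - R n (R n x)" for n x by (simp add: R_def)
  have R: "selfadj (R n) \<and> (\<forall>x. 0 \<le> R n x \<bullet> x) \<and> (\<forall>x. R n x \<bullet> x \<le> x \<bullet> x) \<and>
    (\<forall>x. R n (T x) = T (R n x))" for n
  proof (induction n)
    case 0
    then show ?case using S ST by (simp add: R0)
  next
    case (Suc n)
    then have sa: "selfadj (R n)" and pos: "\<And>x. 0 \<le> R n x \<bullet> x" and le: "\<And>x. R n x \<bullet> x \<le> x \<bullet> x"
      and comm: "\<And>x. R n (T x) = T (R n x)" by auto
    have form: "R (Suc n) x \<bullet> x = R n x \<bullet> x - R n x \<bullet> R n x" for x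
      by (simp add: RS inner_diff_left selfadjD(2)[OF sa])
    have "selfadj (R (Suc n))"
      using selfadj_diff[OF sa selfadj_comp[OF sa sa]] by (simp add: RS[abs_def])
    moreover have "0 \<le> R (Suc n) x \<bullet> x" for x
      using selfadj_contraction_square[OF sa pos le, of x] by (simp add: form)
    moreover have "R (Suc n) x \<bullet> x \<le> x \<bullet> x" for x
      using le[of x] inner_ge_zero[of "R n x"] unfolding form by linarith
    moreover have "R (Suc n) (T x) = T (R (Suc n) x)" for x
      by (simp add: RS comm selfadj_simps[OF T(1)])
    ultimately show ?case by blast
  qed
  then have sa: "\<And>n. selfadj (R n)" and pos: "\<And>n x. 0 \<le> R n x \<bullet> x"
    and comm: "\<And>n x. R n (T x) = T (R n x)" by auto
  have sum: "(\<Sum>k<n. R k (R k x)) = S x - R n x" for n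
    by (induction n) (auto simp: R0 RS)
  have "(\<Sum>k<n. R k x \<bullet> R k x) = S x \<bullet> x - R n x \<bullet> x" for n
  proof -
    have "(\<Sum>k<n. R k x \<bullet> R k x) = (\<Sum>k<n. R k (R k x)) \<bullet> x"
      by (simp add: inner_sum_left selfadjD(2)[OF sa])
    then show ?thesis by (simp add: sum inner_diff_left)
  qed
  \<comment> \<open>The partial sums stay below \<open>S x \<bullet> x\<close> because the remainder
    \<open>R n\<close> is positive. Hence the terms tend to 0, which is the strong convergence of
    \<open>R k\<close> to 0.\<close>
  then have "(\<Sum>k<n. R k x \<bullet> R k x) \<le> S x \<bullet> x" for n using pos[of n x] by simp
  then have "summable (\<lambda>k. R k x \<bullet> R k x)" by (intro summableI_nonneg_bounded) auto
  then have "(\<lambda>k. R k x \<bullet> R k x) \<longlonglongrightarrow> 0" by (rule summable_LIMSEQ_zero)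
  then have "(\<lambda>k. sqrt (R k x \<bullet> R k x)) \<longlonglongrightarrow> sqrt 0" by (rule tendsto_real_sqrt)
  then have "(\<lambda>k. R k x) \<longlonglongrightarrow> 0" by (simp add: norm_eq_sqrt_inner[symmetric] tendsto_norm_zero_iff)
  then have "(\<lambda>n. T x \<bullet> R n x) \<longlonglongrightarrow> T x \<bullet> 0" by (intro tendsto_intros)
  \<comment> \<open>Commutation turns each summand into
    \<open>T (R k x) \<bullet> R k x \<ge> 0\<close>; only the remainder may be negative, and it
    vanishes in the limit.\<close>
  moreover have "T x \<bullet> R n x \<le> S (T x) \<bullet> x" for n
  proof -
    have "S x = (\<Sum>k<n. R k (R k x)) + R n x" by (simp add: sum)
    then have "S (T x) \<bullet> x = T x \<bullet> (\<Sum>k<n. R k (R k x)) + T x \<bullet> R n x"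
      by (simp add: selfadjD(2)[OF S(1)] inner_add_right)
    also have "T x \<bullet> (\<Sum>k<n. R k (R k x)) = (\<Sum>k<n. T (R k x) \<bullet> R k x)"
      by (simp add: inner_sum_right comm flip: selfadjD(2)[OF sa])
    finally show ?thesis using T(2) by (simp add: sum_nonneg)
  qed
  ultimately have "T x \<bullet> 0 \<le> S (T x) \<bullet> x" by (intro LIMSEQ_le_const2) auto
  then show ?thesis by simp
qed

text \<open>\<open>S\<close> is the absolute value of \<open>C = 2 D - 1\<close>. Writing \<open>S = 1 - L\<close>, the equation \<open>S\<^sup>2 = C\<^sup>2\<close> becomes
  \<open>L = (A + L\<^sup>2) / 2\<close> with \<open>A = 1 - C\<^sup>2 = 4 (D - D\<^sup>2)\<close>, which is solved by monotone iteration from \<open>0\<close>.\<close>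

lemma absolute_value_operator:
  fixes D :: "'a \<Rightarrow> 'a::{real_inner,banach}"
  assumes D: "selfadj D" "\<And>x. 0 \<le> D x \<bullet> x" "\<And>x. D x \<bullet> x \<le> x \<bullet> x"
  obtains S where "selfadj S" "\<And>x. 0 \<le> S x \<bullet> x"
    "\<And>x. S (S x) = 2 *\<^sub>R D (2 *\<^sub>R D x - x) - (2 *\<^sub>R D x - x)"
    "\<And>U x. selfadj U \<Longrightarrow> (\<And>x. U (D x) = D (U x)) \<Longrightarrow> U (S x) = S (U x)"
proof -
  define A where "A x = 4 *\<^sub>R (D x - D (D x))" for x
  have A: "selfadj A"
    unfolding A_def[abs_def] by (intro selfadj_scaleR selfadj_diff selfadj_comp[OF D(1) D(1)] D refl)
  have A_form: "A x \<bullet> x = 4 * (D x \<bullet> x - D x \<bullet> D x)" for x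
    by (simp add: A_def inner_diff_left selfadjD(2)[OF D(1)])
  have A_pos: "0 \<le> A x \<bullet> x" for x
    using selfadj_contraction_square[OF D, of x] by (simp add: A_form)
  have A_sq: "(2 *\<^sub>R D x - x) \<bullet> (2 *\<^sub>R D x - x) = x \<bullet> x - A x \<bullet> x" for x
    unfolding A_form by (simp add: inner_diff inner_commute algebra_simps)
  have A_le: "A x \<bullet> x \<le> x \<bullet> x" for x
    using A_sq[of x] inner_ge_zero[of "2 *\<^sub>R D x - x"] by linarith
  define Y where "Y n = ((\<lambda>T x. (1/2) *\<^sub>R (A x + T (T x))) ^^ n) (\<lambda>_. 0)" for n
  have Y0: "Y 0 x = 0" for x by (simp add: Y_def)
  have YS: "Y (Suc n) x = (1/2) *\<^sub>R (A x + Y n (Y n x))" for n x by (simp add: Y_def)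
  have sa: "selfadj (Y n)" for n
  proof (induction n)
    case 0
    have "Y 0 = (\<lambda>_. 0)" by (simp add: Y_def)
    then show ?case by (simp add: selfadj_zero)
  next
    case (Suc n)
    have "Y (Suc n) = (\<lambda>x. (1/2) *\<^sub>R (A x + Y n (Y n x)))" by (simp add: YS fun_eq_iff)
    then show ?case using selfadj_scaleR[OF selfadj_add[OF A selfadj_comp[OF Suc Suc]]] by simp
  qed
  have Y_form: "Y (Suc n) x \<bullet> x = (A x \<bullet> x + Y n x \<bullet> Y n x) / 2" for n x
    by (simp add: YS inner_add_left selfadjD(2)[OF sa])
  have pos: "0 \<le> Y n x \<bullet> x" for n x
    by (cases n) (auto simp: Y0 Y_form A_pos)
  have le: "Y n x \<bullet> x \<le> x \<bullet> x" for n x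
  proof (induction n arbitrary: x)
    case (Suc n)
    show ?case
      using A_le[of x] selfadj_contraction_square[OF sa pos Suc, of x] Suc[of x]
      unfolding Y_form by (simp add: field_simps)
  qed (simp add: Y0)
  \<comment> \<open>Passing to the limit, the commutant of \<open>D\<close> also commutes with
    \<open>S\<close>; this is what later makes the spectral projections commute with
    \<open>B\<close> and with one another.\<close>
  have U: "U (Y n x) = Y n (U x)" if "selfadj U" "\<And>x. U (D x) = D (U x)" for U n x
  proof (induction n arbitrary: x)
    case 0
    then show ?case by (simp add: Y0 selfadj_simps(4)[OF that(1)])
  next
    case (Suc n)
    have "U (A x) = A (U x)" by (simp add: A_def that(2) selfadj_simps[OF that(1)])
    then show ?case by (simp add: YS Suc selfadj_simps[OF that(1)])
  qed
  have DY: "D (Y n x) = Y n (D x)" for n x by (rule U[OF D(1) refl])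
  have comm: "Y m (Y n x) = Y n (Y m x)" for m n x by (rule U) (use sa DY in auto)
  have inc: "Y n x \<bullet> x \<le> Y (Suc n) x \<bullet> x" for n x
  proof (induction n arbitrary: x)
    case 0
    then show ?case by (simp add: Y0 pos)
  next
    case (Suc n)
    \<comment> \<open>Difference of squares: it factors into commuting positive operators, the first
      being positive by the induction hypothesis. Half of it is the next increment.\<close>
    have "0 \<le> (\<lambda>x. Y (Suc n) x - Y n x) ((\<lambda>x. Y (Suc n) x + Y n x) x) \<bullet> x"
    proof (rule commuting_positive_product[of "\<lambda>x. Y (Suc n) x - Y n x" "\<lambda>x. Y (Suc n) x + Y n x"])
      show "selfadj (\<lambda>x. Y (Suc n) x - Y n x)" "selfadj (\<lambda>x. Y (Suc n) x + Y n x)"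
        by (intro selfadj_diff selfadj_add sa)+
      show "0 \<le> (Y (Suc n) x - Y n x) \<bullet> x" for x using Suc[of x] by (simp add: inner_diff_left)
      show "(Y (Suc n) x - Y n x) \<bullet> x \<le> x \<bullet> x" for x
        using le[of "Suc n" x] pos[of n x] by (simp add: inner_diff_left)
      show "0 \<le> (Y (Suc n) x + Y n x) \<bullet> x" for x
        using pos[of n x] pos[of "Suc n" x] by (simp add: inner_add_left)
    qed (simp add: selfadj_simps[OF sa] comm[of "Suc n" n])
    also have "\<dots> = Y (Suc n) x \<bullet> Y (Suc n) x - Y n x \<bullet> Y n x"
      by (simp add: selfadj_simps[OF sa] comm[of n "Suc n"] inner_diff_left inner_add_left
          selfadjD(2)[OF sa])
    finally show ?case unfolding Y_form[of "Suc n"] Y_form[of n] by simp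
  qed
  obtain L where L: "selfadj L" and lim: "\<And>x. (\<lambda>n. Y n x) \<longlonglongrightarrow> L x"
    using selfadj_monotone_limit[of Y, OF sa inc pos le] by blast
  \<comment> \<open>The fixed-point equation is needed for forms only; \<open>selfadj_eqI\<close>
    then lifts the resulting identity of squares to operators.\<close>
  have "L x \<bullet> x = (A x \<bullet> x + L x \<bullet> L x) / 2" for x
  proof (rule LIMSEQ_unique)
    show "(\<lambda>n. Y (Suc n) x \<bullet> x) \<longlonglongrightarrow> L x \<bullet> x"
      by (intro tendsto_intros LIMSEQ_Suc lim)
    show "(\<lambda>n. Y (Suc n) x \<bullet> x) \<longlonglongrightarrow> (A x \<bullet> x + L x \<bullet> L x) / 2"
      unfolding Y_form by (intro tendsto_intros lim) simp
  qed
  note L_form = this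
  define S where "S x = x - L x" for x
  have S: "selfadj S" unfolding S_def[abs_def] by (intro selfadj_diff selfadj_ident L)
  have C: "selfadj (\<lambda>x. 2 *\<^sub>R D x - x)" by (intro selfadj_diff selfadj_ident selfadj_scaleR D)
  show ?thesis
  proof (rule that[OF S])
    show "0 \<le> S x \<bullet> x" for x
    proof -
      have "L x \<bullet> x \<le> x \<bullet> x" using le
        by (intro tendsto_upperbound[OF tendsto_inner[OF lim[of x] tendsto_const]]) auto
      then show ?thesis by (simp add: S_def inner_diff_left)
    qed
    show "S (S x) = 2 *\<^sub>R D (2 *\<^sub>R D x - x) - (2 *\<^sub>R D x - x)" for x
    proof (rule selfadj_eqI[of "\<lambda>x. S (S x)"])
      show "selfadj (\<lambda>x. S (S x))" by (rule selfadj_comp[OF S S refl])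
      show "selfadj (\<lambda>x. 2 *\<^sub>R D (2 *\<^sub>R D x - x) - (2 *\<^sub>R D x - x))" by (rule selfadj_comp[OF C C]) simp
      fix x
      have "S (S x) \<bullet> x = S x \<bullet> S x" by (rule selfadjD(2)[OF S])
      also have "\<dots> = x \<bullet> x - 2 * (L x \<bullet> x) + L x \<bullet> L x" by (simp add: S_def inner_diff inner_commute)
      also have "\<dots> = (2 *\<^sub>R D x - x) \<bullet> (2 *\<^sub>R D x - x)" using L_form[of x] A_sq[of x] by simp
      finally show "S (S x) \<bullet> x = (2 *\<^sub>R D (2 *\<^sub>R D x - x) - (2 *\<^sub>R D x - x)) \<bullet> x"
        using selfadjD(2)[OF C, of "2 *\<^sub>R D x - x" x] by simp
    qed
    show "U (S x) = S (U x)" if u: "selfadj U" "\<And>x. U (D x) = D (U x)" for U x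
    proof -
      have "U (L x) = L (U x)"
        using selfadj_tendsto[OF u(1) lim[of x]] lim[of "U x"] unfolding U[OF u] by (rule LIMSEQ_unique)
      then show ?thesis by (simp add: S_def selfadj_simps[OF u(1)])
    qed
  qed
qed

text \<open>\<open>P\<close> is the projection onto the kernel of \<open>\<bar>C\<bar> + C\<close> for \<open>C = (B - t) / (1 + \<bar>t\<bar>)\<close>.\<close>

lemma spectral_cut:
  fixes B :: "'a \<Rightarrow> 'a::{real_inner,banach}"
  assumes B: "selfadj B" "\<And>x. 0 \<le> B x \<bullet> x" "\<And>x. B x \<bullet> x \<le> x \<bullet> x"
  obtains P where "selfadj P" "\<And>x. P (P x) = P x"
    "\<And>U x. selfadj U \<Longrightarrow> (\<And>x. U (B x) = B (U x)) \<Longrightarrow> U (P x) = P (U x)"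
    "\<And>x. P x = x \<Longrightarrow> B x \<bullet> x \<le> t * (x \<bullet> x)"
    "\<And>x. P x = 0 \<Longrightarrow> t * (x \<bullet> x) \<le> B x \<bullet> x"
    "\<And>x. B x = t *\<^sub>R x \<Longrightarrow> P x = x"
proof -
  \<comment> \<open>This scale puts \<open>C = (B - t) / c\<close> between -1 and 1, so that
    \<open>D = (1 + C) / 2\<close> is a positive contraction, as
    \<open>absolute_value_operator\<close> requires.\<close>
  define c where "c = 1 + \<bar>t\<bar>"
  have c: "c > 0" "t \<le> c" "1 - t \<le> c" by (auto simp: c_def)
  define D where "D x = (1 / (2 * c)) *\<^sub>R (B x - t *\<^sub>R x + c *\<^sub>R x)" for x
  define C where "C x = 2 *\<^sub>R D x - x" for x
  have C_eq: "C x = (1 / c) *\<^sub>R (B x - t *\<^sub>R x)" for x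
    using c by (simp add: C_def D_def scaleR_add_right scaleR_diff_right)
  have B_form: "B x \<bullet> x = t * (x \<bullet> x) + c * (C x \<bullet> x)" for x
    using c by (simp add: C_eq inner_diff_left)
  have D: "selfadj D"
    unfolding D_def[abs_def] by (intro selfadj_scaleR selfadj_add selfadj_diff selfadj_ident B)
  have C: "selfadj C"
    unfolding C_def[abs_def] by (intro selfadj_scaleR selfadj_diff selfadj_ident D)
  have D_form: "D x \<bullet> x = (B x \<bullet> x + (c - t) * (x \<bullet> x)) / (2 * c)" for x
    by (simp add: D_def inner_add_left inner_diff_left algebra_simps add_divide_distrib diff_divide_distrib)
  have D_pos: "0 \<le> D x \<bullet> x" for x
    using B(2)[of x] c by (simp add: D_form)
  have D_le: "D x \<bullet> x \<le> x \<bullet> x" for x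
  proof -
    have "B x \<bullet> x + (c - t) * (x \<bullet> x) \<le> x \<bullet> x + (c - t) * (x \<bullet> x)" using B(3) by simp
    also have "\<dots> = (1 - t + c) * (x \<bullet> x)" by (simp add: algebra_simps)
    also have "\<dots> \<le> (c + c) * (x \<bullet> x)" using c by (intro mult_right_mono) auto
    finally show ?thesis using c by (simp add: D_form field_simps)
  qed
  obtain S where S: "selfadj S" "\<And>x. 0 \<le> S x \<bullet> x" and SS: "\<And>x. S (S x) = C (C x)"
    and US: "\<And>U x. selfadj U \<Longrightarrow> (\<And>x. U (D x) = D (U x)) \<Longrightarrow> U (S x) = S (U x)"
    using absolute_value_operator[OF D D_pos D_le] unfolding C_def by metis
  define M where "M = {x. S x + C x = 0}"
  have SC: "selfadj (\<lambda>x. S x + C x)" by (intro selfadj_add S C)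
  have "subspace M"
    unfolding M_def subspace_def using selfadj_simps[OF SC] by auto
  moreover have "closed M"
    unfolding M_def using selfadjD(1)[OF SC]
    by (intro closed_Collect_eq) (auto intro: linear_continuous_on continuous_on_const)
  ultimately obtain P where P: "selfadj P" and PM: "\<And>x. P x \<in> M"
    and Porth: "\<And>x y. y \<in> M \<Longrightarrow> (x - P x) \<bullet> y = 0" and Pid: "\<And>x. x \<in> M \<Longrightarrow> P x = x"
    by (rule orthogonal_projection) blast
  have DC: "D (C x) = C (D x)" for x by (simp add: C_def selfadj_simps[OF D])
  have CS: "C (S x) = S (C x)" for x using US[OF C] DC by simp
  show ?thesis
  proof (rule that[OF P])
    show "P (P x) = P x" for x by (rule Pid[OF PM])
    show "U (P x) = P (U x)" if U: "selfadj U" "\<And>x. U (B x) = B (U x)" for U x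
    proof -
      have UD: "U (D x) = D (U x)" for x by (simp add: D_def U(2) selfadj_simps[OF U(1)])
      have UC: "U (C x) = C (U x)" for x by (simp add: C_def UD selfadj_simps[OF U(1)])
      have UM: "U y \<in> M" if "y \<in> M" for y
      proof -
        have "S (U y) + C (U y) = U (S y + C y)"
          by (simp add: US[OF U(1) UD] UC selfadj_simps[OF U(1)])
        also have "\<dots> = 0" using that by (simp add: M_def selfadj_simps(4)[OF U(1)])
        finally show ?thesis by (simp add: M_def)
      qed
      \<comment> \<open>\<open>U\<close> preserves \<open>M\<close> and hence, by symmetry, its
        orthogonal complement, so \<open>P\<close> annihilates the image of
        \<open>x - P x\<close>.\<close>
      let ?z = "U (x - P x)"
      have "P ?z \<bullet> P ?z = ?z \<bullet> P ?z - (?z - P ?z) \<bullet> P ?z" by (simp add: inner_diff_left)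
      also have "\<dots> = (x - P x) \<bullet> U (P ?z)" using Porth[OF PM] by (simp add: selfadjD(2)[OF U(1)])
      also have "\<dots> = 0" by (intro Porth UM PM)
      finally have "P ?z = 0" by simp
      then show ?thesis using Pid[OF UM[OF PM]] by (simp add: selfadj_simps[OF U(1)] selfadj_simps[OF P])
    qed
    show "B x \<bullet> x \<le> t * (x \<bullet> x)" if "P x = x" for x
    proof -
      have "S x + C x = 0" using PM[of x] that by (simp add: M_def)
      then have "C x \<bullet> x = - (S x \<bullet> x)" by (metis add_eq_0_iff inner_minus_left)
      then show ?thesis using S(2)[of x] c by (simp add: B_form)
    qed
    show "t * (x \<bullet> x) \<le> B x \<bullet> x" if x: "P x = 0" for x
    proof -
      \<comment> \<open>The product of \<open>S + C\<close> and \<open>S - C\<close> is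
        \<open>S^2 - C^2 = 0\<close>, so the range of \<open>S - C\<close> lies in \<open>M\<close>.
        A vector orthogonal to \<open>M\<close> is then in the kernel of \<open>S - C\<close>, where
        \<open>C\<close> agrees with \<open>S\<close>.\<close>
      have "S y - C y \<in> M" for y
        by (simp add: M_def selfadj_simps[OF S(1)] selfadj_simps[OF C] SS CS)
      then have "x \<bullet> (S (S x - C x) - C (S x - C x)) = 0" using Porth[of _ x] x by simp
      then have "(S x - C x) \<bullet> (S x - C x) = 0"
        by (simp add: inner_diff selfadjD(2)[OF S(1)] selfadjD(2)[OF C] selfadj_simps[OF S(1)] selfadj_simps[OF C])
      then have "C x \<bullet> x = S x \<bullet> x" by simp
      then show ?thesis using S(2)[of x] c by (simp add: B_form)
    qed
    \<comment> \<open>Eigenvectors at \<open>t\<close> itself go to the lower side, the convention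
      behind right-continuity.\<close>
    show "P x = x" if "B x = t *\<^sub>R x" for x
    proof -
      have Cx: "C x = 0" using that by (simp add: C_eq)
      have "S x \<bullet> S x = S (S x) \<bullet> x" by (rule selfadjD(2)[OF S(1), symmetric])
      then have "S x = 0" by (simp add: SS Cx selfadj_simps[OF C])
      then show ?thesis using Cx by (intro Pid) (simp add: M_def)
    qed
  qed
qed

section \<open>From a monotone family of projections to a projection-valued measure\<close>

lemma inner_le_zero_iff: "x \<bullet> x \<le> 0 \<longleftrightarrow> x = (0 :: 'a::real_inner)"
  by (metis antisym inner_ge_zero inner_eq_zero_iff)

text \<open>Dynkin's pi-lambda theorem for the half-lines, which are stable under intersection. Both
  the construction of \<open>E\<close> and its multiplicativity run by this induction.\<close>

lemma borel_induct_atMost [consumes 1, case_names atMost empty compl union]: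
  fixes S :: "real set"
  assumes "S \<in> sets borel"
    and "\<And>t. Q {..t}" and "Q {}"
    and "\<And>S. S \<in> sets borel \<Longrightarrow> Q S \<Longrightarrow> Q (- S)"
    and "\<And>S. disjoint_family S \<Longrightarrow> (\<And>i::nat. S i \<in> sets borel) \<Longrightarrow> (\<And>i. Q (S i)) \<Longrightarrow> Q (\<Union>i. S i)"
  shows "Q S"
proof -
  have borel: "sets borel = sigma_sets UNIV (range (\<lambda>a::real. {..a}))"
    by (subst borel_eq_atMost) (simp add: sets_measure_of)
  have "Int_stable (range (\<lambda>a::real. {..a}))" "range (\<lambda>a::real. {..a}) \<subseteq> Pow UNIV"
    by (auto simp: Int_stable_def Int_atMost)
  moreover have "S \<in> sigma_sets UNIV (range (\<lambda>a::real. {..a}))" using assms(1) borel by simp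
  ultimately show ?thesis
  proof (induction rule: sigma_sets_induct_disjoint)
    case (compl A)
    then have "Q (- A)" by (intro assms(4)) (auto simp: borel)
    then show ?case by (simp add: Compl_eq_Diff_UNIV)
  next
    case (union A)
    then show ?case by (intro assms(5)) (auto simp: borel image_subset_iff)
  qed (use assms in auto)
qed

text \<open>Isolates what is used of the cuts: \<open>low\<close> and \<open>high\<close> locate
  \<open>B\<close> on the range and on the kernel of \<open>P t\<close>, and \<open>ker\<close>
  decides the boundary case.\<close>

locale spectral_family =
  fixes B :: "'a \<Rightarrow> 'a::{real_inner,banach}" and P :: "real \<Rightarrow> 'a \<Rightarrow> 'a"
  assumes B: "selfadj B" and B_pos: "0 \<le> B x \<bullet> x" and B_le: "B x \<bullet> x \<le> x \<bullet> x"
    and P: "selfadj (P t)" and idem: "P t (P t x) = P t x"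
    and comm_B: "B (P t x) = P t (B x)" and comm: "P r (P t x) = P t (P r x)"
    and low: "P t x = x \<Longrightarrow> B x \<bullet> x \<le> t * (x \<bullet> x)"
    and high: "P t x = 0 \<Longrightarrow> t * (x \<bullet> x) \<le> B x \<bullet> x"
    and ker: "B x = t *\<^sub>R x \<Longrightarrow> P t x = x"
begin

lemma P_form: "P t x \<bullet> x = P t x \<bullet> P t x"
  using selfadjD(2)[OF P, of t "P t x" x] idem by simp

lemma P_neg:
  assumes "t < 0" shows "P t x = 0"
proof -
  have "0 \<le> t * (P t x \<bullet> P t x)" using low[OF idem] B_pos by (rule order_trans[rotated])
  then have "P t x \<bullet> P t x \<le> 0" using assms by (simp add: zero_le_mult_iff)
  then show ?thesis by (simp add: inner_le_zero_iff)
qed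

lemma P_top:
  assumes "t > 1" shows "P t x = x"
proof -
  let ?y = "x - P t x"
  have "t * (?y \<bullet> ?y) \<le> B ?y \<bullet> ?y" by (rule high) (simp add: selfadj_simps[OF P] idem)
  also have "\<dots> \<le> 1 * (?y \<bullet> ?y)" using B_le by simp
  finally have "(t - 1) * (?y \<bullet> ?y) \<le> 0" by (simp add: algebra_simps)
  then have "?y \<bullet> ?y \<le> 0" using assms by (simp add: mult_le_0_iff)
  then show ?thesis by (simp add: inner_le_zero_iff)
qed

text \<open>The vector \<open>P r x - P t (P r x)\<close> lies in the range of \<open>P r\<close>
  and in the kernel of \<open>P t\<close>, so \<open>low\<close> and \<open>high\<close> put its
  Rayleigh quotient below \<open>r\<close> and above \<open>t\<close>. For \<open>r < t\<close> it
  must vanish.\<close>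

lemma P_mono:
  assumes "r \<le> t" shows "P t (P r x) = P r x"
proof (cases "r = t")
  case False
  let ?y = "P r x - P t (P r x)"
  have "P r ?y = ?y" by (simp add: selfadj_simps[OF P] idem comm[of r t])
  then have "B ?y \<bullet> ?y \<le> r * (?y \<bullet> ?y)" by (rule low)
  moreover have "t * (?y \<bullet> ?y) \<le> B ?y \<bullet> ?y" by (rule high) (simp add: selfadj_simps[OF P] idem)
  ultimately have "(t - r) * (?y \<bullet> ?y) \<le> 0" by (simp add: algebra_simps)
  then have "?y \<bullet> ?y \<le> 0" using assms False by (simp add: mult_le_0_iff)
  then show ?thesis by (simp add: inner_le_zero_iff)
qed (simp add: idem)

lemma P_diff_form:
  assumes "r \<le> t" shows "(P t x - P r x) \<bullet> (P t x - P r x) = P t x \<bullet> x - P r x \<bullet> x"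
proof -
  have "P t x \<bullet> P r x = x \<bullet> P t (P r x)" by (rule selfadjD(2)[OF P])
  then have "P t x \<bullet> P r x = P r x \<bullet> x" by (simp add: P_mono[OF assms] inner_commute)
  then show ?thesis
    by (simp add: inner_diff inner_commute[of "P r x" "P t x"] P_form[symmetric])
qed

lemma F_mono: "r \<le> t \<Longrightarrow> P r x \<bullet> x \<le> P t x \<bullet> x"
  using P_diff_form[of r t x] inner_ge_zero[of "P t x - P r x"] by simp

lemma F_le: "P t x \<bullet> x \<le> x \<bullet> x"
  using F_mono[of t "max t 2" x] P_top[of "max t 2" x] by simp

text \<open>Let \<open>L\<close> be the strong limit of \<open>P (h n)\<close> as \<open>h n\<close>
  decreases to \<open>a\<close>. Then \<open>y = L x - P a x\<close> lies in the range of every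
  \<open>P (h n)\<close> and in the kernel of \<open>P a\<close>, hence
  \<open>B y \<bullet> y = a * (y \<bullet> y)\<close>. Positivity of \<open>B - a\<close> on that
  kernel upgrades this to \<open>B y = a y\<close>, and \<open>ker\<close> forces
  \<open>y = 0\<close>.\<close>

lemma F_right_continuous: "continuous (at_right a) (\<lambda>t. P t x \<bullet> x)"
proof -
  define h where "h n = a + 1 / real (Suc n)" for n
  have h: "a < h n" for n by (simp add: h_def)
  have h_dec: "h n \<le> h m" if "m \<le> n" for m n
    using that by (simp add: h_def frac_le)
  \<comment> \<open>Complements, because \<open>selfadj_monotone_limit\<close> speaks of increasing
    sequences.\<close>
  define T where "T n x = x - P (h n) x" for n x
  have T: "selfadj (T n)" for n
    unfolding T_def[abs_def] by (intro selfadj_diff selfadj_ident P)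
  have T1: "T n x \<bullet> x \<le> T (Suc n) x \<bullet> x" for n x
    using F_mono[OF h_dec[of n "Suc n"], of x] by (simp add: T_def inner_diff_left)
  have T2: "0 \<le> T n x \<bullet> x" for n x using F_le by (simp add: T_def inner_diff_left)
  have T3: "T n x \<bullet> x \<le> x \<bullet> x" for n x
    by (simp add: T_def inner_diff_left P_form)
  obtain L' where L': "selfadj L'" "\<And>x. (\<lambda>n. T n x) \<longlonglongrightarrow> L' x"
    using selfadj_monotone_limit[of T, OF T T1 T2 T3] by blast
  define L where "L x = x - L' x" for x
  have lim: "(\<lambda>n. P (h n) x) \<longlonglongrightarrow> L x" for x
  proof -
    have "(\<lambda>n. x - T n x) \<longlonglongrightarrow> L x" unfolding L_def by (intro tendsto_intros L')
    then show ?thesis by (simp add: T_def)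
  qed
  define y where "y = L x - P a x"
  have y_n: "P (h n) y = y" for n
  proof -
    have "(\<lambda>m. P (h n) (P (h m) x)) \<longlonglongrightarrow> P (h n) (L x)"
      by (rule selfadj_tendsto[OF P lim])
    moreover have "(\<lambda>m. P (h n) (P (h m) x)) \<longlonglongrightarrow> L x"
      using lim[of x] by (rule Lim_transform_eventually)
        (auto intro!: eventually_sequentiallyI[of n] simp: P_mono h_dec)
    ultimately have "P (h n) (L x) = L x" by (rule LIMSEQ_unique)
    then show ?thesis using P_mono[of a "h n"] h[of n] by (simp add: y_def selfadj_simps[OF P])
  qed
  have y_a: "P a y = 0"
  proof -
    have "(\<lambda>m. P a (P (h m) x)) \<longlonglongrightarrow> P a (L x)" by (rule selfadj_tendsto[OF P lim])
    moreover have "P a (P (h m) x) = P a x" for m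
      using P_mono[of a "h m"] h[of m] comm[of a "h m"] by simp
    ultimately have "P a (L x) = P a x" by (simp add: LIMSEQ_const_iff)
    then show ?thesis by (simp add: y_def selfadj_simps[OF P] idem)
  qed
  have "B y \<bullet> y \<le> a * (y \<bullet> y)"
  proof (rule tendsto_lowerbound[of "\<lambda>n. h n * (y \<bullet> y)"])
    have "(\<lambda>n. h n * (y \<bullet> y)) \<longlonglongrightarrow> (a + 0) * (y \<bullet> y)"
      unfolding h_def by (intro tendsto_intros LIMSEQ_Suc[OF lim_1_over_n])
    then show "(\<lambda>n. h n * (y \<bullet> y)) \<longlonglongrightarrow> a * (y \<bullet> y)" by simp
    show "\<forall>\<^sub>F n in sequentially. B y \<bullet> y \<le> h n * (y \<bullet> y)" using low[OF y_n] by simp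
  qed simp
  then have eq: "B y \<bullet> y = a * (y \<bullet> y)" using high[OF y_a] by simp
  \<comment> \<open>The operator \<open>B - a\<close> followed by \<open>1 - P a\<close>: positive
    on the whole space, as \<open>selfadj_positive_null\<close> requires, and equal to
    \<open>B - a\<close> at \<open>y\<close>.\<close>
  define D where "D z = (B z - a *\<^sub>R z) - P a (B z - a *\<^sub>R z)" for z
  have D: "selfadj D"
  proof -
    have 1: "selfadj (\<lambda>z. B z - a *\<^sub>R z)" by (intro selfadj_diff selfadj_scaleR selfadj_ident B)
    have "selfadj (\<lambda>z. P a (B z - a *\<^sub>R z))"
      by (rule selfadj_comp[OF P 1]) (simp add: selfadj_simps[OF P] comm_B)
    with 1 show ?thesis unfolding D_def[abs_def] by (rule selfadj_diff)
  qed
  have "0 \<le> D z \<bullet> z" for z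
  proof -
    let ?w = "z - P a z"
    have Pw: "P a ?w = 0" by (simp add: selfadj_simps[OF P] idem)
    have "D z = B ?w - a *\<^sub>R ?w"
      by (simp add: D_def selfadj_simps[OF P] selfadj_simps[OF B] comm_B algebra_simps)
    moreover have "(B ?w - a *\<^sub>R ?w) \<bullet> P a z = 0"
      using Pw selfadjD(2)[OF P, of a "B ?w - a *\<^sub>R ?w" z]
      by (simp add: selfadj_simps(2,3)[OF P] comm_B[symmetric] selfadj_simps(4)[OF B])
    ultimately have "D z \<bullet> z = (B ?w - a *\<^sub>R ?w) \<bullet> ?w" by (simp add: inner_diff_right)
    also have "\<dots> \<ge> 0" using high[OF Pw] by (simp add: inner_diff_left)
    finally show ?thesis .
  qed
  moreover have Dy: "D y = B y - a *\<^sub>R y"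
    using y_a comm_B[of a y] by (simp add: D_def selfadj_simps[OF P] selfadj_simps(4)[OF B])
  moreover have "D y \<bullet> y = 0" unfolding Dy using eq by (simp add: inner_diff_left)
  ultimately have "D y = 0" using selfadj_positive_null[OF D] by blast
  then have "P a y = y" using Dy by (intro ker) simp
  then have "L x = P a x" using y_a by (simp add: y_def)
  then have "(\<lambda>n. P (h n) x \<bullet> x) \<longlonglongrightarrow> P a x \<bullet> x" using lim[of x] by (intro tendsto_intros) simp
  then have "\<forall>e>0. \<exists>n. P (h n) x \<bullet> x - P a x \<bullet> x < e"
    unfolding LIMSEQ_def dist_real_def by (metis abs_less_iff order_refl)
  \<comment> \<open>For an increasing function, one point to the right of \<open>a\<close> with a
    small increment is enough.\<close>
  then have "\<forall>e>0. \<exists>d>0. P (a + d) x \<bullet> x - P a x \<bullet> x < e"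
    unfolding h_def by (meson divide_pos_pos of_nat_0_less_iff zero_less_Suc zero_less_one)
  then show ?thesis by (subst continuous_at_right_real_increasing[OF F_mono])
qed

definition \<mu> :: "'a \<Rightarrow> real measure" where
  "\<mu> x = interval_measure (\<lambda>t. P t x \<bullet> x)"

lemma sets_\<mu> [simp, measurable_cong]: "sets (\<mu> x) = sets borel"
  by (simp add: \<mu>_def)

lemma space_\<mu> [simp]: "space (\<mu> x) = UNIV"
  by (simp add: \<mu>_def)

lemma F_limits:
  "((\<lambda>t. P t x \<bullet> x) \<longlongrightarrow> 0) at_bot" "((\<lambda>t. P t x \<bullet> x) \<longlongrightarrow> x \<bullet> x) at_top"
proof -
  have "\<forall>\<^sub>F t in at_bot. 0 = P t x \<bullet> x"
    by (rule eventually_at_bot_linorderI[of "-1"]) (simp add: P_neg)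
  then show "((\<lambda>t. P t x \<bullet> x) \<longlongrightarrow> 0) at_bot" by (rule Lim_transform_eventually[OF tendsto_const])
  have "\<forall>\<^sub>F t in at_top. x \<bullet> x = P t x \<bullet> x"
    by (rule eventually_at_top_linorderI[of 2]) (simp add: P_top)
  then show "((\<lambda>t. P t x \<bullet> x) \<longlongrightarrow> x \<bullet> x) at_top" by (rule Lim_transform_eventually[OF tendsto_const])
qed

lemma finite_\<mu>: "finite_measure (\<mu> x)"
  using finite_borel_measure_interval_measure[OF F_mono F_right_continuous F_limits inner_ge_zero]
  by (simp add: \<mu>_def finite_borel_measure_def)

lemma measure_UNIV: "measure (\<mu> x) UNIV = x \<bullet> x"
  using interval_measure_UNIV[OF F_mono F_right_continuous F_limits inner_ge_zero]
  by (simp add: \<mu>_def measure_def)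

lemma measure_atMost: "measure (\<mu> x) {..t} = P t x \<bullet> x"
  unfolding \<mu>_def using F_mono F_right_continuous F_limits(1)
  by (rule measure_interval_measure_Iic)

lemma measure_compl: "S \<in> sets borel \<Longrightarrow> measure (\<mu> x) (- S) = x \<bullet> x - measure (\<mu> x) S"
  using finite_measure.finite_measure_compl[OF finite_\<mu>, of S x] measure_UNIV
  by (simp add: Compl_eq_Diff_UNIV)

text \<open>The partial sums have the measures of finite unions as forms, hence increase and stay
  below 1, and monotone operator convergence applies. Countable additivity of the scalar measures
  identifies the form of the limit.\<close>

lemma strong_sum:
  assumes disj: "disjoint_family S" and S: "\<And>i::nat. S i \<in> sets borel"
    and T: "\<And>i. selfadj (T i)" "\<And>i x. T i x \<bullet> x = measure (\<mu> x) (S i)"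
  obtains L where "selfadj L" "\<And>x. (\<lambda>i. T i x) sums L x" "\<And>x. L x \<bullet> x = measure (\<mu> x) (\<Union>i. S i)"
proof -
  define U where "U n x = (\<Sum>i<n. T i x)" for n x
  have U: "selfadj (U n)" for n unfolding U_def[abs_def] by (intro selfadj_sumI T)
  have form: "U n x \<bullet> x = measure (\<mu> x) (\<Union>i<n. S i)" for n x
  proof -
    interpret finite_measure "\<mu> x" by (rule finite_\<mu>)
    have "measure (\<mu> x) (\<Union>i<n. S i) = (\<Sum>i<n. measure (\<mu> x) (S i))"
      using disj S by (intro finite_measure_finite_Union) (auto simp: disjoint_family_on_def)
    then show ?thesis by (simp add: U_def inner_sum_left T)
  qed
  have U1: "U n x \<bullet> x \<le> U (Suc n) x \<bullet> x" for n x by (simp add: U_def inner_add_left T)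
  have U2: "0 \<le> U n x \<bullet> x" for n x by (simp add: form)
  have U3: "U n x \<bullet> x \<le> x \<bullet> x" for n x
    using finite_measure.bounded_measure[OF finite_\<mu>, of x] measure_UNIV[of x] by (simp add: form)
  obtain L where L: "selfadj L" "\<And>x. (\<lambda>n. U n x) \<longlonglongrightarrow> L x"
    using selfadj_monotone_limit[of U, OF U U1 U2 U3] by blast
  show ?thesis
  proof (rule that[OF L(1)])
    show "(\<lambda>i. T i x) sums L x" for x using L(2)[of x] by (simp add: sums_def U_def)
    show "L x \<bullet> x = measure (\<mu> x) (\<Union>i. S i)" for x
    proof -
      have "(\<lambda>n. U n x \<bullet> x) \<longlonglongrightarrow> L x \<bullet> x" by (intro tendsto_intros L)
      then have "(\<lambda>i. measure (\<mu> x) (S i)) sums (L x \<bullet> x)"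
        by (simp add: sums_def U_def inner_sum_left T)
      moreover have "(\<lambda>i. measure (\<mu> x) (S i)) sums measure (\<mu> x) (\<Union>i. S i)"
        using finite_measure.finite_measure_UNION[OF finite_\<mu>, of S x] S disj by auto
      ultimately show ?thesis by (rule sums_unique2)
    qed
  qed
qed

definition E :: "real set \<Rightarrow> 'a \<Rightarrow> 'a" where
  "E S = (SOME T. selfadj T \<and> (\<forall>x. T x \<bullet> x = measure (\<mu> x) S))"

text \<open>An operator with the required form is built along the generation of the Borel sets:
  \<open>P t\<close> for half-lines, \<open>1 - T\<close> for complements, strong sums for disjoint
  unions.\<close>

lemma E:
  assumes "S \<in> sets borel"
  shows "selfadj (E S)" "E S x \<bullet> x = measure (\<mu> x) S"
proof -
  have "\<exists>T. selfadj T \<and> (\<forall>x. T x \<bullet> x = measure (\<mu> x) S)"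
    using assms
  proof (induction rule: borel_induct_atMost)
    case (atMost t)
    then show ?case using P measure_atMost by metis
  next
    case empty
    show ?case by (intro exI[of _ "\<lambda>_. 0"]) (simp add: selfadj_zero)
  next
    case (compl S)
    then obtain T where "selfadj T" "\<And>x. T x \<bullet> x = measure (\<mu> x) S" by blast
    with compl show ?case
      by (intro exI[of _ "\<lambda>x. x - T x"])
        (auto intro!: selfadj_diff selfadj_ident simp: inner_diff_left measure_compl)
  next
    case (union S)
    then obtain T where "\<And>i. selfadj (T i)" "\<And>i x. T i x \<bullet> x = measure (\<mu> x) (S i)" by metis
    then show ?case using strong_sum[OF union(1,2), of T] by metis
  qed
  then have "selfadj (E S) \<and> (\<forall>x. E S x \<bullet> x = measure (\<mu> x) S)" unfolding E_def by (rule someI_ex)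
  then show "selfadj (E S)" "E S x \<bullet> x = measure (\<mu> x) S" by auto
qed

lemma E_eqI:
  assumes "S \<in> sets borel" "selfadj T" "\<And>x. T x \<bullet> x = measure (\<mu> x) S"
  shows "E S x = T x"
  by (rule selfadj_eqI[OF E(1)[OF assms(1)] assms(2)]) (simp add: assms E(2))

lemma E_atMost: "E {..t} x = P t x"
  by (rule E_eqI[where T = "P t"]) (auto simp: P measure_atMost)

lemma E_empty: "E {} x = 0"
  by (rule E_eqI[where T = "\<lambda>_. 0"]) (auto simp: selfadj_zero)

lemma E_UNIV: "E UNIV x = x"
  by (rule E_eqI[where T = "\<lambda>x. x"]) (auto simp: selfadj_ident measure_UNIV)

lemma E_diff:
  assumes "S \<in> sets borel" "T \<in> sets borel" "T \<subseteq> S"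
  shows "E (S - T) x = E S x - E T x"
proof (rule E_eqI[where T = "\<lambda>x. E S x - E T x"])
  show "selfadj (\<lambda>x. E S x - E T x)" using assms by (intro selfadj_diff E(1))
  show "(E S x - E T x) \<bullet> x = measure (\<mu> x) (S - T)" for x
    using assms finite_measure.finite_measure_Diff[OF finite_\<mu>, of S x T]
    by (simp add: inner_diff_left E)
qed (use assms in auto)

lemma E_sums:
  assumes "disjoint_family S" "\<And>i::nat. S i \<in> sets borel"
  shows "(\<lambda>i. E (S i) x) sums E (\<Union>i. S i) x"
proof -
  obtain L where L: "selfadj L" "\<And>x. (\<lambda>i. E (S i) x) sums L x"
    "\<And>x. L x \<bullet> x = measure (\<mu> x) (\<Union>i. S i)"
    by (rule strong_sum[of S "\<lambda>i. E (S i)"]) (use assms E in auto)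
  have "E (\<Union>i. S i) x = L x" using assms L by (intro E_eqI[where T = L]) auto
  then show ?thesis using L(2) by simp
qed

text \<open>In \<open>S\<close> both sides respect complements and disjoint countable unions, so
  agreement on half-lines is enough.\<close>

lemma E_mult_induct:
  assumes R: "R \<in> sets borel" and S: "S \<in> sets borel"
    and half: "\<And>t x. E R (E {..t} x) = E (R \<inter> {..t}) x"
  shows "E R (E S x) = E (R \<inter> S) x"
  using S
proof (induction arbitrary: x rule: borel_induct_atMost)
  case (compl S)
  have "- S = UNIV - S" "R \<inter> - S = R - R \<inter> S" by auto
  then show ?case
    using compl R by (simp add: E_diff E_UNIV selfadj_simps(2)[OF E(1)])
next
  case (union S)
  have "(\<lambda>i. E R (E (S i) x)) sums E R (E (\<Union>i. S i) x)"
    by (rule bounded_linear.sums[OF selfadjD(1)[OF E(1)[OF R]] E_sums[OF union(1,2)]])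
  moreover have "(\<lambda>i. E (R \<inter> S i) x) sums E (\<Union>i. R \<inter> S i) x"
    using union R by (intro E_sums) (auto simp: disjoint_family_on_def)
  ultimately have "E R (E (\<Union>i. S i) x) = E (\<Union>i. R \<inter> S i) x"
    unfolding union by (rule sums_unique2)
  then show ?case by simp
qed (simp_all add: half E_empty selfadj_simps(4)[OF E(1)[OF R]])

lemma E_mult:
  assumes R: "R \<in> sets borel" and S: "S \<in> sets borel"
  shows "E R (E S x) = E (R \<inter> S) x"
proof -
  have 1: "E {..r} (E {..t} x) = E ({..r} \<inter> {..t}) x" for r t x
  proof (cases "r \<le> t")
    case True
    then show ?thesis using comm[of r t] by (simp add: E_atMost P_mono min_def)
  next
    case False
    then show ?thesis by (simp add: E_atMost P_mono min_def)
  qed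
  have 2: "E {..r} (E S x) = E ({..r} \<inter> S) x" if "S \<in> sets borel" for r S x
    by (rule E_mult_induct) (use that 1 in auto)
  \<comment> \<open>Taking adjoints in 2 moves the half-line to the inner operator, where
    \<open>E_mult_induct\<close> expects it.\<close>
  have 3: "E S (E {..r} x) = E (S \<inter> {..r}) x" if S: "S \<in> sets borel" for r S x
  proof -
    have "E S (E {..r} x) \<bullet> y = E (S \<inter> {..r}) x \<bullet> y" for y
    proof -
      have "E S (E {..r} x) \<bullet> y = x \<bullet> E {..r} (E S y)"
        using S by (simp add: selfadjD(2)[OF E(1)])
      also have "\<dots> = x \<bullet> E (S \<inter> {..r}) y" using 2[OF S] by (simp add: Int_commute)
      also have "\<dots> = E (S \<inter> {..r}) x \<bullet> y" using S by (subst selfadjD(2)[OF E(1)]) auto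
      finally show ?thesis .
    qed
    then show ?thesis using vector_eq_rdot by blast
  qed
  show ?thesis by (rule E_mult_induct[OF R S 3[OF R]])
qed

lemma projection_valued_measure_E: "projection_valued_measure E"
proof -
  have "\<forall>S\<in>sets borel. bounded_linear (E S) \<and> (\<forall>x y. E S x \<bullet> y = x \<bullet> E S y)"
    using E(1) by (simp add: selfadj_def)
  moreover have "\<forall>x. E UNIV x = x" by (simp add: E_UNIV)
  moreover have "\<forall>R\<in>sets borel. \<forall>S\<in>sets borel. \<forall>x. E R (E S x) = E (R \<inter> S) x" by (simp add: E_mult)
  moreover have "\<forall>S :: nat \<Rightarrow> real set. range S \<subseteq> sets borel \<longrightarrow> disjoint_family S \<longrightarrow>
      (\<forall>x. (\<lambda>i. E (S i) x) sums E (\<Union>i. S i) x)"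
    by (simp add: E_sums image_subset_iff)
  ultimately show ?thesis unfolding projection_valued_measure_def by blast
qed

lemma scalar_spectral_measure_E: "scalar_spectral_measure E x = \<mu> x"
proof -
  interpret finite_measure "\<mu> x" by (rule finite_\<mu>)
  have "scalar_spectral_measure E x = measure_of (space (\<mu> x)) (sets (\<mu> x)) (emeasure (\<mu> x))"
    unfolding scalar_spectral_measure_def space_\<mu> sets_\<mu>
  proof (rule measure_of_eq)
    fix S assume "S \<in> sigma_sets UNIV (sets (borel :: real measure))"
    then have "S \<in> sets borel" using sets.sigma_sets_eq[of "borel :: real measure"] by simp
    then show "ennreal (E S x \<bullet> x) = emeasure (\<mu> x) S"
      by (simp add: E emeasure_eq_measure)
  qed simp
  also have "\<dots> = \<mu> x" by (rule measure_of_of_measure)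
  finally show ?thesis .
qed

lemma E_Ioc: "a \<le> b \<Longrightarrow> E {a<..b} x = P b x - P a x"
proof -
  assume "a \<le> b"
  then have "{a<..b} = {..b} - {..a}" "{..a} \<subseteq> {..b}" by auto
  then show ?thesis by (simp add: E_diff E_atMost)
qed

lemma AE_support:
  assumes "a < 0" "1 < b" shows "AE \<sigma> in \<mu> x. \<sigma> \<in> {a<..b}"
proof -
  interpret finite_measure "\<mu> x" by (rule finite_\<mu>)
  have "measure (\<mu> x) (- {a<..b}) = 0"
    using assms by (subst measure_compl)
      (simp_all add: E(2)[symmetric] E_Ioc P_neg P_top)
  then have "emeasure (\<mu> x) (- {a<..b}) = 0" by (simp add: emeasure_eq_measure)
  then show ?thesis by (intro AE_I[of _ _ "- {a<..b}"]) auto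
qed

text \<open>Riemann sums of mesh \<open>1 / N\<close>. On the spectral slice \<open>y k\<close> of
  the cell \<open>I k\<close> the form of \<open>B\<close> lies between \<open>a k\<close> and
  \<open>a (Suc k)\<close> times \<open>y k \<bullet> y k\<close>, and distinct slices are
  orthogonal for \<open>B\<close>. So both the form and the integral lie within
  \<open>(x \<bullet> x) / N\<close> of the upper sum.\<close>

lemma B_integral: "B x \<bullet> x = (\<integral>\<sigma>. \<sigma> \<partial>\<mu> x)"
proof -
  interpret finite_measure "\<mu> x" by (rule finite_\<mu>)
  have "AE \<sigma> in \<mu> x. \<sigma> \<in> {-2<..2}" by (rule AE_support) auto
  then have "AE \<sigma> in \<mu> x. norm \<sigma> \<le> 2" by (rule eventually_mono) auto
  then have int: "integrable (\<mu> x) (\<lambda>\<sigma>. \<sigma>)" by (rule integrable_const_bound) simp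
  have bound: "\<bar>B x \<bullet> x - (\<integral>\<sigma>. \<sigma> \<partial>\<mu> x)\<bar> \<le> 2 * (x \<bullet> x) * (1 / real N)" if N: "N > 0" for N
  proof -
    define d where "d = real N"
    have d: "d > 0" using N by (simp add: d_def)
    \<comment> \<open>With \<open>N + 2\<close> cells and the shift by -1 the grid runs from
      \<open>- 1 / N\<close> to \<open>(N + 1) / N\<close>, strictly beyond 0 and 1 as
      \<open>P_neg\<close> and \<open>P_top\<close> require.\<close>
    define K where "K = N + 2"
    define a where "a k = (real k - 1) / d" for k
    have a_Suc: "a (Suc k) = a k + 1 / d" for k by (simp add: a_def diff_divide_distrib)
    have a_mono: "a j \<le> a k" if "j \<le> k" for j k
      using that d by (simp add: a_def divide_right_mono)
    define I where "I k = {a k<..a (Suc k)}" for k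
    define y where "y k = P (a (Suc k)) x - P (a k) x" for k
    have y_E: "y k = E (I k) x" for k
      using a_mono[of k "Suc k"] by (simp add: y_def I_def E_Ioc)
    have y_high: "P (a j) (y k) = y k" if "k < j" for j k
      using that a_mono[of "Suc k" j] a_mono[of k j]
      by (simp add: y_def selfadj_simps[OF P] P_mono)
    have y_low: "P (a j) (y k) = 0" if "j \<le> k" for j k
      using that a_mono[of j "Suc k"] a_mono[of j k]
      by (simp add: y_def selfadj_simps[OF P] P_mono comm[of "a j"])
    have y_sum: "(\<Sum>k<K. y k) = x"
    proof -
      have "(\<Sum>k<K. y k) = P (a (K)) x - P (a 0) x"
        unfolding y_def by (rule sum_lessThan_telescope)
      moreover have "a 0 < 0" "a (K) > 1" using d by (auto simp: a_def d_def K_def)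
      ultimately show ?thesis by (simp add: P_neg P_top)
    qed
    \<comment> \<open>The projection at the left endpoint of the later slice fixes the earlier one,
      kills the later one and commutes with \<open>B\<close>.\<close>
    have orth: "B (y k) \<bullet> y j = 0" if "k \<noteq> j" for j k
    proof (cases "k < j")
      case True
      have "B (y k) \<bullet> y j = P (a j) (B (y k)) \<bullet> y j" using y_high[OF True] comm_B by metis
      also have "\<dots> = B (y k) \<bullet> P (a j) (y j)" by (rule selfadjD(2)[OF P])
      finally show ?thesis by (simp add: y_low)
    next
      case False
      then have "j < k" using that by simp
      have "B (y k) \<bullet> y j = B (y k) \<bullet> P (a k) (y j)" using y_high[OF \<open>j < k\<close>] by simp
      also have "\<dots> = P (a k) (B (y k)) \<bullet> y j" by (rule selfadjD(2)[OF P, symmetric])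
      also have "\<dots> = B (P (a k) (y k)) \<bullet> y j" by (simp add: comm_B)
      finally show ?thesis by (simp add: y_low selfadj_simps(4)[OF B])
    qed
    have "B x \<bullet> x = (\<Sum>k<K. B (y k)) \<bullet> (\<Sum>j<K. y j)"
      by (simp only: y_sum selfadj_sum[OF B, symmetric])
    also have "\<dots> = (\<Sum>k<K. \<Sum>j<K. B (y k) \<bullet> y j)"
      unfolding inner_sum_left by (simp only: inner_sum_right)
    also have "\<dots> = (\<Sum>k<K. B (y k) \<bullet> y k)"
    proof (intro sum.cong refl)
      fix k assume "k \<in> {..<K}"
      then have "(\<Sum>j<K. B (y k) \<bullet> y j) = (\<Sum>j\<in>{k}. B (y k) \<bullet> y j)"
        using orth by (intro sum.mono_neutral_right) auto
      then show "(\<Sum>j<K. B (y k) \<bullet> y j) = B (y k) \<bullet> y k" by simp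
    qed
    finally have Bx: "B x \<bullet> x = (\<Sum>k<K. B (y k) \<bullet> y k)" .
    have y_form: "y k \<bullet> y k = measure (\<mu> x) (I k)" for k
    proof -
      have "y k \<bullet> y k = P (a (Suc k)) x \<bullet> x - P (a k) x \<bullet> x"
        unfolding y_def by (rule P_diff_form) (simp add: a_mono)
      also have "\<dots> = y k \<bullet> x" by (simp add: y_def inner_diff_left)
      finally show ?thesis by (simp add: y_E E I_def)
    qed
    have total: "(\<Sum>k<K. y k \<bullet> y k) = x \<bullet> x"
    proof -
      have "(\<Sum>k<K. y k \<bullet> y k) = (\<Sum>k<K. y k \<bullet> x)"
        by (intro sum.cong refl) (simp only: y_form, simp add: y_E E I_def)
      also have "\<dots> = x \<bullet> x" unfolding inner_sum_left[symmetric] y_sum ..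
      finally show ?thesis .
    qed
    define h where "h \<sigma> = (\<Sum>k<K. a (Suc k) * indicator (I k) \<sigma>)" for \<sigma>
    have h_eq: "\<sigma> \<le> h \<sigma> \<and> h \<sigma> \<le> \<sigma> + 1 / d" if \<sigma>: "\<sigma> \<in> {-1/d<..1 + 1/d}" for \<sigma>
    proof -
      \<comment> \<open>\<open>h\<close> rounds \<open>\<sigma>\<close> up to the grid. Cells are
        closed on the right, so the index of the cell containing \<open>\<sigma>\<close> is the
        ceiling of \<open>d * \<sigma>\<close>.\<close>
      define k where "k = nat \<lceil>d * \<sigma>\<rceil>"
      have "- 1 < d * \<sigma>" "d * \<sigma> \<le> d + 1" using \<sigma> d by (auto simp: field_simps)
      then have k: "real k = of_int \<lceil>d * \<sigma>\<rceil>" "k < K"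
        unfolding k_def d_def K_def by linarith+
      have mem: "\<sigma> \<in> I j \<longleftrightarrow> j = k" for j
      proof -
        have "\<sigma> \<in> I j \<longleftrightarrow> real j - 1 < d * \<sigma> \<and> d * \<sigma> \<le> real j"
          using d by (simp add: I_def a_def field_simps)
        also have "\<dots> \<longleftrightarrow> \<lceil>d * \<sigma>\<rceil> = int j" by (auto simp: ceiling_eq_iff)
        also have "\<dots> \<longleftrightarrow> j = k" using k(1) by linarith
        finally show ?thesis .
      qed
      have "h \<sigma> = (\<Sum>j<K. if j = k then a (Suc k) else 0)"
        unfolding h_def by (intro sum.cong) (auto simp: mem indicator_def)
      also have "\<dots> = a (Suc k)" using k by simp
      finally show ?thesis using mem[of k] a_Suc[of k] by (auto simp: I_def)
    qed
    have int_I: "integrable (\<mu> x) (\<lambda>\<sigma>. a (Suc k) * indicator (I k) \<sigma>)" for k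
      by (intro integrable_mult_right integrable_real_indicator) (auto simp: I_def emeasure_eq_measure)
    have int_h: "integrable (\<mu> x) h"
      unfolding h_def[abs_def] by (intro Bochner_Integration.integrable_sum int_I)
    have int_h_eq: "(\<integral>\<sigma>. h \<sigma> \<partial>\<mu> x) = (\<Sum>k<K. a (Suc k) * (y k \<bullet> y k))"
    proof -
      have "(\<integral>\<sigma>. h \<sigma> \<partial>\<mu> x) = (\<Sum>k<K. \<integral>\<sigma>. a (Suc k) * indicator (I k) \<sigma> \<partial>\<mu> x)"
        unfolding h_def by (intro Bochner_Integration.integral_sum int_I)
      also have "\<dots> = (\<Sum>k<K. a (Suc k) * (y k \<bullet> y k))"
        by (intro sum.cong refl) (simp add: y_form)
      finally show ?thesis .
    qed
    have ae: "AE \<sigma> in \<mu> x. \<sigma> \<in> {-1/d<..1 + 1/d}" using d by (intro AE_support) auto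
    have "AE \<sigma> in \<mu> x. \<sigma> \<le> h \<sigma>" using ae by (rule eventually_mono) (use h_eq in blast)
    then have "(\<integral>\<sigma>. \<sigma> \<partial>\<mu> x) \<le> (\<integral>\<sigma>. h \<sigma> \<partial>\<mu> x)"
      by (intro integral_mono_AE int int_h)
    moreover have "AE \<sigma> in \<mu> x. h \<sigma> \<le> \<sigma> + 1 / d"
      using ae by (rule eventually_mono) (use h_eq in blast)
    then have "(\<integral>\<sigma>. h \<sigma> \<partial>\<mu> x) \<le> (\<integral>\<sigma>. \<sigma> + 1 / d \<partial>\<mu> x)"
      by (intro integral_mono_AE int int_h Bochner_Integration.integrable_add) simp
    moreover have "(\<integral>\<sigma>. \<sigma> + 1 / d \<partial>\<mu> x) = (\<integral>\<sigma>. \<sigma> \<partial>\<mu> x) + (x \<bullet> x) / d"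
      by (subst Bochner_Integration.integral_add) (auto simp: int measure_UNIV)
    moreover have "B x \<bullet> x \<le> (\<integral>\<sigma>. h \<sigma> \<partial>\<mu> x)"
      unfolding Bx int_h_eq by (intro sum_mono low y_high) simp
    moreover have "(\<integral>\<sigma>. h \<sigma> \<partial>\<mu> x) - (x \<bullet> x) / d \<le> B x \<bullet> x"
    proof -
      have "(\<Sum>k<K. a (Suc k) * (y k \<bullet> y k)) - (x \<bullet> x) / d
        = (\<Sum>k<K. a (Suc k) * (y k \<bullet> y k) - (1 / d) * (y k \<bullet> y k))"
        unfolding sum_subtractf sum_distrib_left[symmetric] total by simp
      also have "\<dots> = (\<Sum>k<K. a k * (y k \<bullet> y k))"
        by (intro sum.cong refl) (simp add: a_Suc algebra_simps)
      also have "\<dots> \<le> B x \<bullet> x" unfolding Bx by (intro sum_mono high y_low) simp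
      finally show ?thesis unfolding int_h_eq .
    qed
    ultimately have "\<bar>B x \<bullet> x - (\<integral>\<sigma>. \<sigma> \<partial>\<mu> x)\<bar> \<le> (x \<bullet> x) / d" by linarith
    also have "\<dots> \<le> 2 * (x \<bullet> x) * (1 / d)" using d by (simp add: field_simps)
    finally show ?thesis by (simp add: d_def)
  qed
  have "\<bar>B x \<bullet> x - (\<integral>\<sigma>. \<sigma> \<partial>\<mu> x)\<bar> \<le> 2 * (x \<bullet> x) * 0"
    by (rule LIMSEQ_le_const[OF tendsto_mult[OF tendsto_const lim_1_over_n]])
      (use bound in \<open>auto intro!: exI[of _ 1]\<close>)
  then show ?thesis by simp
qed

lemma resolves_E: "resolves E B"
  unfolding resolves_def scalar_spectral_measure_E
proof (intro conjI projection_valued_measure_E allI B_integral exI[of _ 2])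
  fix x
  have "E {-2..2} x = E UNIV x"
  proof (rule E_eqI[where T = "E UNIV", OF _ E(1)])
    show "E UNIV z \<bullet> z = measure (\<mu> z) {-2..2}" for z
    proof -
      interpret finite_measure "\<mu> z" by (rule finite_\<mu>)
      have "AE \<sigma> in \<mu> z. \<sigma> \<in> {-2<..2}" by (rule AE_support) auto
      then have "AE \<sigma> in \<mu> z. \<sigma> \<in> UNIV \<longleftrightarrow> \<sigma> \<in> {-2..2}" by (rule eventually_mono) auto
      then have "measure (\<mu> z) UNIV = measure (\<mu> z) {-2..2}" by (rule finite_measure_eq_AE) auto
      then show ?thesis by (simp add: E(2))
    qed
  qed auto
  then show "E {-2..2} x = x" by (simp add: E_UNIV)
qed

end

theorem spectral_theorem:
  fixes B :: "'a \<Rightarrow> 'a::{real_inner,banach}"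
  assumes B: "selfadj B" "\<And>x. 0 \<le> B x \<bullet> x" "\<And>x. B x \<bullet> x \<le> x \<bullet> x"
  shows "\<exists>E. resolves E B"
proof -
  define cut where "cut t P \<longleftrightarrow> selfadj P \<and> (\<forall>x. P (P x) = P x) \<and>
    (\<forall>U. selfadj U \<longrightarrow> (\<forall>x. U (B x) = B (U x)) \<longrightarrow> (\<forall>x. U (P x) = P (U x))) \<and>
    (\<forall>x. P x = x \<longrightarrow> B x \<bullet> x \<le> t * (x \<bullet> x)) \<and> (\<forall>x. P x = 0 \<longrightarrow> t * (x \<bullet> x) \<le> B x \<bullet> x) \<and>
    (\<forall>x. B x = t *\<^sub>R x \<longrightarrow> P x = x)" for t :: real and P :: "'a \<Rightarrow> 'a"
  have "\<exists>P. cut t P" for t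
    by (rule spectral_cut[of B t, OF B]) (auto simp: cut_def)
  then obtain P where P: "\<And>t. cut t (P t)" by metis
  have BP: "B (P t x) = P t (B x)" for t x using P[of t] B(1) unfolding cut_def by blast
  \<comment> \<open>The commutant clause of one cut is applied to the other cut, which commutes with
    \<open>B\<close> by \<open>BP\<close>.\<close>
  have PP: "P r (P t x) = P t (P r x)" for r t x
    using P[of r] P[of t] BP unfolding cut_def by metis
  have P': "selfadj (P t)" "P t (P t x) = P t x" "P t x = x \<Longrightarrow> B x \<bullet> x \<le> t * (x \<bullet> x)"
    "P t x = 0 \<Longrightarrow> t * (x \<bullet> x) \<le> B x \<bullet> x" "B x = t *\<^sub>R x \<Longrightarrow> P t x = x" for t x
    using P[of t] unfolding cut_def by blast+
  interpret spectral_family B P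
    by unfold_locales (fact B BP PP P')+
  show ?thesis using resolves_E by blast
qed

section \<open>Borel functional calculus\<close>

definition bounded_borel :: "(real \<Rightarrow> real) \<Rightarrow> bool" where
  "bounded_borel f \<longleftrightarrow> f \<in> borel_measurable borel \<and> (\<exists>K. \<forall>\<sigma>. \<bar>f \<sigma>\<bar> \<le> K)"

lemma bounded_borelI: "f \<in> borel_measurable borel \<Longrightarrow> (\<And>\<sigma>. \<bar>f \<sigma>\<bar> \<le> K) \<Longrightarrow> bounded_borel f"
  by (auto simp: bounded_borel_def)

lemma bounded_borel_measurable: "bounded_borel f \<Longrightarrow> f \<in> borel_measurable borel"
  by (simp add: bounded_borel_def)

lemma bounded_borel_const: "bounded_borel (\<lambda>_. c)"
  by (rule bounded_borelI[where K = "\<bar>c\<bar>"]) auto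

lemma bounded_borel_indicator: "S \<in> sets borel \<Longrightarrow> bounded_borel (indicator S)"
  by (rule bounded_borelI[where K = 1]) (auto simp: indicator_def)

lemma bounded_borel_mult:
  assumes "bounded_borel f" "bounded_borel g"
  shows "bounded_borel (\<lambda>\<sigma>. f \<sigma> * g \<sigma>)"
proof -
  obtain K L where K: "\<And>\<sigma>. \<bar>f \<sigma>\<bar> \<le> K" and L: "\<And>\<sigma>. \<bar>g \<sigma>\<bar> \<le> L"
    using assms by (auto simp: bounded_borel_def)
  have "\<bar>f \<sigma> * g \<sigma>\<bar> \<le> K * L" for \<sigma>
    unfolding abs_mult using K[of \<sigma>] L[of \<sigma>] by (intro mult_mono) auto
  then show ?thesis using assms by (intro bounded_borelI) (auto simp: bounded_borel_def)
qed

lemma bounded_borel_add: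
  assumes "bounded_borel f" "bounded_borel g"
  shows "bounded_borel (\<lambda>\<sigma>. f \<sigma> + g \<sigma>)"
proof -
  obtain K L where K: "\<And>\<sigma>. \<bar>f \<sigma>\<bar> \<le> K" and L: "\<And>\<sigma>. \<bar>g \<sigma>\<bar> \<le> L"
    using assms by (auto simp: bounded_borel_def)
  have "\<bar>f \<sigma> + g \<sigma>\<bar> \<le> K + L" for \<sigma>
    using K[of \<sigma>] L[of \<sigma>] by linarith
  then show ?thesis using assms by (intro bounded_borelI) (auto simp: bounded_borel_def)
qed

lemma bounded_borel_diff:
  assumes "bounded_borel f" "bounded_borel g"
  shows "bounded_borel (\<lambda>\<sigma>. f \<sigma> - g \<sigma>)"
  using bounded_borel_add[OF assms(1) bounded_borel_mult[OF bounded_borel_const[of "-1"] assms(2)]]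
  by simp

section \<open>Integration against an arbitrary projection-valued measure\<close>

locale pvm =
  fixes E :: "real set \<Rightarrow> 'a \<Rightarrow> 'a::{real_inner,banach}"
  assumes pvm: "projection_valued_measure E"
begin

lemma E_selfadj: "S \<in> sets borel \<Longrightarrow> selfadj (E S)"
  using pvm by (auto simp: projection_valued_measure_def selfadj_def)

lemma E_UNIV: "E UNIV x = x"
  using pvm by (auto simp: projection_valued_measure_def)

lemma E_mult: "R \<in> sets borel \<Longrightarrow> S \<in> sets borel \<Longrightarrow> E R (E S x) = E (R \<inter> S) x"
  using pvm by (auto simp: projection_valued_measure_def)

lemma E_sums:
  "(\<And>i::nat. S i \<in> sets borel) \<Longrightarrow> disjoint_family S \<Longrightarrow> (\<lambda>i. E (S i) x) sums E (\<Union>i. S i) x"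
  using pvm unfolding projection_valued_measure_def by blast

lemma E_empty: "E {} x = 0"
proof -
  \<comment> \<open>The constant sequence of empty sets is disjoint, so a constant series converges
    and its terms are 0.\<close>
  have "(\<lambda>i::nat. E {} x) sums E (\<Union>i::nat. {}) x" by (intro E_sums) (auto simp: disjoint_family_on_def)
  then have "(\<lambda>i::nat. E {} x) \<longlonglongrightarrow> 0" by (intro summable_LIMSEQ_zero sums_summable)
  then show ?thesis by (simp add: LIMSEQ_const_iff)
qed

lemma E_form:
  assumes "R \<in> sets borel" "S \<in> sets borel"
  shows "E R x \<bullet> E S x = E (R \<inter> S) x \<bullet> x"
  using selfadjD(2)[OF E_selfadj[OF assms(1)], of x "E S x"] assms by (simp add: E_mult inner_commute)

lemma E_form_nonneg: "S \<in> sets borel \<Longrightarrow> 0 \<le> E S x \<bullet> x"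
  using E_form[of S S x] inner_ge_zero[of "E S x"] by simp

abbreviation \<mu> :: "'a \<Rightarrow> real measure" where
  "\<mu> \<equiv> scalar_spectral_measure E"

lemma sets_\<mu> [simp, measurable_cong]: "sets (\<mu> x) = sets borel"
  unfolding scalar_spectral_measure_def
  using sets.sigma_sets_eq[of "borel :: real measure"] by (simp add: sets_measure_of_conv)

lemma space_\<mu> [simp]: "space (\<mu> x) = UNIV"
  using sets_eq_imp_space_eq[OF sets_\<mu>] by simp

text \<open>\<open>measure_of\<close> falls back to the zero measure unless the given set function
  is a measure, so countable additivity of the form must be checked before any value can be read
  off.\<close>

lemma emeasure_\<mu>:
  assumes "S \<in> sets borel"
  shows "emeasure (\<mu> x) S = ennreal (E S x \<bullet> x)"
proof -
  have sets: "sigma_sets UNIV (sets (borel :: real measure)) = sets borel"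
    using sets.sigma_sets_eq[of "borel :: real measure"] by simp
  have "emeasure (measure_of UNIV (sets borel) (\<lambda>S. ennreal (E S x \<bullet> x))) S = ennreal (E S x \<bullet> x)"
  proof (rule emeasure_measure_of_sigma)
    show "sigma_algebra UNIV (sets (borel :: real measure))"
      using sets.sigma_algebra_axioms[of "borel :: real measure"] by simp
    show "positive (sets borel) (\<lambda>S. ennreal (E S x \<bullet> x))"
      by (simp add: positive_def E_empty)
    show "countably_additive (sets borel) (\<lambda>S. ennreal (E S x \<bullet> x))"
    proof (rule countably_additiveI)
      fix S :: "nat \<Rightarrow> real set"
      assume S: "range S \<subseteq> sets borel" "disjoint_family S"
      then have "(\<lambda>i. E (S i) x) sums E (\<Union>i. S i) x" by (intro E_sums) auto
      then have "(\<lambda>i. E (S i) x \<bullet> x) sums (E (\<Union>i. S i) x \<bullet> x)"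
        by (rule bounded_linear.sums[OF bounded_linear_inner_left])
      then show "(\<Sum>i. ennreal (E (S i) x \<bullet> x)) = ennreal (E (\<Union>i. S i) x \<bullet> x)"
        using S by (intro suminf_ennreal_eq E_form_nonneg) auto
    qed
  qed (use assms in auto)
  then show ?thesis by (simp add: scalar_spectral_measure_def)
qed

lemma finite_\<mu>: "finite_measure (\<mu> x)"
  by (rule finite_measureI) (simp add: emeasure_\<mu>)

lemma measure_\<mu>: "S \<in> sets borel \<Longrightarrow> measure (\<mu> x) S = E S x \<bullet> x"
  by (simp add: measure_def emeasure_\<mu> E_form_nonneg)

lemma integrable_bounded:
  assumes "bounded_borel f"
  shows "integrable (\<mu> x) f"
proof -
  interpret finite_measure "\<mu> x" by (rule finite_\<mu>)
  from assms obtain K where "f \<in> borel_measurable borel" "\<And>\<sigma>. \<bar>f \<sigma>\<bar> \<le> K"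
    by (auto simp: bounded_borel_def)
  then show ?thesis by (intro integrable_const_bound[where B = K]) auto
qed

lemma integral_le_const:
  assumes "integrable (\<mu> x) f" "AE \<sigma> in \<mu> x. f \<sigma> \<le> c"
  shows "(\<integral>\<sigma>. f \<sigma> \<partial>\<mu> x) \<le> c * (x \<bullet> x)"
proof -
  interpret finite_measure "\<mu> x" by (rule finite_\<mu>)
  have "(\<integral>\<sigma>. f \<sigma> \<partial>\<mu> x) \<le> (\<integral>\<sigma>. c \<partial>\<mu> x)" using assms by (intro integral_mono_AE) auto
  also have "\<dots> = c * (x \<bullet> x)" by (simp add: measure_\<mu> E_UNIV)
  finally show ?thesis .
qed

text \<open>The pairs \<open>(f, \<integral> f dE)\<close> for Borel step functions \<open>f\<close>.\<close>

inductive step_rep :: "(real \<Rightarrow> real) \<Rightarrow> ('a \<Rightarrow> 'a) \<Rightarrow> bool" where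
  zero: "step_rep (\<lambda>_. 0) (\<lambda>_. 0)"
| add: "S \<in> sets borel \<Longrightarrow> step_rep f T \<Longrightarrow>
    step_rep (\<lambda>\<sigma>. c * indicator S \<sigma> + f \<sigma>) (\<lambda>x. c *\<^sub>R E S x + T x)"

lemma step_rep_bounded: "step_rep f T \<Longrightarrow> bounded_borel f"
proof (induction rule: step_rep.induct)
  case (add S f T c)
  then show ?case
    by (intro bounded_borel_add bounded_borel_mult bounded_borel_const bounded_borel_indicator)
qed (rule bounded_borel_const)

lemma step_rep_selfadj: "step_rep f T \<Longrightarrow> selfadj T"
proof (induction rule: step_rep.induct)
  case (add S f T c)
  then show ?case by (intro selfadj_add selfadj_scaleR E_selfadj)
qed (rule selfadj_zero)

text \<open>\<open>U\<close> is general because the lemma is applied to the projections themselves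
  and, in \<open>rep_commute\<close>, to limits of step operators.\<close>

lemma step_rep_commute:
  assumes "step_rep f T" and U: "selfadj U" "\<And>S x. S \<in> sets borel \<Longrightarrow> U (E S x) = E S (U x)"
  shows "U (T x) = T (U x)"
  using assms(1) by (induction rule: step_rep.induct) (simp_all add: selfadj_simps[OF U(1)] U(2))

lemma step_rep_E: "step_rep f T \<Longrightarrow> S \<in> sets borel \<Longrightarrow> T (E S x) = E S (T x)"
  by (rule step_rep_commute[where U = "E S", symmetric]) (auto simp: E_selfadj E_mult Int_commute)

lemma step_rep_add:
  assumes "step_rep f T" "step_rep g U"
  shows "step_rep (\<lambda>\<sigma>. f \<sigma> + g \<sigma>) (\<lambda>x. T x + U x)"
  using assms(1)
proof (induction rule: step_rep.induct)
  case (add S f T c)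
  from step_rep.add[OF add(1,3), of c] show ?case by (simp add: add.assoc)
qed (simp add: assms(2))

lemma step_rep_scale:
  assumes "step_rep f T"
  shows "step_rep (\<lambda>\<sigma>. c * f \<sigma>) (\<lambda>x. c *\<^sub>R T x)"
  using assms
proof (induction rule: step_rep.induct)
  case (add S f T d)
  from step_rep.add[OF add(1,3), of "c * d"] show ?case by (simp add: distrib_left scaleR_add_right mult.assoc)
qed (simp add: step_rep.zero)

lemma step_rep_diff:
  assumes "step_rep f T" "step_rep g U"
  shows "step_rep (\<lambda>\<sigma>. f \<sigma> - g \<sigma>) (\<lambda>x. T x - U x)"
  using step_rep_add[OF assms(1) step_rep_scale[OF assms(2), of "-1"]] by simp

lemma step_rep_sum:
  assumes "finite I" "\<And>i. i \<in> I \<Longrightarrow> S i \<in> sets borel"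
  shows "step_rep (\<lambda>\<sigma>. \<Sum>i\<in>I. c i * indicator (S i) \<sigma>) (\<lambda>x. \<Sum>i\<in>I. c i *\<^sub>R E (S i) x)"
  using assms
proof (induction rule: finite_induct)
  case (insert i I)
  have "step_rep (\<lambda>\<sigma>. c i * indicator (S i) \<sigma> + (\<Sum>i\<in>I. c i * indicator (S i) \<sigma>))
      (\<lambda>x. c i *\<^sub>R E (S i) x + (\<Sum>i\<in>I. c i *\<^sub>R E (S i) x))"
    by (intro step_rep.add insert) auto
  then show ?case by (simp only: sum.insert[OF insert(1,2)])
qed (simp add: step_rep.zero)

text \<open>The isometry \<open>step_rep_inner\<close> is proved one factor at a time; here the
  second factor is a single projection.\<close>

lemma step_rep_inner_E:
  assumes "step_rep f T" and S: "S \<in> sets borel"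
  shows "T x \<bullet> E S x = (\<integral>\<sigma>. f \<sigma> * indicator S \<sigma> \<partial>\<mu> x)"
  using assms(1)
proof (induction rule: step_rep.induct)
  case (add R f T c)
  interpret finite_measure "\<mu> x" by (rule finite_\<mu>)
  have bb: "bounded_borel (\<lambda>\<sigma>. f \<sigma> * indicator S \<sigma>)" "bounded_borel (\<lambda>\<sigma>. c * indicator (R \<inter> S) \<sigma>)"
    using step_rep_bounded[OF add(2)] add(1) S
    by (intro bounded_borel_mult bounded_borel_const bounded_borel_indicator sets.Int; simp)+
  have "(\<integral>\<sigma>. (c * indicator R \<sigma> + f \<sigma>) * indicator S \<sigma> \<partial>\<mu> x)
    = (\<integral>\<sigma>. c * indicator (R \<inter> S) \<sigma> + f \<sigma> * indicator S \<sigma> \<partial>\<mu> x)"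
    by (intro Bochner_Integration.integral_cong refl) (auto simp: indicator_def)
  also have "\<dots> = (\<integral>\<sigma>. c * indicator (R \<inter> S) \<sigma> \<partial>\<mu> x) + (\<integral>\<sigma>. f \<sigma> * indicator S \<sigma> \<partial>\<mu> x)"
    by (intro Bochner_Integration.integral_add integrable_bounded bb)
  also have "(\<integral>\<sigma>. c * indicator (R \<inter> S) \<sigma> \<partial>\<mu> x) = c * (E (R \<inter> S) x \<bullet> x)"
    using add(1) S by (simp add: measure_\<mu>)
  finally show ?case using add S by (simp add: inner_add_left E_form)
qed simp

lemma step_rep_inner:
  assumes f: "step_rep f T" and "step_rep g U"
  shows "T x \<bullet> U x = (\<integral>\<sigma>. f \<sigma> * g \<sigma> \<partial>\<mu> x)"
  using assms(2)
proof (induction rule: step_rep.induct)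
  case (add S g U c)
  note bb = step_rep_bounded[OF f] step_rep_bounded[OF add(2)] bounded_borel_indicator[OF add(1)]
  have "(\<integral>\<sigma>. f \<sigma> * (c * indicator S \<sigma> + g \<sigma>) \<partial>\<mu> x)
    = (\<integral>\<sigma>. c * (f \<sigma> * indicator S \<sigma>) + f \<sigma> * g \<sigma> \<partial>\<mu> x)"
    by (simp add: algebra_simps)
  also have "\<dots> = (\<integral>\<sigma>. c * (f \<sigma> * indicator S \<sigma>) \<partial>\<mu> x) + (\<integral>\<sigma>. f \<sigma> * g \<sigma> \<partial>\<mu> x)"
    by (intro Bochner_Integration.integral_add integrable_bounded bounded_borel_mult bounded_borel_const bb)
  finally show ?case using add step_rep_inner_E[OF f add(1), of x] by (simp add: inner_add_right)
qed simp

lemma step_rep_norm: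
  assumes "step_rep f T" "\<And>\<sigma>. \<bar>f \<sigma>\<bar> \<le> K" "0 \<le> K"
  shows "norm (T x) \<le> K * norm x"
proof -
  have "(norm (T x))\<^sup>2 = (\<integral>\<sigma>. f \<sigma> * f \<sigma> \<partial>\<mu> x)"
    using step_rep_inner[OF assms(1,1)] by (simp add: power2_norm_eq_inner)
  also have "\<dots> \<le> K\<^sup>2 * (x \<bullet> x)"
  proof (intro integral_le_const integrable_bounded bounded_borel_mult step_rep_bounded[OF assms(1)] AE_I2)
    show "f \<sigma> * f \<sigma> \<le> K\<^sup>2" for \<sigma>
      using power_mono[OF assms(2)[of \<sigma>], of 2] by (simp add: power2_eq_square)
  qed
  also have "\<dots> = (K * norm x)\<^sup>2" by (simp only: power_mult_distrib power2_norm_eq_inner)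
  finally show ?thesis by (rule power2_le_imp_le) (simp add: assms(3))
qed

text \<open>The explicit rate gives, via \<open>step_rep_norm\<close>, both the Cauchy estimate and
  a common bound for the approximants. A relation, because \<open>bounded_spectral_integral\<close>
  is a \<open>THE\<close> description that is identified with the limit only in
  \<open>rep_\<Phi>\<close>.\<close>

definition rep :: "(real \<Rightarrow> real) \<Rightarrow> ('a \<Rightarrow> 'a) \<Rightarrow> bool" where
  "rep f T \<longleftrightarrow> (\<exists>F U. (\<forall>n. step_rep (F n) (U n)) \<and> (\<forall>n \<sigma>. \<bar>F n \<sigma> - f \<sigma>\<bar> \<le> 1 / real (Suc n)) \<and>
     (\<forall>x. (\<lambda>n. U n x) \<longlonglongrightarrow> T x))"

lemma rep_exists:
  assumes f: "bounded_borel f"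
  obtains T where "rep f T"
proof -
  from f obtain K0 where f_meas [measurable]: "f \<in> borel_measurable borel" and K0: "\<And>\<sigma>. \<bar>f \<sigma>\<bar> \<le> K0"
    by (auto simp: bounded_borel_def)
  \<comment> \<open>Rounding down to multiples of \<open>1 / (n + 1)\<close>; as \<open>f\<close> is
    bounded, finitely many values occur.\<close>
  define F where "F n \<sigma> = of_int \<lfloor>real (Suc n) * f \<sigma>\<rfloor> / real (Suc n)" for n \<sigma>
  have F_f: "\<bar>F n \<sigma> - f \<sigma>\<bar> \<le> 1 / real (Suc n)" for n \<sigma>
  proof -
    have "F n \<sigma> - f \<sigma> = (of_int \<lfloor>real (Suc n) * f \<sigma>\<rfloor> - real (Suc n) * f \<sigma>) / real (Suc n)"
      unfolding F_def by (simp add: diff_divide_distrib del: of_nat_Suc)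
    also have "\<bar>\<dots>\<bar> = \<bar>of_int \<lfloor>real (Suc n) * f \<sigma>\<rfloor> - real (Suc n) * f \<sigma>\<bar> / real (Suc n)"
      by (simp del: of_nat_Suc)
    also have "\<dots> \<le> 1 / real (Suc n)"
      by (intro divide_right_mono) linarith+
    finally show ?thesis .
  qed
  have "\<exists>U. step_rep (F n) U" for n
  proof -
    define M where "M = \<lceil>real (Suc n) * K0\<rceil> + 1"
    define S where "S k = {\<sigma>. \<lfloor>real (Suc n) * f \<sigma>\<rfloor> = k}" for k
    have range: "\<lfloor>real (Suc n) * f \<sigma>\<rfloor> \<in> {-M..M}" for \<sigma>
    proof -
      have "\<bar>real (Suc n) * f \<sigma>\<bar> \<le> real (Suc n) * K0"
        unfolding abs_mult using K0[of \<sigma>] by (intro mult_mono) auto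
      then show ?thesis unfolding M_def by (simp only: atLeastAtMost_iff) linarith
    qed
    have "step_rep (\<lambda>\<sigma>. \<Sum>k\<in>{-M..M}. (of_int k / real (Suc n)) * indicator (S k) \<sigma>)
      (\<lambda>x. \<Sum>k\<in>{-M..M}. (of_int k / real (Suc n)) *\<^sub>R E (S k) x)"
      by (rule step_rep_sum) (simp_all add: S_def del: of_nat_Suc)
    moreover have "(\<Sum>k\<in>{-M..M}. (of_int k / real (Suc n)) * indicator (S k) \<sigma>) = F n \<sigma>" for \<sigma>
    proof -
      have "(\<Sum>k\<in>{-M..M}. (of_int k / real (Suc n)) * indicator (S k) \<sigma>)
        = (\<Sum>k\<in>{-M..M}. if k = \<lfloor>real (Suc n) * f \<sigma>\<rfloor> then of_int k / real (Suc n) else 0)"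
        by (intro sum.cong) (auto simp: S_def indicator_def)
      also have "\<dots> = F n \<sigma>"
        unfolding sum.delta[OF finite_atLeastAtMost_int] using range[of \<sigma>] by (simp only: F_def if_True)
      finally show ?thesis .
    qed
    ultimately show ?thesis by (simp only:) blast
  qed
  then obtain U where U: "\<And>n. step_rep (F n) (U n)" by metis
  have "convergent (\<lambda>n. U n x)" for x
  proof (rule Cauchy_convergent, rule metric_CauchyI)
    fix e :: real assume e: "0 < e"
    obtain k where k: "2 * norm x / e < real k" using reals_Archimedean2 by blast
    then have k0: "0 < k" using e by (cases k) (auto simp: field_simps not_less)
    show "\<exists>k. \<forall>m\<ge>k. \<forall>n\<ge>k. dist (U m x) (U n x) < e"
    proof (intro exI[of _ k] allI impI)
      fix m n assume mn: "k \<le> m" "k \<le> n"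
      have inv: "1 / real (Suc l) \<le> 1 / real k" if "k \<le> l" for l
        using that k0 by (intro divide_left_mono) auto
      have "norm (U m x - U n x) \<le> (2 / real k) * norm x"
      proof (rule step_rep_norm[OF step_rep_diff[OF U U]])
        show "\<bar>F m \<sigma> - F n \<sigma>\<bar> \<le> 2 / real k" for \<sigma>
          using F_f[of m \<sigma>] F_f[of n \<sigma>] inv[OF mn(1)] inv[OF mn(2)] by linarith
      qed simp
      also have "\<dots> < e" using k k0 e by (simp add: field_simps)
      finally show "dist (U m x) (U n x) < e" by (simp add: dist_norm)
    qed
  qed
  then have "\<exists>l. (\<lambda>n. U n x) \<longlonglongrightarrow> l" for x by (simp add: convergent_def)
  then obtain T where "\<And>x. (\<lambda>n. U n x) \<longlonglongrightarrow> T x" by metis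
  with U F_f have "rep f T" unfolding rep_def by blast
  then show ?thesis by (rule that)
qed

lemma rep_inner:
  assumes f: "bounded_borel f" and g: "bounded_borel g" and "rep f T" "rep g V"
  shows "T x \<bullet> V x = (\<integral>\<sigma>. f \<sigma> * g \<sigma> \<partial>\<mu> x)"
proof -
  interpret finite_measure "\<mu> x" by (rule finite_\<mu>)
  obtain F U where F: "\<And>n. step_rep (F n) (U n)" "\<And>n \<sigma>. \<bar>F n \<sigma> - f \<sigma>\<bar> \<le> 1 / real (Suc n)"
    "\<And>x. (\<lambda>n. U n x) \<longlonglongrightarrow> T x"
    using assms(3) unfolding rep_def by blast
  obtain G W where G: "\<And>n. step_rep (G n) (W n)" "\<And>n \<sigma>. \<bar>G n \<sigma> - g \<sigma>\<bar> \<le> 1 / real (Suc n)"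
    "\<And>x. (\<lambda>n. W n x) \<longlonglongrightarrow> V x"
    using assms(4) unfolding rep_def by blast
  obtain K L where K: "\<And>\<sigma>. \<bar>f \<sigma>\<bar> \<le> K" and L: "\<And>\<sigma>. \<bar>g \<sigma>\<bar> \<le> L"
    using f g by (auto simp: bounded_borel_def)
  have lim: "(\<lambda>n. H n \<sigma>) \<longlonglongrightarrow> h \<sigma>" if "\<And>n \<sigma>. \<bar>H n \<sigma> - h \<sigma>\<bar> \<le> 1 / real (Suc n)" for H h and \<sigma> :: real
    by (rule LIM_zero_cancel, rule Lim_null_comparison[OF always_eventually LIMSEQ_Suc[OF lim_1_over_n]])
      (simp add: that del: of_nat_Suc)
  have one: "1 / real (Suc n) \<le> 1" for n by simp
  have "(\<lambda>n. \<integral>\<sigma>. F n \<sigma> * G n \<sigma> \<partial>\<mu> x) \<longlonglongrightarrow> (\<integral>\<sigma>. f \<sigma> * g \<sigma> \<partial>\<mu> x)"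
  proof (rule integral_dominated_convergence[where w = "\<lambda>_. (K + 1) * (L + 1)"])
    show "(\<lambda>\<sigma>. f \<sigma> * g \<sigma>) \<in> borel_measurable (\<mu> x)"
      using bounded_borel_measurable[OF bounded_borel_mult[OF f g]] by simp
    show "(\<lambda>\<sigma>. F n \<sigma> * G n \<sigma>) \<in> borel_measurable (\<mu> x)" for n
      using bounded_borel_measurable[OF bounded_borel_mult[OF step_rep_bounded[OF F(1)] step_rep_bounded[OF G(1)]]]
      by simp
    show "AE \<sigma> in \<mu> x. (\<lambda>n. F n \<sigma> * G n \<sigma>) \<longlonglongrightarrow> f \<sigma> * g \<sigma>"
      by (intro AE_I2 tendsto_mult lim F G)
    show "AE \<sigma> in \<mu> x. norm (F n \<sigma> * G n \<sigma>) \<le> (K + 1) * (L + 1)" for n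
    proof (intro AE_I2)
      fix \<sigma>
      have "\<bar>F n \<sigma>\<bar> \<le> K + 1" "\<bar>G n \<sigma>\<bar> \<le> L + 1"
        using F(2)[of n \<sigma>] G(2)[of n \<sigma>] K[of \<sigma>] L[of \<sigma>] one[of n] by linarith+
      then show "norm (F n \<sigma> * G n \<sigma>) \<le> (K + 1) * (L + 1)"
        unfolding real_norm_def abs_mult by (intro mult_mono) auto
    qed
  qed simp
  moreover have "(\<lambda>n. U n x \<bullet> W n x) \<longlonglongrightarrow> T x \<bullet> V x" by (intro tendsto_intros F G)
  ultimately show ?thesis
    unfolding step_rep_inner[OF F(1) G(1)] by (rule LIMSEQ_unique[rotated])
qed

lemma rep_selfadj:
  assumes f: "bounded_borel f" and "rep f T"
  shows "selfadj T"
proof -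
  obtain F U where F: "\<And>n. step_rep (F n) (U n)" "\<And>n \<sigma>. \<bar>F n \<sigma> - f \<sigma>\<bar> \<le> 1 / real (Suc n)"
    "\<And>x. (\<lambda>n. U n x) \<longlonglongrightarrow> T x"
    using assms(2) unfolding rep_def by blast
  obtain K where K: "\<And>\<sigma>. \<bar>f \<sigma>\<bar> \<le> K" using f by (auto simp: bounded_borel_def)
  have one: "1 / real (Suc n) \<le> 1" for n by simp
  show ?thesis
  proof (rule selfadj_limit[OF step_rep_selfadj[OF F(1)] F(3)])
    fix n x
    have "norm (U n x) \<le> (K + 1) * norm x"
    proof (rule step_rep_norm[OF F(1)])
      show "\<bar>F n \<sigma>\<bar> \<le> K + 1" for \<sigma>
        using F(2)[of n \<sigma>] K[of \<sigma>] one[of n] by linarith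
      show "0 \<le> K + 1" using K[of 0] by linarith
    qed
    then show "norm (U n x) \<le> norm x * (K + 1)" by (simp add: mult.commute)
  qed
qed

text \<open>In stages: \<open>T\<close> commutes with every \<open>E S\<close>, being a limit of
  step operators that do, hence with the step operators of \<open>g\<close>, hence with their limit
  \<open>V\<close>.\<close>

lemma rep_commute:
  assumes f: "bounded_borel f" and g: "bounded_borel g" and T: "rep f T" and V: "rep g V"
  shows "T (V x) = V (T x)"
proof -
  obtain F U where F: "\<And>n. step_rep (F n) (U n)" "\<And>x. (\<lambda>n. U n x) \<longlonglongrightarrow> T x"
    using T unfolding rep_def by blast
  obtain G W where G: "\<And>n. step_rep (G n) (W n)" "\<And>x. (\<lambda>n. W n x) \<longlonglongrightarrow> V x"
    using V unfolding rep_def by blast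
  have TE: "T (E S x) = E S (T x)" if "S \<in> sets borel" for S x
    using F(2)[of "E S x"] selfadj_tendsto[OF E_selfadj[OF that] F(2)[of x]]
    unfolding step_rep_E[OF F(1) that] by (rule LIMSEQ_unique)
  have TW: "T (W n x) = W n (T x)" for n x
    by (rule step_rep_commute[OF G(1) rep_selfadj[OF f T] TE])
  show ?thesis
    using selfadj_tendsto[OF rep_selfadj[OF f T] G(2)[of x]] G(2)[of "T x"]
    unfolding TW by (rule LIMSEQ_unique)
qed

abbreviation \<Phi> :: "(real \<Rightarrow> real) \<Rightarrow> 'a \<Rightarrow> 'a" where
  "\<Phi> \<equiv> bounded_spectral_integral E"

lemma rep_one: "rep (\<lambda>_. 1) (\<lambda>x. x)"
proof -
  have "step_rep (\<lambda>_. 1) (\<lambda>x. x)"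
    using step_rep.add[OF _ step_rep.zero, of UNIV 1] by (simp add: E_UNIV)
  then show ?thesis unfolding rep_def
    by (intro exI[of _ "\<lambda>_ _. 1"] exI[of _ "\<lambda>_ x. x"]) simp
qed

lemma rep_form:
  assumes "bounded_borel f" "rep f T"
  shows "T x \<bullet> x = (\<integral>\<sigma>. f \<sigma> \<partial>\<mu> x)"
  using rep_inner[OF assms(1) bounded_borel_const assms(2) rep_one] by simp

text \<open>\<open>selfadj_eqI\<close> supplies the uniqueness that the \<open>THE\<close>
  description demands.\<close>

lemma rep_\<Phi>:
  assumes f: "bounded_borel f"
  shows "rep f (\<Phi> f)"
proof -
  obtain T where T: "rep f T" using rep_exists[OF f] .
  have "\<Phi> f = T"
    unfolding bounded_spectral_integral_def
  proof (rule the_equality)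
    show "bounded_linear T \<and> (\<forall>x y. T x \<bullet> y = x \<bullet> T y) \<and> (\<forall>x. T x \<bullet> x = (\<integral>\<sigma>. f \<sigma> \<partial>\<mu> x))"
      using rep_selfadj[OF f T] rep_form[OF f T] by (simp add: selfadj_def)
    fix S
    assume S: "bounded_linear S \<and> (\<forall>x y. S x \<bullet> y = x \<bullet> S y) \<and> (\<forall>x. S x \<bullet> x = (\<integral>\<sigma>. f \<sigma> \<partial>\<mu> x))"
    then have "selfadj S" by (simp add: selfadj_def)
    moreover have "S x \<bullet> x = T x \<bullet> x" for x using S rep_form[OF f T, of x] by metis
    ultimately have "S x = T x" for x by (rule selfadj_eqI[OF _ rep_selfadj[OF f T]])
    then show "S = T" by (rule ext)
  qed
  with T show ?thesis by simp
qed

lemma \<Phi>_selfadj: "bounded_borel f \<Longrightarrow> selfadj (\<Phi> f)"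
  by (rule rep_selfadj[OF _ rep_\<Phi>])

lemma \<Phi>_form: "bounded_borel f \<Longrightarrow> \<Phi> f x \<bullet> x = (\<integral>\<sigma>. f \<sigma> \<partial>\<mu> x)"
  by (rule rep_form[OF _ rep_\<Phi>])

lemma \<Phi>_inner:
  "bounded_borel f \<Longrightarrow> bounded_borel g \<Longrightarrow> \<Phi> f x \<bullet> \<Phi> g x = (\<integral>\<sigma>. f \<sigma> * g \<sigma> \<partial>\<mu> x)"
  by (rule rep_inner[OF _ _ rep_\<Phi> rep_\<Phi>])

lemma \<Phi>_norm: "bounded_borel f \<Longrightarrow> (norm (\<Phi> f x))\<^sup>2 = (\<integral>\<sigma>. (f \<sigma>)\<^sup>2 \<partial>\<mu> x)"
  unfolding power2_norm_eq_inner by (simp add: \<Phi>_inner power2_eq_square)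

text \<open>The form of the composition is \<open>\<Phi> g x \<bullet> \<Phi> f x\<close>, which
  \<open>\<Phi>_inner\<close> evaluates. Commutation makes the composition self-adjoint, so the form
  determines it.\<close>

lemma \<Phi>_mult:
  assumes f: "bounded_borel f" and g: "bounded_borel g"
  shows "\<Phi> f (\<Phi> g x) = \<Phi> (\<lambda>\<sigma>. f \<sigma> * g \<sigma>) x"
proof (rule selfadj_eqI[where S = "\<lambda>x. \<Phi> f (\<Phi> g x)" and T = "\<Phi> (\<lambda>\<sigma>. f \<sigma> * g \<sigma>)"])
  show "selfadj (\<lambda>x. \<Phi> f (\<Phi> g x))"
    by (rule selfadj_comp[where S = "\<Phi> f" and T = "\<Phi> g", OF \<Phi>_selfadj[OF f] \<Phi>_selfadj[OF g]]) (rule rep_commute[OF f g rep_\<Phi>[OF f] rep_\<Phi>[OF g]])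
  show "selfadj (\<Phi> (\<lambda>\<sigma>. f \<sigma> * g \<sigma>))" by (rule \<Phi>_selfadj[OF bounded_borel_mult[OF f g]])
  show "\<Phi> f (\<Phi> g x) \<bullet> x = \<Phi> (\<lambda>\<sigma>. f \<sigma> * g \<sigma>) x \<bullet> x" for x
    using \<Phi>_inner[OF f g, of x]
    unfolding \<Phi>_form[OF bounded_borel_mult[OF f g]] selfadjD(2)[OF \<Phi>_selfadj[OF f], of "\<Phi> g x" x]
    by (simp only: inner_commute)
qed

lemma \<Phi>_diff:
  assumes f: "bounded_borel f" and g: "bounded_borel g"
  shows "\<Phi> (\<lambda>\<sigma>. f \<sigma> - g \<sigma>) x = \<Phi> f x - \<Phi> g x"
proof (rule selfadj_eqI[where S = "\<Phi> (\<lambda>\<sigma>. f \<sigma> - g \<sigma>)" and T = "\<lambda>x. \<Phi> f x - \<Phi> g x"])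
  show "selfadj (\<Phi> (\<lambda>\<sigma>. f \<sigma> - g \<sigma>))" by (rule \<Phi>_selfadj[OF bounded_borel_diff[OF f g]])
  show "selfadj (\<lambda>x. \<Phi> f x - \<Phi> g x)" by (intro selfadj_diff \<Phi>_selfadj f g)
  show "\<Phi> (\<lambda>\<sigma>. f \<sigma> - g \<sigma>) x \<bullet> x = (\<Phi> f x - \<Phi> g x) \<bullet> x" for x
    by (simp add: \<Phi>_form bounded_borel_diff f g inner_diff_left integrable_bounded)
qed

lemma measurable_bounded: "bounded_borel f \<Longrightarrow> f \<in> borel_measurable (\<mu> x)"
  using integrable_bounded by (rule borel_measurable_integrable)

lemma \<Phi>_cong_AE:
  assumes f: "bounded_borel f" and g: "bounded_borel g" and "\<And>x. AE \<sigma> in \<mu> x. f \<sigma> = g \<sigma>"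
  shows "\<Phi> f x = \<Phi> g x"
proof (rule selfadj_eqI[OF \<Phi>_selfadj[OF f] \<Phi>_selfadj[OF g]])
  show "\<Phi> f x \<bullet> x = \<Phi> g x \<bullet> x" for x
    unfolding \<Phi>_form[OF f] \<Phi>_form[OF g]
    by (rule integral_cong_AE[OF measurable_bounded[OF f] measurable_bounded[OF g] assms(3)])
qed

text \<open>By \<open>\<Phi>_norm\<close> the squared distance is the integral of
  \<open>(F n - f)^2\<close> against the finite measure \<open>\<mu> x\<close>, where dominated
  convergence applies.\<close>

lemma \<Phi>_tendsto:
  assumes F: "\<And>n. bounded_borel (F n)" and f: "bounded_borel f"
    and K: "\<And>n \<sigma>. \<bar>F n \<sigma>\<bar> \<le> K" and lim: "\<And>\<sigma>. (\<lambda>n. F n \<sigma>) \<longlonglongrightarrow> f \<sigma>"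
  shows "(\<lambda>n. \<Phi> (F n) x) \<longlonglongrightarrow> \<Phi> f x"
proof -
  interpret finite_measure "\<mu> x" by (rule finite_\<mu>)
  have fK: "\<bar>f \<sigma>\<bar> \<le> K" for \<sigma>
    using K by (intro tendsto_upperbound[OF tendsto_rabs[OF lim]]) auto
  have "(\<lambda>n. \<integral>\<sigma>. (F n \<sigma> - f \<sigma>)\<^sup>2 \<partial>\<mu> x) \<longlonglongrightarrow> (\<integral>\<sigma>. 0 \<partial>\<mu> x)"
  proof (rule integral_dominated_convergence[where w = "\<lambda>_. (2 * K)\<^sup>2"])
    show "(\<lambda>\<sigma>. (F n \<sigma> - f \<sigma>)\<^sup>2) \<in> borel_measurable (\<mu> x)" for n
      by (intro borel_measurable_power measurable_bounded bounded_borel_diff F f)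
    show "AE \<sigma> in \<mu> x. (\<lambda>n. (F n \<sigma> - f \<sigma>)\<^sup>2) \<longlonglongrightarrow> 0"
    proof (rule AE_I2)
      fix \<sigma>
      have "(\<lambda>n. (F n \<sigma> - f \<sigma>)\<^sup>2) \<longlonglongrightarrow> (f \<sigma> - f \<sigma>)\<^sup>2" by (intro tendsto_intros lim)
      then show "(\<lambda>n. (F n \<sigma> - f \<sigma>)\<^sup>2) \<longlonglongrightarrow> 0" by simp
    qed
    show "AE \<sigma> in \<mu> x. norm ((F n \<sigma> - f \<sigma>)\<^sup>2) \<le> (2 * K)\<^sup>2" for n
    proof (rule AE_I2)
      fix \<sigma>
      have "\<bar>F n \<sigma> - f \<sigma>\<bar> \<le> 2 * K" using K[of n \<sigma>] fK[of \<sigma>] by linarith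
      from power_mono[OF this, of 2] show "norm ((F n \<sigma> - f \<sigma>)\<^sup>2) \<le> (2 * K)\<^sup>2" by simp
    qed
  qed simp_all
  then have "(\<lambda>n. sqrt (\<integral>\<sigma>. (F n \<sigma> - f \<sigma>)\<^sup>2 \<partial>\<mu> x)) \<longlonglongrightarrow> sqrt 0"
    by (intro tendsto_real_sqrt) simp
  moreover have "sqrt (\<integral>\<sigma>. (F n \<sigma> - f \<sigma>)\<^sup>2 \<partial>\<mu> x) = norm (\<Phi> (F n) x - \<Phi> f x)" for n
    unfolding \<Phi>_norm[OF bounded_borel_diff[OF F f], symmetric] \<Phi>_diff[OF F f] by simp
  ultimately have "(\<lambda>n. norm (\<Phi> (F n) x - \<Phi> f x)) \<longlonglongrightarrow> 0" by simp
  then show ?thesis using tendsto_norm_zero_iff LIM_zero_cancel by blast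
qed

end

section \<open>Resolutions of a positive contraction\<close>

locale contraction_resolution = pvm E for E :: "real set \<Rightarrow> 'a \<Rightarrow> 'a::{real_inner,banach}" +
  fixes B :: "'a \<Rightarrow> 'a"
  assumes res: "resolves E B"
    and B: "selfadj B" and B_pos: "0 \<le> B x \<bullet> x" and B_le: "B x \<bullet> x \<le> x \<bullet> x"
begin

lemma B_integral: "B x \<bullet> x = (\<integral>\<sigma>. \<sigma> \<partial>\<mu> x)"
  using res by (simp add: resolves_def)

text \<open>By multiplicativity \<open>E (- S)\<close> annihilates \<open>E S x\<close>, so the
  scalar measure of that vector has no mass outside \<open>S\<close>.\<close>

lemma AE_E_range:
  assumes S: "S \<in> sets borel"
  shows "AE \<sigma> in \<mu> (E S x). \<sigma> \<in> S"
proof -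
  have "emeasure (\<mu> (E S x)) (- S) = 0"
    using S by (simp add: emeasure_\<mu> E_mult E_empty)
  then show ?thesis using S by (intro AE_I[of _ _ "- S"]) auto
qed

lemma AE_E_zero:
  assumes S: "S \<in> sets borel" and "E S x = 0"
  shows "AE \<sigma> in \<mu> x. \<sigma> \<notin> S"
proof -
  have "emeasure (\<mu> x) S = 0" using assms by (simp add: emeasure_\<mu>)
  then show ?thesis using S by (intro AE_I[of _ _ S]) auto
qed

lemma AE_False_zero:
  assumes "AE \<sigma> in \<mu> x. False"
  shows "x = 0"
proof -
  have "emeasure (\<mu> x) UNIV = 0"
    using AE_iff_null_sets[of UNIV "\<mu> x"] assms by (auto simp: null_sets_def)
  then have "x \<bullet> x \<le> 0" by (simp add: emeasure_\<mu> E_UNIV ennreal_eq_0_iff)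
  then show ?thesis by (simp add: inner_le_zero_iff)
qed

text \<open>The compact support demanded by \<open>resolves\<close> enters here; it makes the
  integral in \<open>B_integral\<close> a genuine one and not the default value 0.\<close>

lemma integrable_id: "integrable (\<mu> x) (\<lambda>\<sigma>. \<sigma>)"
proof -
  interpret finite_measure "\<mu> x" by (rule finite_\<mu>)
  obtain r where r: "\<And>x. E {-r..r} x = x" using res by (auto simp: resolves_def)
  have "AE \<sigma> in \<mu> (E {-r..r} x). \<sigma> \<in> {-r..r}" by (rule AE_E_range) simp
  then have "AE \<sigma> in \<mu> x. norm \<sigma> \<le> r" unfolding r by (rule eventually_mono) auto
  then show ?thesis by (rule integrable_const_bound) simp
qed

text \<open>The scalar measure of \<open>E {..<0} x\<close> sits on the negative axis, yet its mean
  is a value of the nonnegative form of \<open>B\<close>; this leaves no mass. Above 1 the same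
  argument is run with \<open>\<sigma> - 1\<close> and \<open>B_le\<close>.\<close>

lemma AE_support: "AE \<sigma> in \<mu> x. \<sigma> \<in> {0..1}"
proof -
  have "E {..<0} x = 0"
  proof (rule AE_False_zero)
    let ?y = "E {..<0} x"
    have neg: "AE \<sigma> in \<mu> ?y. \<sigma> \<in> {..<0}" by (rule AE_E_range) simp
    have int: "integrable (\<mu> ?y) (\<lambda>\<sigma>. - \<sigma>)" using integrable_id by simp
    have nn: "AE \<sigma> in \<mu> ?y. 0 \<le> - \<sigma>" using neg by (rule eventually_mono) auto
    have "(\<integral>\<sigma>. - \<sigma> \<partial>\<mu> ?y) \<le> 0" using B_integral[of ?y] B_pos[of ?y] by simp
    then have "(\<integral>\<sigma>. - \<sigma> \<partial>\<mu> ?y) = 0" using integral_nonneg_AE[OF nn] by linarith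
    then have "AE \<sigma> in \<mu> ?y. - \<sigma> = 0" using integral_nonneg_eq_0_iff_AE[OF int nn] by simp
    with neg show "AE \<sigma> in \<mu> ?y. False" by eventually_elim simp
  qed
  then have 1: "AE \<sigma> in \<mu> x. \<sigma> \<notin> {..<0}" by (intro AE_E_zero) auto
  have "E {1<..} x = 0"
  proof (rule AE_False_zero)
    let ?y = "E {1<..} x"
    interpret finite_measure "\<mu> ?y" by (rule finite_\<mu>)
    have large: "AE \<sigma> in \<mu> ?y. \<sigma> \<in> {1<..}" by (rule AE_E_range) simp
    have int: "integrable (\<mu> ?y) (\<lambda>\<sigma>. \<sigma> - 1)" using integrable_id by simp
    have nn: "AE \<sigma> in \<mu> ?y. 0 \<le> \<sigma> - 1" using large by (rule eventually_mono) auto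
    have "(\<integral>\<sigma>. \<sigma> - 1 \<partial>\<mu> ?y) = B ?y \<bullet> ?y - ?y \<bullet> ?y"
      by (subst Bochner_Integration.integral_diff)
        (auto simp: integrable_id B_integral measure_\<mu> E_UNIV)
    then have "(\<integral>\<sigma>. \<sigma> - 1 \<partial>\<mu> ?y) \<le> 0" using B_le[of ?y] by simp
    then have "(\<integral>\<sigma>. \<sigma> - 1 \<partial>\<mu> ?y) = 0" using integral_nonneg_AE[OF nn] by linarith
    then have "AE \<sigma> in \<mu> ?y. \<sigma> - 1 = 0" using integral_nonneg_eq_0_iff_AE[OF int nn] by simp
    with large show "AE \<sigma> in \<mu> ?y. False" by eventually_elim simp
  qed
  then have 2: "AE \<sigma> in \<mu> x. \<sigma> \<notin> {1<..}" by (intro AE_E_zero) auto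
  from 1 2 show ?thesis by eventually_elim auto
qed

text \<open>The identity is unbounded on the line; cut off outside the spectrum it represents
  \<open>B\<close> within the bounded calculus.\<close>

definition \<iota> :: "real \<Rightarrow> real" where
  "\<iota> \<sigma> = \<sigma> * indicator {0..1} \<sigma>"

lemma bounded_borel_\<iota>: "bounded_borel \<iota>"
  unfolding \<iota>_def[abs_def] by (rule bounded_borelI[where K = 1]) (auto simp: indicator_def)

lemma B_eq: "B x = \<Phi> \<iota> x"
proof (rule selfadj_eqI[OF B \<Phi>_selfadj[OF bounded_borel_\<iota>]])
  fix x
  have "(\<integral>\<sigma>. \<sigma> \<partial>\<mu> x) = (\<integral>\<sigma>. \<iota> \<sigma> \<partial>\<mu> x)"
  proof (rule integral_cong_AE)
    show "AE \<sigma> in \<mu> x. \<sigma> = \<iota> \<sigma>"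
      using AE_support[of x] by (rule eventually_mono) (simp add: \<iota>_def)
  qed (simp_all add: measurable_bounded bounded_borel_\<iota>)
  then show "B x \<bullet> x = \<Phi> \<iota> x \<bullet> x" by (simp only: B_integral \<Phi>_form[OF bounded_borel_\<iota>])
qed

lemma norm_\<Phi>_le:
  assumes f: "bounded_borel f" and le: "\<And>\<sigma>. \<sigma> \<in> {0..1} \<Longrightarrow> \<bar>f \<sigma>\<bar> \<le> c" and "0 \<le> c"
  shows "norm (\<Phi> f x) \<le> c * norm x"
proof -
  have "(norm (\<Phi> f x))\<^sup>2 = (\<integral>\<sigma>. f \<sigma> * f \<sigma> \<partial>\<mu> x)"
    unfolding power2_norm_eq_inner by (rule \<Phi>_inner[OF f f])
  also have "\<dots> \<le> c\<^sup>2 * (x \<bullet> x)"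
  proof (rule integral_le_const[OF integrable_bounded[OF bounded_borel_mult[OF f f]]])
    have "f \<sigma> * f \<sigma> \<le> c\<^sup>2" if "\<sigma> \<in> {0..1}" for \<sigma>
      using power_mono[OF le[OF that], of 2] by (simp add: power2_eq_square)
    then show "AE \<sigma> in \<mu> x. f \<sigma> * f \<sigma> \<le> c\<^sup>2"
      using AE_support[of x] by (rule eventually_mono[rotated])
  qed
  also have "\<dots> = (c * norm x)\<^sup>2" by (simp only: power_mult_distrib power2_norm_eq_inner)
  finally show ?thesis by (rule power2_le_imp_le) (simp add: assms(3))
qed

text \<open>Once \<open>n\<close> exceeds \<open>K\<close>, the truncations in
  \<open>borel_calculus\<close> agree with \<open>f\<close> almost everywhere for each
  \<open>\<mu> x\<close>, so the sequence is eventually constant and \<open>lim\<close> has an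
  explicit value.\<close>

lemma calculus_bounded:
  assumes f: "f \<in> borel_measurable borel" and K: "\<And>\<sigma>. \<sigma> \<in> {0..1} \<Longrightarrow> \<bar>f \<sigma>\<bar> \<le> K"
  shows "(\<lambda>n. \<Phi> (\<lambda>\<sigma>. if \<bar>f \<sigma>\<bar> \<le> real n then f \<sigma> else 0) x)
    \<longlonglongrightarrow> \<Phi> (\<lambda>\<sigma>. f \<sigma> * indicator {0..1} \<sigma>) x"
proof (rule tendsto_eventually, rule eventually_sequentiallyI[of "nat \<lceil>K\<rceil>"])
  fix n assume "nat \<lceil>K\<rceil> \<le> n"
  then have n: "K \<le> real n" by linarith
  show "\<Phi> (\<lambda>\<sigma>. if \<bar>f \<sigma>\<bar> \<le> real n then f \<sigma> else 0) x = \<Phi> (\<lambda>\<sigma>. f \<sigma> * indicator {0..1} \<sigma>) x"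
  proof (rule \<Phi>_cong_AE)
    show "bounded_borel (\<lambda>\<sigma>. if \<bar>f \<sigma>\<bar> \<le> real n then f \<sigma> else 0)"
      using f by (intro bounded_borelI[where K = n]) auto
    have "\<bar>f \<sigma> * indicator {0..1} \<sigma>\<bar> \<le> max K 0" for \<sigma>
      using K[of \<sigma>] by (auto simp: indicator_def)
    then show "bounded_borel (\<lambda>\<sigma>. f \<sigma> * indicator {0..1} \<sigma>)"
      using f by (intro bounded_borelI) auto
    have eq: "(if \<bar>f \<sigma>\<bar> \<le> real n then f \<sigma> else 0) = f \<sigma> * indicator {0..1} \<sigma>"
      if "\<sigma> \<in> {0..1}" for \<sigma>
      using K[OF that] n that by simp
    show "AE \<sigma> in \<mu> x. (if \<bar>f \<sigma>\<bar> \<le> real n then f \<sigma> else 0) = f \<sigma> * indicator {0..1} \<sigma>" for x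
      using AE_support[of x] by (rule eventually_mono) (rule eq)
  qed
qed

end

section \<open>Spectral regularisation\<close>

locale hilbert_contraction =
  fixes A :: "'a::{real_inner,banach} \<Rightarrow> 'b::real_inner"
  assumes A: "bounded_linear A" "onorm A \<le> 1"
begin

abbreviation A' :: "'b \<Rightarrow> 'a" where "A' \<equiv> adjoint A"

lemma normal_form: "(A' \<circ> A) x \<bullet> y = A x \<bullet> A y"
  using adjoint_inner[OF A(1), of y "A x"] by (simp add: inner_commute)

lemma normal_selfadj: "selfadj (A' \<circ> A)"
  unfolding selfadj_def
proof (intro conjI allI)
  show "bounded_linear (A' \<circ> A)"
    unfolding o_def by (rule bounded_linear_compose[OF bounded_linear_adjoint[OF A(1)] A(1)])
  show "(A' \<circ> A) x \<bullet> y = x \<bullet> (A' \<circ> A) y" for x y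
    using normal_form[of x y] normal_form[of y x] by (simp add: inner_commute)
qed

lemma normal_pos: "0 \<le> (A' \<circ> A) x \<bullet> x"
  unfolding normal_form by simp

lemma normal_le: "(A' \<circ> A) x \<bullet> x \<le> x \<bullet> x"
proof -
  have "norm (A x) \<le> onorm A * norm x" by (rule onorm[OF A(1)])
  also have "\<dots> \<le> 1 * norm x" using A(2) by (intro mult_right_mono) auto
  finally have "(norm (A x))\<^sup>2 \<le> (norm x)\<^sup>2" by (intro power_mono) auto
  then show ?thesis unfolding normal_form power2_norm_eq_inner .
qed

sublocale contraction_resolution "spectral_resolution (A' \<circ> A)" "A' \<circ> A"
proof -
  \<comment> \<open>Existence is what turns the \<open>SOME\<close> in
    \<open>spectral_resolution\<close> into a resolution.\<close>
  have "\<exists>E. resolves E (A' \<circ> A)" by (rule spectral_theorem[OF normal_selfadj normal_pos normal_le])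
  then have res: "resolves (spectral_resolution (A' \<circ> A)) (A' \<circ> A)"
    unfolding spectral_resolution_def by (rule someI_ex)
  then show "contraction_resolution (spectral_resolution (A' \<circ> A)) (A' \<circ> A)"
    using normal_selfadj normal_pos normal_le
    by unfold_locales (auto simp: resolves_def)
qed

lemma operator_power_eq:
  assumes "0 < s"
  shows "operator_power (A' \<circ> A) s z = \<Phi> (\<lambda>\<sigma>. \<sigma> powr s * indicator {0..1} \<sigma>) z"
  unfolding operator_power_def borel_calculus_def
proof (rule limI, rule calculus_bounded)
  show "\<bar>\<sigma> powr s\<bar> \<le> 1" if "\<sigma> \<in> {0..1}" for \<sigma>
    using that assms powr_mono2[of s \<sigma> 1] by simp
qed measurable

text \<open>\<open>\<parallel>h(A\<^sup>*A) A\<^sup>*\<parallel> = \<parallel>A h(A\<^sup>*A)\<parallel>\<close>, and the square of the latter is the norm of \<open>\<sigma> h(\<sigma>)\<^sup>2\<close> at \<open>A\<^sup>*A\<close>.\<close>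

lemma norm_\<Phi>_adjoint_le:
  assumes h: "bounded_borel h" and le: "\<And>\<sigma>. \<sigma> \<in> {0..1} \<Longrightarrow> \<bar>h \<sigma> * sqrt \<sigma>\<bar> \<le> c" and c: "0 \<le> c"
  shows "norm (\<Phi> h (A' y)) \<le> c * norm y"
proof -
  define w where "w = \<Phi> h (A' y)"
  note bb = bounded_borel_mult[OF bounded_borel_\<iota> h]
  have "(norm (A (\<Phi> h w)))\<^sup>2 = \<Phi> h w \<bullet> (A' \<circ> A) (\<Phi> h w)"
    using normal_form[of "\<Phi> h w" "\<Phi> h w"] by (simp add: power2_norm_eq_inner inner_commute)
  also have "\<dots> = \<Phi> h w \<bullet> \<Phi> (\<lambda>\<sigma>. \<iota> \<sigma> * h \<sigma>) w"
    unfolding B_eq[of "\<Phi> h w"] \<Phi>_mult[OF bounded_borel_\<iota> h] ..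
  also have "\<dots> = (\<integral>\<sigma>. h \<sigma> * (\<iota> \<sigma> * h \<sigma>) \<partial>\<mu> w)" by (rule \<Phi>_inner[OF h bb])
  also have "\<dots> \<le> c\<^sup>2 * (w \<bullet> w)"
  proof (rule integral_le_const[OF integrable_bounded[OF bounded_borel_mult[OF h bb]]])
    have "h \<sigma> * (\<iota> \<sigma> * h \<sigma>) \<le> c\<^sup>2" if "\<sigma> \<in> {0..1}" for \<sigma>
    proof -
      have "h \<sigma> * (\<iota> \<sigma> * h \<sigma>) = (h \<sigma>)\<^sup>2 * (sqrt \<sigma>)\<^sup>2"
      proof -
        have "(sqrt \<sigma>)\<^sup>2 = \<sigma>" "\<iota> \<sigma> = \<sigma>" using that by (simp_all add: \<iota>_def)
        then show ?thesis by (simp only: power2_eq_square[of "h \<sigma>"] mult_ac)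
      qed
      also have "\<dots> = \<bar>h \<sigma> * sqrt \<sigma>\<bar>\<^sup>2" by (simp only: power2_abs power_mult_distrib)
      also have "\<dots> \<le> c\<^sup>2" using le[OF that] by (intro power_mono) auto
      finally show ?thesis .
    qed
    then show "AE \<sigma> in \<mu> w. h \<sigma> * (\<iota> \<sigma> * h \<sigma>) \<le> c\<^sup>2"
      using AE_support[of w] by (rule eventually_mono[rotated])
  qed
  also have "\<dots> = (c * norm w)\<^sup>2" by (simp only: power_mult_distrib power2_norm_eq_inner)
  finally have A_w: "norm (A (\<Phi> h w)) \<le> c * norm w" by (rule power2_le_imp_le) (simp add: c)
  \<comment> \<open>Duality: moving \<open>\<Phi> h\<close> and then \<open>A'\<close> across the
    inner product brings in the bound \<open>A_w\<close>, and one factor \<open>norm w\<close>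
    cancels.\<close>
  have "(norm w)\<^sup>2 = w \<bullet> \<Phi> h (A' y)" by (simp add: w_def power2_norm_eq_inner)
  also have "\<dots> = \<Phi> h w \<bullet> A' y" by (rule selfadjD(2)[OF \<Phi>_selfadj[OF h], symmetric])
  also have "\<dots> = A (\<Phi> h w) \<bullet> y" by (rule adjoint_inner[OF A(1), symmetric])
  also have "\<dots> \<le> norm (A (\<Phi> h w)) * norm y" by (rule norm_cauchy_schwarz)
  also have "\<dots> \<le> (c * norm w) * norm y" using A_w by (rule mult_right_mono) simp
  finally have "norm w * norm w \<le> norm w * (c * norm y)" by (simp add: power2_eq_square mult_ac)
  then have "norm w \<le> c * norm y" using c by (cases "norm w = 0") (auto simp: mult_le_cancel_left)
  then show ?thesis by (simp add: w_def)
qed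

end

section \<open>Filters composed with the adjoint\<close>

locale spectral_filter = hilbert_contraction A for A :: "'a::{real_inner,banach} \<Rightarrow> 'b::real_inner" +
  fixes g :: "real \<Rightarrow> real" and c :: real
  assumes g_meas: "g \<in> borel_measurable (restrict_space borel {0<..1})"
    and g_bound: "\<And>\<sigma>. \<sigma> \<in> {0<..1} \<Longrightarrow> \<bar>g \<sigma> * sqrt \<sigma>\<bar> \<le> c"
begin

definition G :: "real \<Rightarrow> real" where
  "G \<sigma> = (if \<sigma> \<in> {0<..1} then g \<sigma> else 0)"

text \<open>These are the truncations that \<open>borel_calculus\<close> applies to
  \<open>G\<close>, so the limit of \<open>\<Phi> (Gn n) (A' y)\<close> unfolds to
  \<open>spectral_reconstruction A g y\<close>.\<close>

definition Gn :: "nat \<Rightarrow> real \<Rightarrow> real" where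
  "Gn n \<sigma> = (if \<bar>G \<sigma>\<bar> \<le> real n then G \<sigma> else 0)"

lemma c_nonneg: "0 \<le> c"
  using g_bound[of 1] by simp

lemma G_measurable [measurable]: "G \<in> borel_measurable borel"
proof -
  have "(\<lambda>\<sigma>. indicator {0<..1} \<sigma> *\<^sub>R g \<sigma>) \<in> borel_measurable borel"
    using g_meas by (subst (asm) borel_measurable_restrict_space_iff) auto
  also have "(\<lambda>\<sigma>. indicator {0<..1} \<sigma> *\<^sub>R g \<sigma>) = G" by (auto simp: G_def indicator_def)
  finally show ?thesis .
qed

lemma G_sqrt: "\<bar>G \<sigma> * sqrt \<sigma>\<bar> \<le> c"
  using g_bound[of \<sigma>] c_nonneg by (auto simp: G_def)

lemma Gn_sqrt: "\<bar>Gn n \<sigma> * sqrt \<sigma>\<bar> \<le> c"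
  using G_sqrt[of \<sigma>] c_nonneg by (auto simp: Gn_def)

lemma bounded_borel_Gn: "bounded_borel (Gn n)"
  by (rule bounded_borelI[where K = n]) (auto simp: Gn_def[abs_def])

lemma G_\<iota>: "\<bar>G \<sigma> * \<iota> \<sigma>\<bar> \<le> c"
proof (cases "\<sigma> \<in> {0<..1}")
  case True
  then have "\<bar>G \<sigma> * \<iota> \<sigma>\<bar> = \<bar>G \<sigma> * sqrt \<sigma>\<bar> * sqrt \<sigma>" by (simp add: \<iota>_def abs_mult)
  also have "\<dots> \<le> c * 1" using True c_nonneg G_sqrt[of \<sigma>] by (intro mult_mono) auto
  finally show ?thesis by simp
qed (auto simp: G_def c_nonneg)

lemma bounded_borel_G\<iota>: "bounded_borel (\<lambda>\<sigma>. G \<sigma> * \<iota> \<sigma>)"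
  using bounded_borel_measurable[OF bounded_borel_\<iota>] by (intro bounded_borelI[where K = c] G_\<iota>) simp

text \<open>The truncations \<open>G\<^sub>n\<close> have disjoint increments, so \<open>\<parallel>G\<^sub>n v - G\<^sub>m v\<parallel>\<^sup>2\<close> is the increment of the
  bounded monotone sequence \<open>\<parallel>G\<^sub>n v\<parallel>\<^sup>2\<close>.\<close>

lemma reconstruction_tendsto:
  "(\<lambda>n. \<Phi> (Gn n) (A' y)) \<longlonglongrightarrow> spectral_reconstruction A g y"
proof -
  define v where "v = A' y"
  have bound: "norm (\<Phi> (Gn n) v) \<le> c * norm y" for n
    unfolding v_def by (rule norm_\<Phi>_adjoint_le[OF bounded_borel_Gn Gn_sqrt c_nonneg])
  define a where "a n = (norm (\<Phi> (Gn n) v))\<^sup>2" for n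
  have incr: "(norm (\<Phi> (Gn n) v - \<Phi> (Gn m) v))\<^sup>2 = a n - a m" if "m \<le> n" for m n
  proof -
    have sq: "integrable (\<mu> v) (\<lambda>\<sigma>. (Gn k \<sigma>)\<^sup>2)" for k
      using integrable_bounded[OF bounded_borel_mult[OF bounded_borel_Gn bounded_borel_Gn]]
      by (simp add: power2_eq_square)
    have "(norm (\<Phi> (Gn n) v - \<Phi> (Gn m) v))\<^sup>2 = (\<integral>\<sigma>. (Gn n \<sigma> - Gn m \<sigma>)\<^sup>2 \<partial>\<mu> v)"
      unfolding \<Phi>_diff[OF bounded_borel_Gn bounded_borel_Gn, symmetric]
      by (rule \<Phi>_norm[OF bounded_borel_diff[OF bounded_borel_Gn bounded_borel_Gn]])
    \<comment> \<open>Pointwise, \<open>Gn m\<close> is either \<open>Gn n\<close> or 0, so the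
      product of the two is \<open>(Gn m)^2\<close>.\<close>
    also have "\<dots> = (\<integral>\<sigma>. (Gn n \<sigma>)\<^sup>2 - (Gn m \<sigma>)\<^sup>2 \<partial>\<mu> v)"
      using that by (intro Bochner_Integration.integral_cong) (auto simp: Gn_def)
    also have "\<dots> = a n - a m"
      unfolding a_def \<Phi>_norm[OF bounded_borel_Gn] by (rule Bochner_Integration.integral_diff[OF sq sq])
    finally show ?thesis .
  qed
  have mono: "a m \<le> a n" if "m \<le> n" for m n
    using incr[OF that] by (metis diff_ge_0_iff_ge zero_le_power2)
  have "a n \<le> (c * norm y)\<^sup>2" for n unfolding a_def using bound by (rule power_mono) simp
  then have "convergent a"
    using mono by (intro Bseq_monoseq_convergent BseqI'[of _ "(c * norm y)\<^sup>2"])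
      (auto simp: monoseq_def a_def)
  then have "Cauchy a" by (rule convergent_Cauchy)
  have "Cauchy (\<lambda>n. \<Phi> (Gn n) v)"
  proof (rule metric_CauchyI)
    fix e :: real assume e: "0 < e"
    then obtain k where k: "\<And>m n. m \<ge> k \<Longrightarrow> n \<ge> k \<Longrightarrow> \<bar>a m - a n\<bar> < e\<^sup>2"
      using \<open>Cauchy a\<close> unfolding Cauchy_def dist_real_def by (meson zero_less_power)
    have *: "dist (\<Phi> (Gn m) v) (\<Phi> (Gn n) v) < e" if "k \<le> m" "m \<le> n" for m n
    proof -
      have "(norm (\<Phi> (Gn n) v - \<Phi> (Gn m) v))\<^sup>2 < e\<^sup>2"
        unfolding incr[OF that(2)] using k[of n m] that by linarith
      then show ?thesis using e
        by (simp add: dist_norm norm_minus_commute power2_less_imp_less)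
    qed
    show "\<exists>k. \<forall>m\<ge>k. \<forall>n\<ge>k. dist (\<Phi> (Gn m) v) (\<Phi> (Gn n) v) < e"
    proof (intro exI[of _ k] allI impI)
      fix m n assume "k \<le> m" "k \<le> n"
      then show "dist (\<Phi> (Gn m) v) (\<Phi> (Gn n) v) < e"
        using *[of m n] *[of n m] by (cases "m \<le> n") (auto simp: dist_commute)
    qed
  qed
  then have "(\<lambda>n. \<Phi> (Gn n) v) \<longlonglongrightarrow> lim (\<lambda>n. \<Phi> (Gn n) v)"
    by (simp add: Cauchy_convergent_iff convergent_LIMSEQ_iff)
  then show ?thesis
    unfolding spectral_reconstruction_def borel_calculus_def v_def Gn_def[abs_def] G_def .
qed

lemma norm_reconstruction_le: "norm (spectral_reconstruction A g y) \<le> c * norm y"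
  using norm_\<Phi>_adjoint_le[OF bounded_borel_Gn Gn_sqrt c_nonneg]
  by (intro tendsto_upperbound[OF tendsto_norm[OF reconstruction_tendsto]]) auto

lemma bounded_linear_reconstruction: "bounded_linear (spectral_reconstruction A g)"
proof (rule bounded_linear_intro)
  note sa = \<Phi>_selfadj[OF bounded_borel_Gn]
  note adj = linear_simps[OF bounded_linear_adjoint[OF A(1)]]
  show "spectral_reconstruction A g (x + y) = spectral_reconstruction A g x + spectral_reconstruction A g y" for x y
  proof (rule LIMSEQ_unique[OF reconstruction_tendsto])
    show "(\<lambda>n. \<Phi> (Gn n) (A' (x + y))) \<longlonglongrightarrow> spectral_reconstruction A g x + spectral_reconstruction A g y"
      unfolding adj selfadj_simps(1)[OF sa] by (intro tendsto_add reconstruction_tendsto)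
  qed
  show "spectral_reconstruction A g (r *\<^sub>R x) = r *\<^sub>R spectral_reconstruction A g x" for r x
  proof (rule LIMSEQ_unique[OF reconstruction_tendsto])
    show "(\<lambda>n. \<Phi> (Gn n) (A' (r *\<^sub>R x))) \<longlonglongrightarrow> r *\<^sub>R spectral_reconstruction A g x"
      unfolding adj selfadj_simps(3)[OF sa] by (intro tendsto_scaleR tendsto_const reconstruction_tendsto)
  qed
  show "norm (spectral_reconstruction A g y) \<le> norm y * c" for y
    using norm_reconstruction_le[of y] by (simp add: mult.commute)
qed

text \<open>On data from the range of \<open>A\<close> the adjoint contributes a factor
  \<open>\<iota>\<close>. Although \<open>G\<close> may be unbounded, \<open>G \<iota>\<close> is
  bounded by \<open>c\<close>, and \<open>\<Phi>_tendsto\<close> removes the truncation.\<close>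

lemma reconstruction_A: "spectral_reconstruction A g (A x) = \<Phi> (\<lambda>\<sigma>. G \<sigma> * \<iota> \<sigma>) x"
proof (rule LIMSEQ_unique[OF reconstruction_tendsto])
  have "\<Phi> (Gn n) (A' (A x)) = \<Phi> (\<lambda>\<sigma>. Gn n \<sigma> * \<iota> \<sigma>) x" for n
    using B_eq[of x] \<Phi>_mult[OF bounded_borel_Gn bounded_borel_\<iota>] by simp
  moreover have "(\<lambda>n. \<Phi> (\<lambda>\<sigma>. Gn n \<sigma> * \<iota> \<sigma>) x) \<longlonglongrightarrow> \<Phi> (\<lambda>\<sigma>. G \<sigma> * \<iota> \<sigma>) x"
  proof (rule \<Phi>_tendsto[OF bounded_borel_mult[OF bounded_borel_Gn bounded_borel_\<iota>] bounded_borel_G\<iota>])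
    show "\<bar>Gn n \<sigma> * \<iota> \<sigma>\<bar> \<le> c" for n \<sigma>
      using G_\<iota>[of \<sigma>] c_nonneg by (simp add: Gn_def)
    show "(\<lambda>n. Gn n \<sigma> * \<iota> \<sigma>) \<longlonglongrightarrow> G \<sigma> * \<iota> \<sigma>" for \<sigma>
    proof (rule tendsto_eventually, rule eventually_sequentiallyI[of "nat \<lceil>\<bar>G \<sigma>\<bar>\<rceil>"])
      fix n assume "nat \<lceil>\<bar>G \<sigma>\<bar>\<rceil> \<le> n"
      then have "\<bar>G \<sigma>\<bar> \<le> real n" by linarith
      then show "Gn n \<sigma> * \<iota> \<sigma> = G \<sigma> * \<iota> \<sigma>" by (simp add: Gn_def)
    qed
  qed
  ultimately show "(\<lambda>n. \<Phi> (Gn n) (A' (A x))) \<longlonglongrightarrow> \<Phi> (\<lambda>\<sigma>. G \<sigma> * \<iota> \<sigma>) x" by simp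
qed

lemma residual_le:
  assumes s: "0 < s" and D: "0 \<le> D"
    and qual: "\<And>\<sigma>. \<sigma> \<in> {0<..1} \<Longrightarrow> \<bar>(1 - g \<sigma> * \<sigma>) * \<sigma> powr s\<bar> \<le> D"
    and x: "x = operator_power (A' \<circ> A) s z"
  shows "norm (spectral_reconstruction A g (A x) - x) \<le> D * norm z"
proof -
  define p where "p \<sigma> = \<sigma> powr s * indicator {0..1} \<sigma>" for \<sigma> :: real
  have p: "bounded_borel p"
  proof (rule bounded_borelI[where K = 1])
    show "\<bar>p \<sigma>\<bar> \<le> 1" for \<sigma>
      using s powr_mono2[of s \<sigma> 1] by (auto simp: p_def indicator_def)
  qed (simp add: p_def[abs_def])
  note bb = bounded_borel_mult[OF bounded_borel_G\<iota> p]
  have xp: "x = \<Phi> p z" using x operator_power_eq[OF s, of z] by (simp add: p_def[abs_def])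
  have "spectral_reconstruction A g (A x) - x = \<Phi> (\<lambda>\<sigma>. G \<sigma> * \<iota> \<sigma> * p \<sigma> - p \<sigma>) z"
    unfolding reconstruction_A xp \<Phi>_mult[OF bounded_borel_G\<iota> p] \<Phi>_diff[OF bb p] ..
  moreover have "\<bar>G \<sigma> * \<iota> \<sigma> * p \<sigma> - p \<sigma>\<bar> \<le> D" if \<sigma>: "\<sigma> \<in> {0..1}" for \<sigma>
  proof (cases "\<sigma> = 0")
    \<comment> \<open>\<open>qual\<close> does not cover 0, but there \<open>0 powr s = 0\<close>
      makes the symbol vanish.\<close>
    case True
    then show ?thesis using D by (simp add: p_def)
  next
    case False
    then have \<sigma>': "\<sigma> \<in> {0<..1}" using \<sigma> by simp
    have "G \<sigma> * \<iota> \<sigma> * p \<sigma> - p \<sigma> = - ((1 - g \<sigma> * \<sigma>) * \<sigma> powr s)"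
      using \<sigma>' by (simp add: p_def G_def \<iota>_def algebra_simps)
    then show ?thesis using qual[OF \<sigma>'] by simp
  qed
  ultimately show ?thesis
    using norm_\<Phi>_le[OF bounded_borel_diff[OF bb p] _ D] by simp
qed

end

section \<open>Risk bounds\<close>

lemma norm_truncation_le: "norm (truncation x) \<le> 1"
  by (auto simp: truncation_def field_simps)

lemma truncation_measurable [measurable]:
  "truncation \<in> borel_measurable (borel :: 'a::{real_normed_vector,second_countable_topology} measure)"
  unfolding truncation_def[abs_def] by measurable

text \<open>Truncation is the metric projection onto the unit ball. For
  \<open>b = norm u > 1\<close>, expanding the squares reduces the claim to
  \<open>2 * (u \<bullet> x) * (1 - 1 / b) \<le> b^2 - 1\<close>, which follows from
  \<open>u \<bullet> x \<le> b\<close> and \<open>(b - 1)^2 \<ge> 0\<close>.\<close>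

lemma norm_truncation_diff_le:
  fixes u x :: "'a::real_inner"
  assumes "norm x \<le> 1"
  shows "norm (truncation u - x) \<le> norm (u - x)"
proof (cases "norm u \<le> 1")
  case False
  define b where "b = norm u"
  have b: "b > 1" using False by (simp add: b_def)
  have "u \<bullet> x \<le> norm u * norm x" by (rule norm_cauchy_schwarz)
  also have "\<dots> \<le> b * 1" using assms b by (intro mult_mono) (auto simp: b_def)
  finally have ux: "u \<bullet> x \<le> b" by simp
  have uu: "u \<bullet> u = b\<^sup>2" by (simp only: b_def power2_norm_eq_inner)
  have "truncation u = (1 / b) *\<^sub>R u" using b by (simp add: truncation_def b_def inverse_eq_divide)
  then have "(norm (truncation u - x))\<^sup>2 = (1 / b)\<^sup>2 * (u \<bullet> u) - 2 * (1 / b) * (u \<bullet> x) + x \<bullet> x"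
    unfolding power2_norm_eq_inner by (simp add: inner_diff inner_commute power2_eq_square)
  also have "\<dots> = 1 - 2 * (u \<bullet> x) / b + x \<bullet> x" using b by (simp add: uu power_divide)
  also have "\<dots> \<le> b\<^sup>2 - 2 * (u \<bullet> x) + x \<bullet> x"
  proof -
    have "2 * (u \<bullet> x) * (1 - 1 / b) \<le> 2 * b * (1 - 1 / b)"
      using ux b by (intro mult_right_mono) auto
    also have "\<dots> = 2 * b - 2" using b by (simp add: field_simps)
    also have "\<dots> \<le> b\<^sup>2 - 1" using zero_le_power2[of "b - 1"] by (simp add: power2_diff)
    finally show ?thesis by (simp add: algebra_simps)
  qed
  also have "\<dots> = (norm (u - x))\<^sup>2"
    unfolding power2_norm_eq_inner uu[symmetric] by (simp add: inner_diff inner_commute)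
  finally show ?thesis by (rule power2_le_imp_le) simp
qed (simp add: truncation_def)

lemma square_integrable_nn:
  assumes f: "f \<in> borel_measurable M"
    and le: "(\<integral>\<^sup>+\<omega>. ennreal ((norm (f \<omega>))\<^sup>2) \<partial>M) \<le> ennreal c" and "0 \<le> c"
  shows "integrable M (\<lambda>\<omega>. (norm (f \<omega>))\<^sup>2)" "(\<integral>\<omega>. (norm (f \<omega>))\<^sup>2 \<partial>M) \<le> c"
proof -
  show int: "integrable M (\<lambda>\<omega>. (norm (f \<omega>))\<^sup>2)"
  proof (rule integrableI_bounded)
    show "(\<lambda>\<omega>. (norm (f \<omega>))\<^sup>2) \<in> borel_measurable M" using f by measurable
    show "(\<integral>\<^sup>+\<omega>. ennreal (norm ((norm (f \<omega>))\<^sup>2)) \<partial>M) < \<infinity>"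
      using le_less_trans[OF le ennreal_less_top] by simp
  qed
  have "ennreal (\<integral>\<omega>. (norm (f \<omega>))\<^sup>2 \<partial>M) \<le> ennreal c"
    using le nn_integral_eq_integral[OF int] by simp
  then show "(\<integral>\<omega>. (norm (f \<omega>))\<^sup>2 \<partial>M) \<le> c" using \<open>0 \<le> c\<close> by simp
qed

section \<open>Exponential moments and tail bounds\<close>

lemma exp_chord:
  fixes \<kappa> w :: real
  assumes "0 \<le> w" "w \<le> 4"
  shows "exp (\<kappa> / 4 * w) \<le> 1 + (exp \<kappa> - 1) / 4 * w"
proof -
  have "exp ((1 - w / 4) *\<^sub>R 0 + (w / 4) *\<^sub>R \<kappa>) \<le> (1 - w / 4) * exp 0 + (w / 4) * exp \<kappa>"
    by (rule convex_onD[OF exp_convex]) (use assms in auto)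
  then show ?thesis by (simp add: algebra_simps diff_divide_distrib)
qed

text \<open>Chernoff's method: Markov's inequality for the product of exponentials, whose
  expectation factors by independence.\<close>

lemma (in prob_space) exp_moment_tail:
  fixes U :: "nat \<Rightarrow> 'a \<Rightarrow> real"
  assumes indep: "indep_vars (\<lambda>_. borel) U {1..n}"
    and int: "\<And>i. i \<in> {1..n} \<Longrightarrow> integrable M (\<lambda>\<omega>. exp (U i \<omega>))"
    and le: "\<And>i. i \<in> {1..n} \<Longrightarrow> expectation (\<lambda>\<omega>. exp (U i \<omega>)) \<le> exp a"
  shows "prob {\<omega> \<in> space M. real n * a + t \<le> (\<Sum>i=1..n. U i \<omega>)} \<le> exp (- t)"
proof -
  have indep': "indep_vars (\<lambda>_. borel) (\<lambda>i \<omega>. exp (U i \<omega>)) {1..n}"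
    by (rule indep_vars_compose2[OF indep]) simp
  have int': "integrable M (\<lambda>\<omega>. \<Prod>i=1..n. exp (U i \<omega>))"
    by (rule indep_vars_integrable[OF _ indep' int]) simp_all
  have "{\<omega> \<in> space M. real n * a + t \<le> (\<Sum>i=1..n. U i \<omega>)}
      = {\<omega> \<in> space M. exp (real n * a + t) \<le> (\<Prod>i=1..n. exp (U i \<omega>))}"
    by (simp add: exp_sum[symmetric])
  also have "prob \<dots> \<le> expectation (\<lambda>\<omega>. \<Prod>i=1..n. exp (U i \<omega>)) / exp (real n * a + t)"
    by (rule integral_Markov_inequality_measure[OF int', where A = "{}"])
      (auto intro!: AE_I2 prod_nonneg)
  also have "expectation (\<lambda>\<omega>. \<Prod>i=1..n. exp (U i \<omega>)) = (\<Prod>i=1..n. expectation (\<lambda>\<omega>. exp (U i \<omega>)))"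
    by (rule indep_vars_lebesgue_integral[OF _ indep' int]) simp_all
  also have "\<dots> \<le> (\<Prod>i=1..n. exp a)"
    by (intro prod_mono) (auto intro!: le integral_nonneg_AE)
  also have "\<dots> = exp (real n * a)" by (simp add: exp_of_nat_mult)
  also have "exp (real n * a) / exp (real n * a + t) = exp (- t)" by (simp add: exp_add exp_minus field_simps)
  finally show ?thesis by (simp add: divide_right_mono)
qed

text \<open>The chord of \<open>exp\<close> over the loss range \<open>[0,4]\<close> is affine in
  \<open>W i\<close>, so its expectation depends on the mean \<open>L\<close> alone. This produces a
  multiplicative factor on the risk and a remainder of order 1/n. Positive \<open>\<kappa>\<close>
  yields an upper tail, negative \<open>\<kappa>\<close> a lower one.\<close>

lemma (in prob_space) bounded_sum_tail:
  fixes W :: "nat \<Rightarrow> 'a \<Rightarrow> real"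
  assumes indep: "indep_vars (\<lambda>_. borel) W {1..n}"
    and W: "\<And>i. i \<in> {1..n} \<Longrightarrow> AE \<omega> in M. 0 \<le> W i \<omega> \<and> W i \<omega> \<le> 4"
    and L: "\<And>i. i \<in> {1..n} \<Longrightarrow> expectation (W i) = L"
  shows "prob {\<omega> \<in> space M. real n * ((exp \<kappa> - 1) / 4 * L) + t \<le> (\<Sum>i=1..n. \<kappa> / 4 * W i \<omega>)} \<le> exp (- t)"
proof (rule exp_moment_tail)
  show "indep_vars (\<lambda>_. borel) (\<lambda>i \<omega>. \<kappa> / 4 * W i \<omega>) {1..n}"
    by (rule indep_vars_compose2[OF indep]) simp
  fix i assume i: "i \<in> {1..n}"
  have meas [measurable]: "W i \<in> borel_measurable M" using indep i by (auto simp: indep_vars_def)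
  have chord: "AE \<omega> in M. exp (\<kappa> / 4 * W i \<omega>) \<le> 1 + (exp \<kappa> - 1) / 4 * W i \<omega>"
    using W[OF i] by (rule eventually_mono) (use exp_chord in blast)
  have intW: "integrable M (W i)"
  proof (rule integrable_const_bound)
    show "AE \<omega> in M. norm (W i \<omega>) \<le> 4" using W[OF i] by (rule eventually_mono) simp
  qed simp
  show int: "integrable M (\<lambda>\<omega>. exp (\<kappa> / 4 * W i \<omega>))"
  proof (rule integrable_const_bound)
    show "AE \<omega> in M. norm (exp (\<kappa> / 4 * W i \<omega>)) \<le> exp \<bar>\<kappa>\<bar>"
      using W[OF i]
    proof (rule eventually_mono)
      fix \<omega> assume "0 \<le> W i \<omega> \<and> W i \<omega> \<le> 4"
      then have "\<kappa> / 4 * W i \<omega> \<le> \<bar>\<kappa>\<bar> / 4 * 4"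
        by (intro mult_mono) auto
      then show "norm (exp (\<kappa> / 4 * W i \<omega>)) \<le> exp \<bar>\<kappa>\<bar>" by simp
    qed
  qed simp
  have "expectation (\<lambda>\<omega>. exp (\<kappa> / 4 * W i \<omega>)) \<le> expectation (\<lambda>\<omega>. 1 + (exp \<kappa> - 1) / 4 * W i \<omega>)"
    by (intro integral_mono_AE int chord) (use intW in simp)
  also have "\<dots> = 1 + (exp \<kappa> - 1) / 4 * L"
    using intW L[OF i] by (simp add: prob_space)
  \<comment> \<open>Puts the bound into the exponential form that \<open>exp_moment_tail\<close>
    multiplies over the sample.\<close>
  also have "\<dots> \<le> exp ((exp \<kappa> - 1) / 4 * L)" by (rule exp_ge_add_one_self)
  finally show "expectation (\<lambda>\<omega>. exp (\<kappa> / 4 * W i \<omega>)) \<le> exp ((exp \<kappa> - 1) / 4 * L)" .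
qed

lemma has_cond_exp_zero_inner:
  fixes \<epsilon> h :: "'w \<Rightarrow> 'b::{real_inner,banach,second_countable_topology}"
  assumes \<epsilon>: "has_cond_exp M F \<epsilon> (\<lambda>_. 0)"
    and h: "h \<in> borel_measurable F" and K: "\<And>\<omega>. norm (h \<omega>) \<le> K"
  shows "(\<integral>\<omega>. h \<omega> \<bullet> \<epsilon> \<omega> \<partial>M) = 0"
proof -
  have F: "subalgebra M F" and int: "integrable M \<epsilon>"
    and zero: "\<And>S. S \<in> sets F \<Longrightarrow> (LINT \<omega>:S|M. \<epsilon> \<omega>) = 0"
    using \<epsilon> by (auto simp: has_cond_exp_def set_lebesgue_integral_def)
  have [measurable]: "\<epsilon> \<in> borel_measurable M" using int by auto
  have space: "space F = space M" using F by (simp add: subalgebra_def)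
  \<comment> \<open>Vanishing integrals over the sets of \<open>F\<close> extend to simple
    functions, one level set at a time. The factor 2 reappears in the majorant
    \<open>2 * K * norm (\<epsilon> \<omega>)\<close>.\<close>
  obtain s where s: "\<And>i. simple_function F (s i)" "\<And>\<omega>. \<omega> \<in> space F \<Longrightarrow> (\<lambda>i. s i \<omega>) \<longlonglongrightarrow> h \<omega>"
    "\<And>i \<omega>. \<omega> \<in> space F \<Longrightarrow> norm (s i \<omega>) \<le> 2 * norm (h \<omega>)"
    using borel_measurable_implies_sequence_metric[OF h, of 0] unfolding dist_norm diff_zero by blast
  have [measurable]: "h \<in> borel_measurable M" by (rule measurable_from_subalg[OF F h])
  have [measurable]: "s i \<in> borel_measurable M" for i
    by (rule measurable_from_subalg[OF F borel_measurable_simple_function[OF s(1)]])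
  have "(\<integral>\<omega>. s i \<omega> \<bullet> \<epsilon> \<omega> \<partial>M) = 0" for i
  proof -
    define S where "S c = s i -` {c} \<inter> space F" for c
    have S: "S c \<in> sets F" if "c \<in> s i ` space F" for c
      using s(1)[of i] that unfolding S_def simple_function_def by blast
    then have S_M: "S c \<in> sets M" if "c \<in> s i ` space F" for c
      using F that by (auto simp: subalgebra_def)
    have fin: "finite (s i ` space F)" using s(1)[of i] by (simp add: simple_function_def)
    have int_S: "integrable M (\<lambda>\<omega>. indicator (S c) \<omega> *\<^sub>R \<epsilon> \<omega>)" if "c \<in> s i ` space F" for c
      using integrable_mult_indicator[OF S_M[OF that] int] .
    have "(\<integral>\<omega>. s i \<omega> \<bullet> \<epsilon> \<omega> \<partial>M) = (\<integral>\<omega>. (\<Sum>c\<in>s i ` space F. c \<bullet> (indicator (S c) \<omega> *\<^sub>R \<epsilon> \<omega>)) \<partial>M)"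
    proof (rule Bochner_Integration.integral_cong[OF refl])
      fix \<omega> assume \<omega>: "\<omega> \<in> space M"
      have "(\<Sum>c\<in>s i ` space F. c \<bullet> (indicator (S c) \<omega> *\<^sub>R \<epsilon> \<omega>))
          = (\<Sum>c\<in>s i ` space F. if c = s i \<omega> then c \<bullet> \<epsilon> \<omega> else 0)"
        using \<omega> space by (intro sum.cong refl) (auto simp: S_def)
      also have "\<dots> = s i \<omega> \<bullet> \<epsilon> \<omega>" using \<omega> space fin by (simp add: sum.delta)
      finally show "s i \<omega> \<bullet> \<epsilon> \<omega> = (\<Sum>c\<in>s i ` space F. c \<bullet> (indicator (S c) \<omega> *\<^sub>R \<epsilon> \<omega>))" ..
    qed
    also have "\<dots> = (\<Sum>c\<in>s i ` space F. \<integral>\<omega>. c \<bullet> (indicator (S c) \<omega> *\<^sub>R \<epsilon> \<omega>) \<partial>M)"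
      by (intro Bochner_Integration.integral_sum integrable_inner_right int_S)
    also have "\<dots> = (\<Sum>c\<in>s i ` space F. c \<bullet> (LINT \<omega>:S c|M. \<epsilon> \<omega>))"
      unfolding set_lebesgue_integral_def
      by (intro sum.cong refl integral_inner_right int_S)
    also have "\<dots> = 0" using zero[OF S] by (intro sum.neutral ballI) simp
    finally show ?thesis .
  qed
  moreover have "(\<lambda>i. \<integral>\<omega>. s i \<omega> \<bullet> \<epsilon> \<omega> \<partial>M) \<longlonglongrightarrow> (\<integral>\<omega>. h \<omega> \<bullet> \<epsilon> \<omega> \<partial>M)"
  proof (rule integral_dominated_convergence[where w = "\<lambda>\<omega>. 2 * K * norm (\<epsilon> \<omega>)"])
    show "integrable M (\<lambda>\<omega>. 2 * K * norm (\<epsilon> \<omega>))" using int by simp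
    show "AE \<omega> in M. (\<lambda>i. s i \<omega> \<bullet> \<epsilon> \<omega>) \<longlonglongrightarrow> h \<omega> \<bullet> \<epsilon> \<omega>"
      using s(2) space by (intro AE_I2 tendsto_intros) simp
    show "AE \<omega> in M. norm (s i \<omega> \<bullet> \<epsilon> \<omega>) \<le> 2 * K * norm (\<epsilon> \<omega>)" for i
    proof (rule AE_I2)
      fix \<omega> assume "\<omega> \<in> space M"
      then have "norm (s i \<omega>) \<le> 2 * K" using s(3)[of \<omega> i] K[of \<omega>] space by simp
      then have "norm (s i \<omega>) * norm (\<epsilon> \<omega>) \<le> 2 * K * norm (\<epsilon> \<omega>)" by (rule mult_right_mono) simp
      then show "norm (s i \<omega> \<bullet> \<epsilon> \<omega>) \<le> 2 * K * norm (\<epsilon> \<omega>)"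
        using Cauchy_Schwarz_ineq2[of "s i \<omega>" "\<epsilon> \<omega>"] by simp
    qed
  qed measurable
  ultimately show ?thesis by (simp add: LIMSEQ_const_iff)
qed

lemma (in prob_space) nn_cond_exp_const_bound:
  assumes F: "subalgebra M F" and f: "f \<in> borel_measurable M"
    and le: "AE \<omega> in M. nn_cond_exp M F f \<omega> \<le> c"
  shows "(\<integral>\<^sup>+\<omega>. f \<omega> \<partial>M) \<le> c"
proof -
  interpret finite_measure_subalgebra M F
    using F by unfold_locales
  have "(\<integral>\<^sup>+\<omega>. f \<omega> \<partial>M) = (\<integral>\<^sup>+\<omega>. nn_cond_exp M F f \<omega> \<partial>M)"
    using nn_cond_exp_intg[of "\<lambda>_. 1" f] f by simp
  also have "\<dots> \<le> (\<integral>\<^sup>+\<omega>. c \<partial>M)" using le by (rule nn_integral_mono_AE)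
  also have "\<dots> = c" by (simp add: emeasure_space_1)
  finally show ?thesis .
qed

lemma (in prob_space) expected_risk_le:
  fixes A :: "'x::{real_inner,banach,second_countable_topology} \<Rightarrow> 'y::{real_inner,banach,second_countable_topology}"
    and R :: "'y \<Rightarrow> 'x" and X Z :: "'a \<Rightarrow> 'x" and \<epsilon> Y :: "'a \<Rightarrow> 'y"
  assumes A: "bounded_linear A" and R: "bounded_linear R"
    and X: "X \<in> borel_measurable M" and \<epsilon>: "\<epsilon> \<in> borel_measurable M" and Y: "Y \<in> borel_measurable M"
    and Z: "Z \<in> borel_measurable M"
    and model: "AE \<omega> in M. Y \<omega> = A (X \<omega>) + \<epsilon> \<omega>"
    and noise_mean: "has_cond_exp M (sigma_gen M X) \<epsilon> (\<lambda>_. 0)"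
    and noise_var: "(\<integral>\<^sup>+\<omega>. ennreal ((norm (\<epsilon> \<omega>))\<^sup>2) \<partial>M) \<le> ennreal (\<tau>\<^sup>2)"
    and X_bound: "AE \<omega> in M. norm (X \<omega>) \<le> 1"
    and Z_bound: "(\<integral>\<^sup>+\<omega>. ennreal ((norm (Z \<omega>))\<^sup>2) \<partial>M) \<le> ennreal (\<beta>\<^sup>2)"
    and R_bound: "\<And>y. norm (R y) \<le> c * norm y"
    and residual: "AE \<omega> in M. norm (R (A (X \<omega>)) - X \<omega>) \<le> D * norm (Z \<omega>)"
  shows "expected_risk M X Y R \<le> D\<^sup>2 * \<beta>\<^sup>2 + c\<^sup>2 * \<tau>\<^sup>2"
proof -
  define V where "V \<omega> = R (\<epsilon> \<omega>)" for \<omega>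
  \<comment> \<open>\<open>truncation (X \<omega>)\<close> agrees with \<open>X \<omega>\<close>
    almost everywhere. It makes the bias bounded at every point, as
    \<open>has_cond_exp_zero_inner\<close> demands, while keeping it a function of
    \<open>X\<close>.\<close>
  define U where "U \<omega> = R (A (truncation (X \<omega>))) - truncation (X \<omega>)" for \<omega>
  define T where "T = (\<lambda>x. R (A x) - x)"
  have T: "bounded_linear T"
    unfolding T_def by (intro bounded_linear_sub bounded_linear_ident bounded_linear_compose[OF R A])
  obtain K where K: "\<And>x. norm (T x) \<le> norm x * K" "0 < K" using bounded_linear.pos_bounded[OF T] by blast
  have R_meas: "R \<in> borel_measurable borel" and T_meas: "T \<in> borel_measurable borel"
    and adj_meas: "adjoint R \<in> borel_measurable borel"
    using R T bounded_linear_adjoint[OF R]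
    by (auto intro!: borel_measurable_continuous_onI linear_continuous_on)
  have U_T: "U \<omega> = T (truncation (X \<omega>))" for \<omega> by (simp add: U_def T_def)
  have U_K: "norm (U \<omega>) \<le> K" for \<omega>
  proof -
    have "norm (U \<omega>) \<le> norm (truncation (X \<omega>)) * K" unfolding U_T by (rule K)
    also have "\<dots> \<le> 1 * K" using norm_truncation_le K(2) by (intro mult_right_mono) auto
    finally show ?thesis by simp
  qed
  have X_F: "X \<in> borel_measurable (sigma_gen M X)"
    unfolding sigma_gen_def by (rule measurable_vimage_algebra1) simp
  have U_F: "U \<in> borel_measurable (sigma_gen M X)"
    unfolding U_T[abs_def]
    by (intro measurable_compose[OF _ T_meas] measurable_compose[OF X_F truncation_measurable])
  have U_meas: "U \<in> borel_measurable M"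
    unfolding U_T[abs_def]
    by (intro measurable_compose[OF _ T_meas] measurable_compose[OF X truncation_measurable])
  have V_meas: "V \<in> borel_measurable M"
    unfolding V_def[abs_def] by (rule measurable_compose[OF \<epsilon> R_meas])
  note sq_Z = square_integrable_nn[OF Z Z_bound zero_le_power2]
  note sq_\<epsilon> = square_integrable_nn[OF \<epsilon> noise_var zero_le_power2]
  have V_le: "(norm (V \<omega>))\<^sup>2 \<le> c\<^sup>2 * (norm (\<epsilon> \<omega>))\<^sup>2" for \<omega>
    using power_mono[OF R_bound[of "\<epsilon> \<omega>"], where n = 2] by (simp add: V_def power_mult_distrib)
  have int_V: "integrable M (\<lambda>\<omega>. (norm (V \<omega>))\<^sup>2)"
    using V_meas V_le
    by (intro Bochner_Integration.integrable_bound[OF integrable_mult_right[OF sq_\<epsilon>(1), of "c\<^sup>2"]]) auto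
  have int_U: "integrable M (\<lambda>\<omega>. (norm (U \<omega>))\<^sup>2)"
  proof (rule integrable_const_bound)
    show "AE \<omega> in M. norm ((norm (U \<omega>))\<^sup>2) \<le> K\<^sup>2"
      using power_mono[OF U_K, where n = 2] by (intro AE_I2) simp
  qed (use U_meas in measurable)
  have int_UV: "integrable M (\<lambda>\<omega>. U \<omega> \<bullet> V \<omega>)"
  proof (rule Bochner_Integration.integrable_bound[OF Bochner_Integration.integrable_add[OF int_U int_V]])
    show "(\<lambda>\<omega>. U \<omega> \<bullet> V \<omega>) \<in> borel_measurable M" using U_meas V_meas by measurable
    show "AE \<omega> in M. norm (U \<omega> \<bullet> V \<omega>) \<le> norm ((norm (U \<omega>))\<^sup>2 + (norm (V \<omega>))\<^sup>2)"
    proof (rule AE_I2)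
      fix \<omega>
      have "\<bar>U \<omega> \<bullet> V \<omega>\<bar> \<le> norm (U \<omega>) * norm (V \<omega>)" by (rule Cauchy_Schwarz_ineq2)
      also have "\<dots> \<le> (norm (U \<omega>))\<^sup>2 + (norm (V \<omega>))\<^sup>2"
        using sum_squares_bound[of "norm (U \<omega>)" "norm (V \<omega>)"]
          mult_nonneg_nonneg[OF norm_ge_zero[of "U \<omega>"] norm_ge_zero[of "V \<omega>"]] by linarith
      finally show "norm (U \<omega> \<bullet> V \<omega>) \<le> norm ((norm (U \<omega>))\<^sup>2 + (norm (V \<omega>))\<^sup>2)" by simp
    qed
  qed
  have cross: "(\<integral>\<omega>. U \<omega> \<bullet> V \<omega> \<partial>M) = 0"
  proof -
    obtain K' where K': "\<And>x. norm (adjoint R x) \<le> norm x * K'" "0 < K'"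
      using bounded_linear.pos_bounded[OF bounded_linear_adjoint[OF R]] by blast
    \<comment> \<open>The operator is moved onto \<open>U\<close>, since the conditional mean is
      given for \<open>\<epsilon>\<close> and not for \<open>V\<close>.\<close>
    have "(\<integral>\<omega>. adjoint R (U \<omega>) \<bullet> \<epsilon> \<omega> \<partial>M) = 0"
    proof (rule has_cond_exp_zero_inner[OF noise_mean])
      show "(\<lambda>\<omega>. adjoint R (U \<omega>)) \<in> borel_measurable (sigma_gen M X)"
        by (rule measurable_compose[OF U_F adj_meas])
      show "norm (adjoint R (U \<omega>)) \<le> K * K'" for \<omega>
        using K'(1)[of "U \<omega>"] mult_right_mono[OF U_K[of \<omega>], of K'] K'(2) by linarith
    qed
    moreover have "adjoint R (U \<omega>) \<bullet> \<epsilon> \<omega> = U \<omega> \<bullet> V \<omega>" for \<omega>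
      using adjoint_inner[OF R, of "\<epsilon> \<omega>" "U \<omega>"] by (simp add: V_def inner_commute)
    ultimately show ?thesis by simp
  qed
  have sum_sq: "(norm (U \<omega> + V \<omega>))\<^sup>2 = (norm (U \<omega>))\<^sup>2 + 2 * (U \<omega> \<bullet> V \<omega>) + (norm (V \<omega>))\<^sup>2" for \<omega>
    unfolding power2_norm_eq_inner by (simp add: inner_add inner_commute)
  have int_sum: "integrable M (\<lambda>\<omega>. (norm (U \<omega> + V \<omega>))\<^sup>2)"
    unfolding sum_sq by (intro Bochner_Integration.integrable_add integrable_mult_right int_U int_V int_UV)
  have U_eq: "AE \<omega> in M. U \<omega> = R (A (X \<omega>)) - X \<omega>"
    using X_bound by (rule eventually_mono) (simp add: U_def truncation_def)
  have loss: "AE \<omega> in M. trunc_loss (R (Y \<omega>)) (X \<omega>) \<le> (norm (U \<omega> + V \<omega>))\<^sup>2"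
    using U_eq X_bound model
  proof eventually_elim
    fix \<omega> assume 1: "U \<omega> = R (A (X \<omega>)) - X \<omega>" "norm (X \<omega>) \<le> 1" "Y \<omega> = A (X \<omega>) + \<epsilon> \<omega>"
    have "U \<omega> + V \<omega> = R (Y \<omega>) - X \<omega>"
      using 1 by (simp add: V_def linear_simps[OF R])
    moreover have "trunc_loss (R (Y \<omega>)) (X \<omega>) = (norm (truncation (R (Y \<omega>)) - X \<omega>))\<^sup>2"
      using 1 by (simp add: trunc_loss_def truncation_def)
    ultimately show "trunc_loss (R (Y \<omega>)) (X \<omega>) \<le> (norm (U \<omega> + V \<omega>))\<^sup>2"
      using norm_truncation_diff_le[OF 1(2), of "R (Y \<omega>)"] by (simp add: power_mono)
  qed
  have loss_meas: "(\<lambda>\<omega>. trunc_loss (R (Y \<omega>)) (X \<omega>)) \<in> borel_measurable M"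
  proof -
    have [measurable]: "(\<lambda>\<omega>. truncation (R (Y \<omega>))) \<in> borel_measurable M"
      by (intro measurable_compose[OF _ truncation_measurable] measurable_compose[OF Y R_meas])
    have [measurable]: "(\<lambda>\<omega>. truncation (X \<omega>)) \<in> borel_measurable M"
      by (rule measurable_compose[OF X truncation_measurable])
    show ?thesis unfolding trunc_loss_def by measurable
  qed
  have int_loss: "integrable M (\<lambda>\<omega>. trunc_loss (R (Y \<omega>)) (X \<omega>))"
  proof (rule Bochner_Integration.integrable_bound[OF int_sum loss_meas])
    show "AE \<omega> in M. norm (trunc_loss (R (Y \<omega>)) (X \<omega>)) \<le> norm ((norm (U \<omega> + V \<omega>))\<^sup>2)"
      using loss by (rule eventually_mono) (simp add: trunc_loss_def)
  qed
  have "expected_risk M X Y R \<le> (\<integral>\<omega>. (norm (U \<omega> + V \<omega>))\<^sup>2 \<partial>M)"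
    unfolding expected_risk_def by (rule integral_mono_AE[OF int_loss int_sum loss])
  also have "\<dots> = (\<integral>\<omega>. (norm (U \<omega>))\<^sup>2 \<partial>M) + (\<integral>\<omega>. (norm (V \<omega>))\<^sup>2 \<partial>M)"
    unfolding sum_sq by (simp add: int_U int_V int_UV cross)
  also have "(\<integral>\<omega>. (norm (U \<omega>))\<^sup>2 \<partial>M) \<le> D\<^sup>2 * \<beta>\<^sup>2"
  proof -
    have "AE \<omega> in M. (norm (U \<omega>))\<^sup>2 \<le> D\<^sup>2 * (norm (Z \<omega>))\<^sup>2"
      using U_eq residual
    proof eventually_elim
      fix \<omega> assume "U \<omega> = R (A (X \<omega>)) - X \<omega>" "norm (R (A (X \<omega>)) - X \<omega>) \<le> D * norm (Z \<omega>)"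
      then have "norm (U \<omega>) \<le> D * norm (Z \<omega>)" by simp
      from power_mono[OF this, where n = 2] show "(norm (U \<omega>))\<^sup>2 \<le> D\<^sup>2 * (norm (Z \<omega>))\<^sup>2"
        by (simp add: power_mult_distrib)
    qed
    then have "(\<integral>\<omega>. (norm (U \<omega>))\<^sup>2 \<partial>M) \<le> (\<integral>\<omega>. D\<^sup>2 * (norm (Z \<omega>))\<^sup>2 \<partial>M)"
      by (intro integral_mono_AE int_U integrable_mult_right sq_Z)
    also have "\<dots> = D\<^sup>2 * (\<integral>\<omega>. (norm (Z \<omega>))\<^sup>2 \<partial>M)" by simp
    also have "\<dots> \<le> D\<^sup>2 * \<beta>\<^sup>2" using sq_Z(2) by (intro mult_left_mono) auto
    finally show ?thesis .
  qed
  also have "(\<integral>\<omega>. (norm (V \<omega>))\<^sup>2 \<partial>M) \<le> c\<^sup>2 * \<tau>\<^sup>2"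
  proof -
    have "(\<integral>\<omega>. (norm (V \<omega>))\<^sup>2 \<partial>M) \<le> (\<integral>\<omega>. c\<^sup>2 * (norm (\<epsilon> \<omega>))\<^sup>2 \<partial>M)"
      by (intro integral_mono int_V integrable_mult_right sq_\<epsilon> V_le)
    also have "\<dots> = c\<^sup>2 * (\<integral>\<omega>. (norm (\<epsilon> \<omega>))\<^sup>2 \<partial>M)" by simp
    also have "\<dots> \<le> c\<^sup>2 * \<tau>\<^sup>2" using sq_\<epsilon>(2) by (intro mult_left_mono) auto
    finally show ?thesis .
  qed
  finally show ?thesis by simp
qed

section \<open>The optimal parameter and the geometric grid\<close>

lemma grid_factor_mono:
  fixes q Q \<alpha> :: real
  assumes \<alpha>: "\<alpha> > 0" and q: "1 \<le> q" "q \<le> Q"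
  shows "1 / q + q powr (2 * \<alpha>) / (2 * \<alpha>) \<le> 1 / Q + Q powr (2 * \<alpha>) / (2 * \<alpha>)"
proof -
  \<comment> \<open>In logarithmic coordinates the first term loses at most \<open>v - u\<close> and
    the second gains at least \<open>v - u\<close>, both by
    \<open>1 + x \<le> exp x\<close>.\<close>
  define u v where "u = ln q" and "v = ln Q"
  have uv: "0 \<le> u" "u \<le> v" using q by (simp_all add: u_def v_def)
  have qQ: "q = exp u" "Q = exp v" using q by (simp_all add: u_def v_def)
  have "exp (- u) - exp (- v) = exp (- u) * (1 - exp (- (v - u)))"
    by (simp add: right_diff_distrib flip: exp_add)
  also have "\<dots> \<le> 1 * (v - u)"
  proof (intro mult_mono)
    show "1 - exp (- (v - u)) \<le> v - u" using exp_ge_add_one_self[of "- (v - u)"] by linarith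
  qed (use uv in auto)
  finally have 1: "exp (- u) - exp (- v) \<le> v - u" by simp
  have "1 * (2 * \<alpha> * (v - u)) \<le> exp (2 * \<alpha> * u) * (exp (2 * \<alpha> * (v - u)) - 1)"
  proof (intro mult_mono)
    show "2 * \<alpha> * (v - u) \<le> exp (2 * \<alpha> * (v - u)) - 1"
      using exp_ge_add_one_self[of "2 * \<alpha> * (v - u)"] by linarith
  qed (use uv \<alpha> in auto)
  also have "\<dots> = exp (2 * \<alpha> * v) - exp (2 * \<alpha> * u)"
    by (simp add: right_diff_distrib flip: exp_add)
  finally have "v - u \<le> (exp (2 * \<alpha> * v) - exp (2 * \<alpha> * u)) / (2 * \<alpha>)"
    using \<alpha> by (simp add: field_simps)
  with 1 have "exp (- u) + exp (2 * \<alpha> * u) / (2 * \<alpha>) \<le> exp (- v) + exp (2 * \<alpha> * v) / (2 * \<alpha>)"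
    by (simp add: diff_divide_distrib)
  then show ?thesis by (simp add: qQ powr_def exp_minus inverse_eq_divide)
qed

text \<open>\<open>lamstar\<close> is the stationary point in \<open>l\<close> of \<open>C2^2 *
  \<beta>^2 * l powr (2 * \<alpha>) + C1^2 * \<tau>^2 / l\<close>; there the variance term is
  \<open>2 * \<alpha>\<close> times the bias term \<open>K\<close>. Logarithms make both identities
  linear.\<close>

lemma optimal_parameter_balance:
  fixes C1 C2 \<alpha> \<tau> \<beta> lamstar :: real
  assumes pos: "C1 > 0" "C2 > 0" "\<alpha> > 0" "\<tau> > 0" "\<beta> > 0"
    and lamstar: "lamstar = (C1\<^sup>2 / (2 * \<alpha> * C2\<^sup>2)) powr (1 / (2 * \<alpha> + 1))
                            * (\<tau> / \<beta>) powr (2 / (2 * \<alpha> + 1))"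
  defines "K \<equiv> ((C1\<^sup>2 / (2 * \<alpha>)) powr (2 * \<alpha>) * C2\<^sup>2) powr (1 / (2 * \<alpha> + 1))
               * (\<tau> powr (2 * \<alpha>) * \<beta>) powr (2 / (2 * \<alpha> + 1))"
  shows "lamstar > 0" "C2\<^sup>2 * \<beta>\<^sup>2 * lamstar powr (2 * \<alpha>) = K" "C1\<^sup>2 * \<tau>\<^sup>2 / lamstar = 2 * \<alpha> * K"
proof -
  show lam: "lamstar > 0" using pos by (simp add: lamstar)
  have K: "K > 0" using pos by (simp add: K_def)
  define p where "p = 2 * \<alpha> + 1"
  have p: "p > 0" using pos by (simp add: p_def)
  define m where "m = C1\<^sup>2 / (2 * \<alpha>)"
  have m: "m > 0" using pos by (simp add: m_def)
  have "C1\<^sup>2 / (2 * \<alpha> * C2\<^sup>2) = m / C2\<^sup>2" by (simp add: m_def)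
  then have ln_lam: "ln lamstar = (ln m - 2 * ln C2 + 2 * (ln \<tau> - ln \<beta>)) / p"
    unfolding lamstar p_def[symmetric] using pos m p
    by (simp add: ln_mult ln_div ln_powr ln_realpow add_divide_distrib diff_divide_distrib)
  have ln_K: "ln K = (2 * \<alpha> * ln m + 2 * ln C2 + 2 * (2 * \<alpha> * ln \<tau> + ln \<beta>)) / p"
    unfolding K_def p_def[symmetric] m_def[symmetric] using pos m p
    by (simp add: ln_mult ln_div ln_powr ln_realpow add_divide_distrib diff_divide_distrib)
  have "ln (C2\<^sup>2 * \<beta>\<^sup>2 * lamstar powr (2 * \<alpha>)) = 2 * ln C2 + 2 * ln \<beta> + 2 * \<alpha> * ln lamstar"
    using pos lam by (simp add: ln_mult ln_powr ln_realpow)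
  also have "\<dots> = ln K" unfolding ln_lam ln_K using p by (simp add: field_simps) (simp add: p_def algebra_simps)
  finally show "C2\<^sup>2 * \<beta>\<^sup>2 * lamstar powr (2 * \<alpha>) = K" using pos lam K by (subst (asm) ln_inj_iff) auto
  have "ln (m * \<tau>\<^sup>2 / lamstar) = ln m + 2 * ln \<tau> - ln lamstar"
    using pos m lam by (simp add: ln_mult ln_div ln_realpow)
  also have "\<dots> = ln K" unfolding ln_lam ln_K using p by (simp add: field_simps) (simp add: p_def algebra_simps)
  finally have "m * \<tau>\<^sup>2 / lamstar = K" using pos m lam K by (subst (asm) ln_inj_iff) auto
  moreover have "C1\<^sup>2 * \<tau>\<^sup>2 / lamstar = 2 * \<alpha> * (m * \<tau>\<^sup>2 / lamstar)" using pos by (simp add: m_def)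
  ultimately show "C1\<^sup>2 * \<tau>\<^sup>2 / lamstar = 2 * \<alpha> * K" by simp
qed

lemma geometric_grid_point:
  fixes lam :: "nat \<Rightarrow> real"
  assumes N: "N \<ge> 1" and lam1: "lam 1 > 0" and Q: "Q \<ge> 1"
    and geom: "\<And>j. j \<in> {1..N} \<Longrightarrow> lam j = lam 1 * Q ^ (j - 1)"
    and range: "x \<in> {lam 1..lam N}"
  obtains j q where "j \<in> {1..N}" "lam j = q * x" "1 \<le> q" "q \<le> Q"
proof -
  have x: "x > 0" using lam1 range by simp
  \<comment> \<open>Rounding up keeps \<open>q \<ge> 1\<close>, where the risk bound increases in
    \<open>q\<close>. The predecessor of the least admissible index lies below \<open>x\<close>, so
    rounding costs at most a factor \<open>Q\<close>.\<close>
  define j where "j = (LEAST j. 1 \<le> j \<and> x \<le> lam j)"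
  have ex: "1 \<le> N \<and> x \<le> lam N" using N range by simp
  have j: "1 \<le> j" "x \<le> lam j" using LeastI[of "\<lambda>j. 1 \<le> j \<and> x \<le> lam j", OF ex] by (auto simp: j_def)
  have jN: "j \<le> N" unfolding j_def by (rule Least_le) (rule ex)
  have "lam j \<le> Q * x"
  proof (cases "j = 1")
    \<comment> \<open>There is no predecessor, but \<open>x \<ge> lam 1\<close> already gives
      \<open>lam j \<le> x\<close>.\<close>
    case True
    then have "lam j \<le> 1 * x" using range by simp
    also have "\<dots> \<le> Q * x" using Q x by (intro mult_right_mono) auto
    finally show ?thesis .
  next
    case False
    then obtain k where k: "j = Suc k" "1 \<le> k" using j by (cases j) auto
    have "\<not> (1 \<le> k \<and> x \<le> lam k)"
      using not_less_Least[of k "\<lambda>j. 1 \<le> j \<and> x \<le> lam j"] k(1) unfolding j_def[symmetric] by blast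
    then have "lam k < x" using k(2) by simp
    moreover have "lam j = Q * lam k"
      using geom[of j] geom[of k] k jN by (cases k) auto
    ultimately show ?thesis using Q by simp
  qed
  then show ?thesis using that[of j "lam j / x"] j jN x by (simp add: field_simps)
qed

section \<open>Risk of the parameter selected by the empirical risk\<close>

theorem corollary1:
  fixes A :: "'x::{real_inner, banach, second_countable_topology}
              \<Rightarrow> 'y::{real_inner, banach, second_countable_topology}"
    and M :: "'w measure"
    and X Z :: "'w \<Rightarrow> 'x" and \<epsilon> Y :: "'w \<Rightarrow> 'y"
    and Xs :: "nat \<Rightarrow> 'w \<Rightarrow> 'x" and Ys :: "nat \<Rightarrow> 'w \<Rightarrow> 'y"
    and g :: "real \<Rightarrow> real \<Rightarrow> real"
    and lam :: "nat \<Rightarrow> real" and lamhat :: "'w \<Rightarrow> real"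
    and \<tau> \<beta> s C1 C2 \<alpha> Q lamstar \<eta> :: real
    and N n :: nat
  assumes A: "bounded_linear A" "onorm A \<le> 1"
    and M: "prob_space M"
    and rv: "X \<in> borel_measurable M" "\<epsilon> \<in> borel_measurable M" "Y \<in> borel_measurable M"
    and model: "AE \<omega> in M. Y \<omega> = A (X \<omega>) + \<epsilon> \<omega>"
    and noise_mean: "has_cond_exp M (sigma_gen M X) \<epsilon> (\<lambda>_. 0)"
    and \<tau>: "\<tau> > 0"
    and noise_var: "AE \<omega> in M. nn_cond_exp M (sigma_gen M X) (\<lambda>\<omega>. ennreal ((norm (\<epsilon> \<omega>))\<^sup>2)) \<omega>
                      \<le> ennreal (\<tau>\<^sup>2)"
    and X_bound: "AE \<omega> in M. norm (X \<omega>) \<le> 1"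
    and Z: "Z \<in> borel_measurable M"
    and \<beta>: "\<beta> > 0" and s: "s > 0"
    and source: "AE \<omega> in M. X \<omega> = operator_power (adjoint A \<circ> A) s (Z \<omega>)"
    and Z_bound: "(\<integral>\<^sup>+\<omega>. ennreal ((norm (Z \<omega>))\<^sup>2) \<partial>M) \<le> ennreal (\<beta>\<^sup>2)"
    and g_meas: "\<And>l. l > 0 \<Longrightarrow> g l \<in> borel_measurable (restrict_space borel {0<..1})"
    and C1: "C1 > 0" and C2: "C2 > 0" and \<alpha>: "\<alpha> > 0"
    and g_bound: "\<And>l \<sigma>. l > 0 \<Longrightarrow> \<sigma> \<in> {0<..1} \<Longrightarrow> \<bar>g l \<sigma> * sqrt \<sigma>\<bar> \<le> C1 / sqrt l"
    and g_qualification: "\<And>l \<sigma>. l > 0 \<Longrightarrow> \<sigma> \<in> {0<..1} \<Longrightarrow>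
                            \<bar>(1 - g l \<sigma> * \<sigma>) * \<sigma> powr s\<bar> \<le> C2 * l powr \<alpha>"
    and N: "N \<ge> 2"
    and lam1: "lam 1 > 0"
    and lam_mono: "\<And>i j. 1 \<le> i \<Longrightarrow> i \<le> j \<Longrightarrow> j \<le> N \<Longrightarrow> lam i \<le> lam j"
    and Q: "Q = (lam N / lam 1) powr (1 / (real N - 1))"
    and lam_geom: "\<And>j. j \<in> {1..N} \<Longrightarrow> lam j = lam 1 * Q ^ (j - 1)"
    and lamstar: "lamstar = (C1\<^sup>2 / (2 * \<alpha> * C2\<^sup>2)) powr (1 / (2 * \<alpha> + 1))
                            * (\<tau> / \<beta>) powr (2 / (2 * \<alpha> + 1))"
    and lamstar_range: "lamstar \<in> {lam 1..lam N}"
    \<comment> \<open>the sample\<close>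
    and n: "n \<ge> 1"
    and indep: "prob_space.indep_vars M (\<lambda>_. borel \<Otimes>\<^sub>M borel) (\<lambda>i \<omega>. (Ys i \<omega>, Xs i \<omega>)) {1..n}"
    and copies: "\<And>i. i \<in> {1..n} \<Longrightarrow>
                   distr M (borel \<Otimes>\<^sub>M borel) (\<lambda>\<omega>. (Ys i \<omega>, Xs i \<omega>))
                   = distr M (borel \<Otimes>\<^sub>M borel) (\<lambda>\<omega>. (Y \<omega>, X \<omega>))"
    and lamhat_rv: "lamhat \<in> borel_measurable M"
    and lamhat: "\<And>\<omega>. \<omega> \<in> space M \<Longrightarrow>
                   is_arg_min
                     (\<lambda>l. empirical_risk n (\<lambda>i. Xs i \<omega>) (\<lambda>i. Ys i \<omega>)
                            (spectral_reconstruction A (g l)))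
                     (\<lambda>l. l \<in> lam ` {1..N}) (lamhat \<omega>)"
    and \<eta>: "0 < \<eta>" "\<eta> < 1"
  shows "measure M {\<omega> \<in> space M.
           expected_risk M X Y (spectral_reconstruction A (g (lamhat \<omega>)))
           \<le> 2 * (2 * \<alpha> + Q powr (2 * \<alpha> + 1)) / Q
               * ((C1\<^sup>2 / (2 * \<alpha>)) powr (2 * \<alpha>) * C2\<^sup>2) powr (1 / (2 * \<alpha> + 1))
               * (\<tau> powr (2 * \<alpha>) * \<beta>) powr (2 / (2 * \<alpha> + 1))
             + 26 / real n * ln (2 * real N / \<eta>)} \<ge> 1 - \<eta>"
proof -
  interpret prob_space M by (rule M)
  define R where "R l = spectral_reconstruction A (g l)" for l
  define L where "L l = expected_risk M X Y (R l)" for l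
  \<comment> \<open>\<open>snd p\<close> stays untruncated as in \<open>empirical_risk\<close>;
    agreement with the truncated loss holds almost everywhere and is used in
    \<open>W_exp\<close>.\<close>
  define h where "h l p = (norm (truncation (R l (fst p)) - snd p))\<^sup>2" for l and p :: "'y \<times> 'x"
  define W where "W l i \<omega> = h l (Ys i \<omega>, Xs i \<omega>)" for l i \<omega>
  let ?P = "borel \<Otimes>\<^sub>M borel :: ('y \<times> 'x) measure"

  have filter: "spectral_filter A (g l) (C1 / sqrt l)" if "l > 0" for l
    by (intro spectral_filter.intro hilbert_contraction.intro spectral_filter_axioms.intro
        A g_meas[OF that] g_bound[OF that])
  have R_lin: "bounded_linear (R l)" if "l > 0" for l
    unfolding R_def using filter[OF that] by (rule spectral_filter.bounded_linear_reconstruction)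
  have R_meas: "R l \<in> borel_measurable borel" if "l > 0" for l
    by (intro borel_measurable_continuous_onI linear_continuous_on R_lin that)

  have noise: "(\<integral>\<^sup>+\<omega>. ennreal ((norm (\<epsilon> \<omega>))\<^sup>2) \<partial>M) \<le> ennreal (\<tau>\<^sup>2)"
  proof (rule nn_cond_exp_const_bound[OF _ _ noise_var])
    show "subalgebra M (sigma_gen M X)" using noise_mean by (simp add: has_cond_exp_def)
    show "(\<lambda>\<omega>. ennreal ((norm (\<epsilon> \<omega>))\<^sup>2)) \<in> borel_measurable M" using rv(2) by measurable
  qed
  have risk: "L l \<le> C2\<^sup>2 * \<beta>\<^sup>2 * l powr (2 * \<alpha>) + C1\<^sup>2 * \<tau>\<^sup>2 / l" if l: "l > 0" for l
  proof -
    have "AE \<omega> in M. norm (R l (A (X \<omega>)) - X \<omega>) \<le> (C2 * l powr \<alpha>) * norm (Z \<omega>)"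
      using source
    proof (rule eventually_mono)
      fix \<omega> assume "X \<omega> = operator_power (adjoint A \<circ> A) s (Z \<omega>)"
      then show "norm (R l (A (X \<omega>)) - X \<omega>) \<le> (C2 * l powr \<alpha>) * norm (Z \<omega>)"
        unfolding R_def using C2 g_qualification[OF l]
        by (intro spectral_filter.residual_le[OF filter[OF l] s]) auto
    qed
    then have "L l \<le> (C2 * l powr \<alpha>)\<^sup>2 * \<beta>\<^sup>2 + (C1 / sqrt l)\<^sup>2 * \<tau>\<^sup>2"
      unfolding L_def
      using spectral_filter.norm_reconstruction_le[OF filter[OF l]]
      by (intro expected_risk_le[OF A(1) R_lin[OF l] rv Z model noise_mean noise X_bound Z_bound])
        (simp_all add: R_def)
    also have "(C2 * l powr \<alpha>)\<^sup>2 = C2\<^sup>2 * l powr (2 * \<alpha>)"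
    proof -
      have "(l powr \<alpha>)\<^sup>2 = l powr (2 * \<alpha>)" by (simp add: power2_eq_square flip: powr_add)
      then show ?thesis by (simp add: power_mult_distrib)
    qed
    also have "(C1 / sqrt l)\<^sup>2 = C1\<^sup>2 / l" using l by (simp add: power_divide)
    finally show ?thesis by (simp add: mult_ac)
  qed

  have "lam 1 \<le> lam 2" using lam_mono[of 1 2] N by simp
  also have "lam 2 = lam 1 * Q" using lam_geom[of 2] N by simp
  finally have Q1: "1 \<le> Q" using lam1 by simp
  have lam_pos: "lam j > 0" if "j \<in> {1..N}" for j
    using lam_geom[OF that] lam1 Q1 by simp
  define K where "K = ((C1\<^sup>2 / (2 * \<alpha>)) powr (2 * \<alpha>) * C2\<^sup>2) powr (1 / (2 * \<alpha> + 1))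
               * (\<tau> powr (2 * \<alpha>) * \<beta>) powr (2 / (2 * \<alpha> + 1))"
  note balance = optimal_parameter_balance[OF C1 C2 \<alpha> \<tau> \<beta> lamstar, folded K_def]
  have N1: "N \<ge> 1" using N by simp
  obtain j q where j: "j \<in> {1..N}" and q: "lam j = q * lamstar" "1 \<le> q" "q \<le> Q"
    using geometric_grid_point[OF N1 lam1 Q1 lam_geom lamstar_range] by metis
  have L_j: "L (lam j) \<le> (2 * \<alpha> + Q powr (2 * \<alpha> + 1)) / Q * K"
  proof -
    have K0: "K \<ge> 0" by (simp add: K_def)
    have "L (lam j) \<le> C2\<^sup>2 * \<beta>\<^sup>2 * (q * lamstar) powr (2 * \<alpha>) + C1\<^sup>2 * \<tau>\<^sup>2 / (q * lamstar)"
      using risk[OF lam_pos[OF j]] by (simp add: q)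
    also have "(q * lamstar) powr (2 * \<alpha>) = q powr (2 * \<alpha>) * lamstar powr (2 * \<alpha>)"
      by (rule powr_mult)
    also have "C2\<^sup>2 * \<beta>\<^sup>2 * (q powr (2 * \<alpha>) * lamstar powr (2 * \<alpha>))
      = q powr (2 * \<alpha>) * (C2\<^sup>2 * \<beta>\<^sup>2 * lamstar powr (2 * \<alpha>))" by (simp only: mult_ac)
    also have "\<dots> = q powr (2 * \<alpha>) * K" by (simp only: balance(2))
    also have "C1\<^sup>2 * \<tau>\<^sup>2 / (q * lamstar) = (C1\<^sup>2 * \<tau>\<^sup>2 / lamstar) / q" by simp
    also have "\<dots> = 2 * \<alpha> * K / q" by (simp only: balance(3))
    \<comment> \<open>In this product, \<open>q\<close> occurs only in the factor treated by
      \<open>grid_factor_mono\<close>.\<close>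
    also have "q powr (2 * \<alpha>) * K + 2 * \<alpha> * K / q = (1 / q + q powr (2 * \<alpha>) / (2 * \<alpha>)) * (2 * \<alpha> * K)"
      using \<alpha> q by (simp add: field_simps)
    also have "\<dots> \<le> (1 / Q + Q powr (2 * \<alpha>) / (2 * \<alpha>)) * (2 * \<alpha> * K)"
      using \<alpha> K0 by (intro mult_right_mono grid_factor_mono q) auto
    also have "\<dots> = (2 * \<alpha> + Q powr (2 * \<alpha> + 1)) / Q * K"
      using \<alpha> Q1 by (simp add: field_simps powr_add)
    finally show ?thesis .
  qed

  have pair: "(\<lambda>\<omega>. (Y \<omega>, X \<omega>)) \<in> measurable M ?P" using rv by measurable
  have pairs: "(\<lambda>\<omega>. (Ys i \<omega>, Xs i \<omega>)) \<in> measurable M ?P" if "i \<in> {1..n}" for i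
    using indep that by (simp add: indep_vars_def)
  have h_meas: "h l \<in> borel_measurable ?P" if l: "l > 0" for l
  proof -
    have [measurable]: "(\<lambda>p. truncation (R l (fst p))) \<in> borel_measurable ?P"
      by (intro measurable_compose[OF _ truncation_measurable] measurable_compose[OF _ R_meas[OF l]]) measurable
    show ?thesis unfolding h_def by measurable
  qed
  have indep_W: "indep_vars (\<lambda>_. borel) (W l) {1..n}" if l: "l > 0" for l
    unfolding W_def by (rule indep_vars_compose2[OF indep h_meas[OF l]])
  have W_bound: "AE \<omega> in M. 0 \<le> W l i \<omega> \<and> W l i \<omega> \<le> 4" if i: "i \<in> {1..n}" for l i
  proof -
    \<comment> \<open>The unit bound is given for \<open>X\<close>; equality of the joint laws
      carries it over to the copies.\<close>
    have sets: "{p \<in> space ?P. norm (snd p) \<le> 1} \<in> sets ?P" by measurable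
    have "AE p in distr M ?P (\<lambda>\<omega>. (Ys i \<omega>, Xs i \<omega>)). norm (snd p) \<le> 1"
      unfolding copies[OF i] using X_bound by (subst AE_distr_iff[OF pair sets]) simp
    then have "AE \<omega> in M. norm (Xs i \<omega>) \<le> 1" by (subst (asm) AE_distr_iff[OF pairs[OF i] sets]) simp
    then show ?thesis
    proof (rule eventually_mono)
      fix \<omega> assume "norm (Xs i \<omega>) \<le> 1"
      then have "norm (truncation (R l (Ys i \<omega>)) - Xs i \<omega>) \<le> 2"
        using norm_triangle_ineq4[of "truncation (R l (Ys i \<omega>))" "Xs i \<omega>"]
          norm_truncation_le[of "R l (Ys i \<omega>)"] by linarith
      from power_mono[OF this, where n = 2] show "0 \<le> W l i \<omega> \<and> W l i \<omega> \<le> 4" by (simp add: W_def h_def)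
    qed
  qed
  have W_exp: "expectation (W l i) = L l" if l: "l > 0" and i: "i \<in> {1..n}" for l i
  proof -
    have "expectation (W l i) = (\<integral>p. h l p \<partial>distr M ?P (\<lambda>\<omega>. (Ys i \<omega>, Xs i \<omega>)))"
      unfolding W_def using pairs[OF i] h_meas[OF l] by (rule integral_distr[symmetric])
    also have "\<dots> = expectation (\<lambda>\<omega>. h l (Y \<omega>, X \<omega>))"
      unfolding copies[OF i] using pair h_meas[OF l] by (rule integral_distr)
    also have "\<dots> = L l"
      unfolding L_def expected_risk_def
    proof (rule integral_cong_AE)
      show "(\<lambda>\<omega>. h l (Y \<omega>, X \<omega>)) \<in> borel_measurable M"
        by (rule measurable_compose[OF pair h_meas[OF l]])
      have [measurable]: "(\<lambda>\<omega>. truncation (R l (Y \<omega>))) \<in> borel_measurable M"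
        by (intro measurable_compose[OF _ truncation_measurable] measurable_compose[OF rv(3) R_meas[OF l]])
      have [measurable]: "(\<lambda>\<omega>. truncation (X \<omega>)) \<in> borel_measurable M"
        by (rule measurable_compose[OF rv(1) truncation_measurable])
      show "(\<lambda>\<omega>. trunc_loss (R l (Y \<omega>)) (X \<omega>)) \<in> borel_measurable M"
        unfolding trunc_loss_def by measurable
      show "AE \<omega> in M. h l (Y \<omega>, X \<omega>) = trunc_loss (R l (Y \<omega>)) (X \<omega>)"
        using X_bound by (rule eventually_mono) (simp add: h_def trunc_loss_def truncation_def[of "X _"])
    qed
    finally show ?thesis .
  qed
  have tail: "prob {\<omega> \<in> space M. real n * ((exp \<kappa> - 1) / 4 * L l) + t \<le> (\<Sum>i=1..n. \<kappa> / 4 * W l i \<omega>)}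
      \<le> exp (- t)" if "l > 0" for l \<kappa> t
    by (rule bounded_sum_tail[OF indep_W[OF that] W_bound W_exp[OF that]])

  define t where "t = ln (2 * real N / \<eta>)"
  have N\<eta>: "1 \<le> 2 * real N / \<eta>" using N \<eta> by (simp add: field_simps)
  have t: "0 \<le> t" "exp (- t) = \<eta> / (2 * real N)"
    using N\<eta> N \<eta> by (simp_all add: t_def exp_minus)
  \<comment> \<open>One weighted sum serves both tails, as \<open>\<kappa> = ln 2\<close> and
    \<open>\<kappa> = - ln 2\<close> differ in sign only.\<close>
  define S where "S l \<omega> = (\<Sum>i=1..n. ln 2 / 4 * W l i \<omega>)" for l \<omega>
  have W_meas: "W l i \<in> borel_measurable M" if "l > 0" "i \<in> {1..n}" for l i
    using indep_W[OF that(1)] that(2) by (simp add: indep_vars_def)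
  have S_meas: "S l \<in> borel_measurable M" if "l > 0" for l
    unfolding S_def using W_meas[OF that] by (intro borel_measurable_sum borel_measurable_times) auto
  \<comment> \<open>Since \<open>exp (- ln 2) = 1/2\<close>, the mean enters with
    \<open>(1/2 - 1) / 4 = - 1/8\<close>; in \<open>up\<close> it enters with
    \<open>(2 - 1) / 4 = 1/4\<close>.\<close>
  define low where "low k = {\<omega> \<in> space M. S (lam k) \<omega> \<le> real n * (L (lam k) / 8) - t}" for k
  define up where "up = {\<omega> \<in> space M. real n * (L (lam j) / 4) + t \<le> S (lam j) \<omega>}"
  have low_meas: "low k \<in> events" if "k \<in> {1..N}" for k
    unfolding low_def using S_meas[OF lam_pos[OF that]] by measurable
  have up_meas: "up \<in> events"
    unfolding up_def using S_meas[OF lam_pos[OF j]] by measurable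
  have low_prob: "prob (low k) \<le> exp (- t)" if k: "k \<in> {1..N}" for k
  proof -
    have "low k = {\<omega> \<in> space M. real n * ((exp (- ln 2) - 1) / 4 * L (lam k)) + t
        \<le> (\<Sum>i=1..n. - ln 2 / 4 * W (lam k) i \<omega>)}"
      by (auto simp: low_def S_def exp_minus sum_negf algebra_simps)
    then show ?thesis using tail[OF lam_pos[OF k], of "- ln 2" t] by (simp only:)
  qed
  have up_prob: "prob up \<le> exp (- t)"
  proof -
    have "up = {\<omega> \<in> space M. real n * ((exp (ln 2) - 1) / 4 * L (lam j)) + t
        \<le> (\<Sum>i=1..n. ln 2 / 4 * W (lam j) i \<omega>)}"
      by (simp add: up_def S_def)
    then show ?thesis using tail[OF lam_pos[OF j], of "ln 2" t] by (simp only:)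
  qed
  \<comment> \<open>The selected parameter is random, so lower tails are controlled at all grid
    points; the comparison point \<open>lam j\<close> is deterministic and takes a single upper
    tail.\<close>
  define bad where "bad = up \<union> (\<Union>k\<in>{1..N}. low k)"
  have bad_meas: "bad \<in> events" unfolding bad_def using low_meas up_meas by auto
  have "prob bad \<le> prob up + prob (\<Union>k\<in>{1..N}. low k)"
    unfolding bad_def using low_meas up_meas by (intro measure_Un_le) auto
  also have "prob (\<Union>k\<in>{1..N}. low k) \<le> (\<Sum>k\<in>{1..N}. prob (low k))"
    using low_meas by (intro finite_measure_subadditive_finite) auto
  also have "\<dots> \<le> (\<Sum>k\<in>{1..N}. exp (- t))" by (intro sum_mono low_prob)
  also have "\<dots> = real N * exp (- t)" by simp
  finally have "prob bad \<le> exp (- t) + real N * exp (- t)" using up_prob by linarith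
  also have "\<dots> = (1 + real N) / (2 * real N) * \<eta>" using N by (simp add: t field_simps)
  also have "\<dots> \<le> 1 * \<eta>" using N \<eta> by (intro mult_right_mono) (auto simp: field_simps)
  finally have bad_prob: "prob bad \<le> \<eta>" by simp

  define good where "good = {\<omega> \<in> space M. L (lamhat \<omega>)
    \<le> 2 * (2 * \<alpha> + Q powr (2 * \<alpha> + 1)) / Q * K + 26 / real n * t}"
  have lamhat_in: "lamhat \<omega> \<in> lam ` {1..N}" if "\<omega> \<in> space M" for \<omega>
    using lamhat[OF that] by (simp add: is_arg_min_def)
  have good_meas: "good \<in> events"
  proof -
    \<comment> \<open>\<open>lamhat\<close> has finitely many values, so \<open>good\<close> is the
      preimage of a finite set and no regularity of \<open>l \<mapsto> L l\<close> is
      involved.\<close>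
    define Lam where "Lam = {l \<in> lam ` {1..N}. L l \<le> 2 * (2 * \<alpha> + Q powr (2 * \<alpha> + 1)) / Q * K + 26 / real n * t}"
    have "finite Lam" by (simp add: Lam_def)
    then have "Lam \<in> sets borel" by (rule finite_imp_closed[THEN borel_closed])
    moreover have "good = lamhat -` Lam \<inter> space M"
      using lamhat_in by (auto simp: good_def Lam_def)
    ultimately show ?thesis using lamhat_rv by (simp add: measurable_sets)
  qed
  have "space M - good \<subseteq> bad"
  proof
    fix \<omega> assume \<omega>: "\<omega> \<in> space M - good"
    show "\<omega> \<in> bad"
    proof (rule ccontr)
      assume nb: "\<omega> \<notin> bad"
      obtain k where k: "k \<in> {1..N}" "lamhat \<omega> = lam k" using lamhat_in[of \<omega>] \<omega> by auto
      have n0: "real n > 0" using n by simp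
      have emp: "empirical_risk n (\<lambda>i. Xs i \<omega>) (\<lambda>i. Ys i \<omega>) (R l) = 4 / (real n * ln 2) * S l \<omega>" for l
      proof -
        have "S l \<omega> = ln 2 / 4 * (\<Sum>i=1..n. W l i \<omega>)" unfolding S_def sum_distrib_left ..
        then have "(\<Sum>i=1..n. W l i \<omega>) = 4 / ln 2 * S l \<omega>" by (simp only:) simp
        moreover have "empirical_risk n (\<lambda>i. Xs i \<omega>) (\<lambda>i. Ys i \<omega>) (R l) = 1 / real n * (\<Sum>i=1..n. W l i \<omega>)"
          by (simp add: empirical_risk_def W_def h_def)
        ultimately show ?thesis by simp
      qed
      have "\<not> empirical_risk n (\<lambda>i. Xs i \<omega>) (\<lambda>i. Ys i \<omega>) (R (lam j))
          < empirical_risk n (\<lambda>i. Xs i \<omega>) (\<lambda>i. Ys i \<omega>) (R (lam k))"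
        using lamhat[of \<omega>] \<omega> j unfolding is_arg_min_def k(2) R_def by blast
      then have "4 / (real n * ln 2) * S (lam k) \<omega> \<le> 4 / (real n * ln 2) * S (lam j) \<omega>"
        unfolding emp by simp
      then have "S (lam k) \<omega> \<le> S (lam j) \<omega>" using n0 by (simp add: divide_le_cancel)
      moreover have "real n * (L (lam k) / 8) - t < S (lam k) \<omega>"
        using nb \<omega> k by (auto simp: bad_def low_def not_le)
      moreover have "S (lam j) \<omega> < real n * (L (lam j) / 4) + t"
        using nb \<omega> by (auto simp: bad_def up_def not_le)
      \<comment> \<open>Multiplying by 8 turns the factors 1/8 and 1/4 into 1 and 2, and the two
        deviations \<open>t\<close> into \<open>16 * t\<close>.\<close>
      ultimately have "real n * L (lam k) \<le> real n * (2 * L (lam j)) + 16 * t" by linarith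
      then have "L (lam k) \<le> 2 * L (lam j) + 16 * t / real n"
        using n0 by (simp add: field_simps)
      \<comment> \<open>The argument yields 16, which is weakened to the claimed 26.\<close>
      also have "16 * t / real n \<le> 26 * t / real n" using t n0 by (intro divide_right_mono) auto
      finally have "L (lam k) \<le> 2 * L (lam j) + 26 * t / real n" by simp
      also have "2 * L (lam j) \<le> 2 * ((2 * \<alpha> + Q powr (2 * \<alpha> + 1)) / Q * K)" using L_j by simp
      also have "\<dots> = 2 * (2 * \<alpha> + Q powr (2 * \<alpha> + 1)) / Q * K"
        by (simp only: times_divide_eq_left times_divide_eq_right mult.assoc)
      also have "26 * t / real n = 26 / real n * t" by simp
      finally have "L (lamhat \<omega>) \<le> 2 * (2 * \<alpha> + Q powr (2 * \<alpha> + 1)) / Q * K + 26 / real n * t"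
        by (simp only: k(2))
      then have "\<omega> \<in> good" using \<omega> by (simp only: good_def mem_Collect_eq Diff_iff)
      with \<omega> show False by simp
    qed
  qed
  then have "prob (space M - good) \<le> prob bad" using bad_meas by (rule finite_measure_mono)
  then have "1 - \<eta> \<le> prob good" using bad_prob prob_compl[OF good_meas] by linarith
  then show ?thesis by (simp only: good_def L_def R_def K_def t_def mult.assoc)
qed

end
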